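(* For any positive integer $d$, two graphs are $d$-measurement isomorphic if and only if they are $2$-isomorphic.
   Context: A graph $\Gamma$ is a finite set $\mathcal{V}(\Gamma)$ of $v$ vertices together with a set $\mathcal{E}(\Gamma)$ of $e$ edges, where $\mathcal{E}(\Gamma)$ is a set of two-element subsets of $\mathcal{V}(\Gamma)$. Two graphs $\Gamma,\Delta$ are isomorphic if there is a bijection $\varrho:\mathcal{V}(\Gamma)\to\mathcal{V}(\Delta)$ such that $\{x,y\}\in\mathcal{E}(\Gamma)$ iff $\{\varrho(x),\varrho(y)\}\in\mathcal{E}(\Delta)$. For $S\subset\mathcal{E}(\Gamma)$, $\Gamma[S]$ denotes the subgraph induced by $S$: its edge set is $S$ and its vertices are the endpoints of edges in $S$. Split and 1-isomorphism. A cut vertex of a graph is a vertex whose removal disconnects the graph. A split operation breaks a cut vertex into two vertices to produce two disjoint subgraphs. Two graphs are 1-isomorphic if they become isomorphic under a finite sequence of split operations. Reversal and 2-isomorphism. A partition $\{S,T\}$ of $\mathcal{E}(\Gamma)$ is a 2-separation of $\Gamma$ if $|S|\ge 2$, $|T|\ge 2$ and $|\mathcal{V}(\Gamma[S])\cap\mathcal{V}(\Gamma[T])|=2$. Given a 2-separation $\{S,T\}$ with cut pair $\mathcal{V}(\Gamma[S])\cap\mathcal{V}(\Gamma[T])=\{x,y\}$, let $\Gamma'$ be the graph obtained from $\Gamma$ by interchanging in $\Gamma[S]$ the incidences of the edges at $x$ and $y$. Then $\Gamma'$ is said to be obtained from $\Gamma$ by a reversal operation. Two graphs are 2-isomorphic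 if they become 1-isomorphic after a finite sequence of reversals. Measurement sets. $\mathbb{E}^d$ is $d$-dimensional Euclidean space. $C^d(\mathcal{V})$ is the space of configurations of $\mathcal{V}$ in $\mathbb{E}^d$, i.e. of all maps $p:\mathcal{V}\to\mathbb{E}^d$. Once an identification of the edges of $\Gamma$ with the coordinate axes of $\mathbb{R}^e$ is fixed, the length-squared function $\ell_\Gamma:C^d(\mathcal{V}(\Gamma))\to\mathbb{R}^e$ sends $p$ to the vector whose coordinate for the edge $\{u,w\}$ is $|p(u)-p(w)|^2$. The $d$-dimensional measurement set $M_d(\Gamma)\subset\mathbb{R}^e$ is the image of $C^d(\mathcal{V}(\Gamma))$ under $\ell_\Gamma$. Two graphs $\Gamma,\Delta$, both with $e$ edges, are $d$-measurement isomorphic if there are an identification of each edge of $\Gamma$ with an associated coordinate axis of $\mathbb{R}^e$ and an identification of each edge of $\Delta$ with an associated coordinate axis of $\mathbb{R}^e$ under which $M_d(\Gamma)=M_d(\Delta)$.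
   Formalization: The two graphs are assumed to have equally many isolated vertices; otherwise the claim fails: K2 and K2 plus an isolated vertex have the same measurement set but are not 2-isomorphic, since splits and reversals cannot remove a vertex. *)

theory Defs
  imports "HOL-Analysis.Analysis" "HOL-Combinatorics.Transposition"
begin

datatype 'a graph = Graph (verts: "'a set") (edges: "'a set set")

definition graph :: "'a graph \<Rightarrow> bool" where
  "graph \<Gamma> \<longleftrightarrow> finite (verts \<Gamma>) \<and> (\<forall>s \<in> edges \<Gamma>. s \<subseteq> verts \<Gamma> \<and> card s = 2)"

text \<open>Measurement sets do not see isolated vertices, whereas splits and reversals preserve their
  number. Graphs that are compared must therefore have equally many of them.\<close>

definition isolated_verts :: "'a graph \<Rightarrow> 'a set" where
  "isolated_verts \<Gamma> = verts \<Gamma> - \<Union> (edges \<Gamma>)"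

definition isomorphic :: "'a graph \<Rightarrow> 'b graph \<Rightarrow> bool" where
  "isomorphic \<Gamma> \<Delta> \<longleftrightarrow>
     (\<exists>\<rho>. bij_betw \<rho> (verts \<Gamma>) (verts \<Delta>) \<and>
          (\<forall>x \<in> verts \<Gamma>. \<forall>y \<in> verts \<Gamma>. {x, y} \<in> edges \<Gamma> \<longleftrightarrow> {\<rho> x, \<rho> y} \<in> edges \<Delta>))"


subsection \<open>Splits and 1-isomorphism\<close>

definition adj :: "'a graph \<Rightarrow> 'a \<Rightarrow> 'a \<Rightarrow> bool" where
  "adj \<Gamma> u w \<longleftrightarrow> {u, w} \<in> edges \<Gamma>"

definition delete_vertex :: "'a graph \<Rightarrow> 'a \<Rightarrow> 'a graph" where
  "delete_vertex \<Gamma> x = Graph (verts \<Gamma> - {x}) {s \<in> edges \<Gamma>. x \<notin> s}"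

text \<open>Since graphs need not be connected, the removal of \<open>x\<close> disconnects the graph when it separates
  two vertices that were joined by a path before, i.e. when it increases the number of components.\<close>

definition cut_vertex :: "'a graph \<Rightarrow> 'a \<Rightarrow> bool" where
  "cut_vertex \<Gamma> x \<longleftrightarrow> x \<in> verts \<Gamma> \<and>
     (\<exists>u \<in> verts \<Gamma> - {x}. \<exists>w \<in> verts \<Gamma> - {x}.
        (adj \<Gamma>)\<^sup>*\<^sup>* u w \<and> \<not> (adj (delete_vertex \<Gamma> x))\<^sup>*\<^sup>* u w)"

text \<open>The vertex \<open>x\<close> is broken into \<open>x\<close> and a new vertex \<open>x'\<close>, which gives two disjoint subgraphs
  with vertex sets \<open>A \<union> {x}\<close> and \<open>B \<union> {x'}\<close>. Each of the two vertices receives at least one of the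
  edges at \<open>x\<close>.\<close>

definition split_op :: "'a graph \<Rightarrow> 'a graph \<Rightarrow> bool" where
  "split_op \<Gamma> \<Gamma>' \<longleftrightarrow>
     (\<exists>x x' A B. cut_vertex \<Gamma> x \<and> x' \<notin> verts \<Gamma> \<and>
        A \<union> B = verts \<Gamma> - {x} \<and> A \<inter> B = {} \<and>
        (\<forall>a \<in> A. \<forall>b \<in> B. \<not> adj \<Gamma> a b) \<and>
        (\<exists>a \<in> A. adj \<Gamma> x a) \<and> (\<exists>b \<in> B. adj \<Gamma> x b) \<and>
        \<Gamma>' = Graph (insert x' (verts \<Gamma>))
               ({s \<in> edges \<Gamma>. s \<subseteq> insert x A} \<union>
                (\<lambda>s. (id(x := x')) ` s) ` {s \<in> edges \<Gamma>. s \<subseteq> insert x B}))"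

text \<open>Splits need new vertices, which \<^typ>\<open>'a\<close> may fail to provide; the copies on
  \<^typ>\<open>'a \<times> nat\<close> always leave infinitely many unused ones.\<close>

definition copy_graph :: "'a graph \<Rightarrow> ('a \<times> nat) graph" where
  "copy_graph \<Gamma> = Graph ((\<lambda>v. (v, 0)) ` verts \<Gamma>) ((\<lambda>s. (\<lambda>v. (v, 0)) ` s) ` edges \<Gamma>)"

definition one_isomorphic :: "'a graph \<Rightarrow> 'b graph \<Rightarrow> bool" where
  "one_isomorphic \<Gamma> \<Delta> \<longleftrightarrow>
     (\<exists>\<Gamma>' \<Delta>'. split_op\<^sup>*\<^sup>* (copy_graph \<Gamma>) \<Gamma>' \<and> split_op\<^sup>*\<^sup>* (copy_graph \<Delta>) \<Delta>' \<and>
        isomorphic \<Gamma>' \<Delta>')"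


subsection \<open>Reversals and 2-isomorphism\<close>

text \<open>\<open>\<Union> S\<close> is the vertex set of the subgraph induced by the edge set \<open>S\<close>.\<close>

definition two_separation :: "'a graph \<Rightarrow> 'a set set \<Rightarrow> 'a set set \<Rightarrow> bool" where
  "two_separation \<Gamma> S T \<longleftrightarrow>
     S \<union> T = edges \<Gamma> \<and> S \<inter> T = {} \<and> card S \<ge> 2 \<and> card T \<ge> 2 \<and> card (\<Union> S \<inter> \<Union> T) = 2"

text \<open>Here \<open>transpose x y\<close> is the transposition of \<open>x\<close> and \<open>y\<close>, not the transpose of a matrix.\<close>

definition reversal :: "'a graph \<Rightarrow> 'a graph \<Rightarrow> bool" where
  "reversal \<Gamma> \<Gamma>' \<longleftrightarrow>
     (\<exists>S T x y. two_separation \<Gamma> S T \<and> \<Union> S \<inter> \<Union> T = {x, y} \<and>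
        \<Gamma>' = Graph (verts \<Gamma>) ((\<lambda>s. Transposition.transpose x y ` s) ` S \<union> T))"

definition two_isomorphic :: "'a graph \<Rightarrow> 'b graph \<Rightarrow> bool" where
  "two_isomorphic \<Gamma> \<Delta> \<longleftrightarrow>
     (\<exists>\<Gamma>' \<Delta>'. reversal\<^sup>*\<^sup>* \<Gamma> \<Gamma>' \<and> reversal\<^sup>*\<^sup>* \<Delta> \<Delta>' \<and> one_isomorphic \<Gamma>' \<Delta>')"


subsection \<open>Measurement sets\<close>

definition edge_length_sq :: "('a \<Rightarrow> real ^ 'd) \<Rightarrow> 'a set \<Rightarrow> real" where
  "edge_length_sq p s = (THE r. \<exists>u w. s = {u, w} \<and> r = (norm (p u - p w))\<^sup>2)"

lemma edge_length_sq_doubleton: "edge_length_sq p {u, w} = (norm (p u - p w))\<^sup>2"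
  unfolding edge_length_sq_def
  by (rule the_equality) (auto simp: doubleton_eq_iff norm_minus_commute)

text \<open>Vectors of \<open>\<real>\<^sup>e\<close> are functions in \<open>{..<e} \<rightarrow>\<^sub>E UNIV\<close>. An identification \<open>\<phi>\<close> of
  the edges with the coordinate axes is given as the bijection from axes to edges.\<close>

definition edge_labelling :: "'a graph \<Rightarrow> (nat \<Rightarrow> 'a set) \<Rightarrow> bool" where
  "edge_labelling \<Gamma> \<phi> \<longleftrightarrow> bij_betw \<phi> {..<card (edges \<Gamma>)} (edges \<Gamma>)"

definition length_sq_map ::
  "'a graph \<Rightarrow> (nat \<Rightarrow> 'a set) \<Rightarrow> ('a \<Rightarrow> real ^ 'd) \<Rightarrow> (nat \<Rightarrow> real)" where
  "length_sq_map \<Gamma> \<phi> p = (\<lambda>i \<in> {..<card (edges \<Gamma>)}. edge_length_sq p (\<phi> i))"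

text \<open>The dimension \<open>d\<close> is the cardinality of the index type \<^typ>\<open>'d\<close>.\<close>

definition measurement_set ::
  "'d::finite itself \<Rightarrow> 'a graph \<Rightarrow> (nat \<Rightarrow> 'a set) \<Rightarrow> (nat \<Rightarrow> real) set" where
  "measurement_set _ \<Gamma> \<phi> = length_sq_map \<Gamma> \<phi> ` (verts \<Gamma> \<rightarrow>\<^sub>E (UNIV :: (real ^ 'd) set))"

definition measurement_isomorphic ::
  "'d::finite itself \<Rightarrow> 'a graph \<Rightarrow> 'b graph \<Rightarrow> bool" where
  "measurement_isomorphic d \<Gamma> \<Delta> \<longleftrightarrow>
     card (edges \<Gamma>) = card (edges \<Delta>) \<and>
     (\<exists>\<phi> \<psi>. edge_labelling \<Gamma> \<phi> \<and> edge_labelling \<Delta> \<psi> \<and>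
        measurement_set d \<Gamma> \<phi> = measurement_set d \<Delta> \<psi>)"

end

theory Submission
  imports Defs
begin

text \<open>The indicator of a vertex set shows that the minimal edge cuts, and hence all edge cuts,
  can be read off the measurement set, in every dimension. Conversely, the point reflection that exchanges
  the images of the cut pair realizes a reversal without changing edge lengths, and a translation
  realizes a split.

  It remains to prove Whitney's theorem: graphs on the same edge set with the same cuts are related by
  reversals and splits. For one block, argue by induction on the number of edges of a
  multigraph. Without 2-separations every vertex star of one graph is a vertex star of the other, since
  a star whose removal leaves a disconnected matroid gives a 2-separation. A 2-separation of minimal
  size has, possibly after one reversal, two common vertices in both graphs; put a virtual edge
  between them, apply the induction hypothesis to both parts, and glue, which may cost another
  reversal. Reversals of a block extend to the whole graph, and splits finally separate the blocks.

  Working over GF(2) with the space of cuts, 1- and 2-separations become statements about the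
  restrictions of cuts to an edge set, which are the same for both graphs.\<close>


subsection \<open>Cut spaces of multigraphs\<close>

text \<open>Whitney's theorem compares two graphs edge by edge, so both are maps from one label set
  \<open>E\<close> to sets of ends, and reversals, splits and isomorphisms keep the labels. Parallel
  edges are allowed because a virtual edge may be parallel to an existing one. The virtual edge
  borrows a label from the other side of the 2-separation, so the label type need not supply a fresh
  one. The obstacle is that vertices are invisible: the star of a vertex is a cut, but the same edge
  set need not be a star in the other graph. So whatever has to pass from one graph to the other is
  expressed by cuts alone: connectivity, 2-separations, and the cuts of a part with its virtual
  edge. A 2-separation of the cut space need not be one of a given graph. If two disjoint edges of a
  2-connected graph form a cut, they meet the remaining edges in four vertices. The minimal choice
  confines this defect: a minimal 2-separation is connected, and then has exactly two common
  vertices with the rest in either graph, or it is a pair of edges in series, which at most one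
  reversal makes adjacent.\<close>

definition multigraph :: "'e set \<Rightarrow> ('e \<Rightarrow> 'v set) \<Rightarrow> bool" where
  "multigraph E f \<longleftrightarrow> finite E \<and> (\<forall>e\<in>E. card (f e) = 2)"

abbreviation vset :: "('e \<Rightarrow> 'v set) \<Rightarrow> 'e set \<Rightarrow> 'v set" where
  "vset f S \<equiv> \<Union> (f ` S)"

lemma multigraph_finite: "multigraph E f \<Longrightarrow> finite E"
  by (simp add: multigraph_def)

lemma multigraph_subset: "multigraph E f \<Longrightarrow> S \<subseteq> E \<Longrightarrow> multigraph S f"
  by (auto simp: multigraph_def intro: finite_subset)

lemma multigraph_ends:
  assumes "multigraph E f" "e \<in> E"
  obtains a b where "f e = {a, b}" "a \<noteq> b"
  using assms by (auto simp: multigraph_def card_2_iff)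

lemma multigraph_ends_at:
  assumes "multigraph E f" "e \<in> E" "v \<in> f e"
  obtains w where "f e = {v, w}" "v \<noteq> w"
  using multigraph_ends[OF assms(1,2)] assms(3) by (metis insert_commute insert_iff singletonD)

lemma finite_vset: "multigraph E f \<Longrightarrow> S \<subseteq> E \<Longrightarrow> finite (vset f S)"
  unfolding multigraph_def by (metis card.infinite finite_UN finite_subset subsetD zero_neq_numeral)

definition edge_cut :: "'e set \<Rightarrow> ('e \<Rightarrow> 'v set) \<Rightarrow> 'v set \<Rightarrow> 'e set" where
  "edge_cut E f U = {e \<in> E. f e \<inter> U \<noteq> {} \<and> \<not> f e \<subseteq> U}"

text \<open>The empty cut is included, so this is a vector space over GF(2) under
  \<open>sym_diff\<close>. Its minimal nonempty members are the cocircuits of the graphic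
  matroid.\<close>

definition cuts :: "'e set \<Rightarrow> ('e \<Rightarrow> 'v set) \<Rightarrow> 'e set set" where
  "cuts E f = range (edge_cut E f)"

lemma cut_in_cuts [simp, intro]: "edge_cut E f U \<in> cuts E f"
  by (simp add: cuts_def)

lemma cut_subset: "edge_cut E f U \<subseteq> E"
  by (auto simp: edge_cut_def)

lemma cuts_subset: "D \<in> cuts E f \<Longrightarrow> D \<subseteq> E"
  by (auto simp: cuts_def edge_cut_def)

lemma mem_cut_iff: "e \<in> E \<Longrightarrow> f e = {a, b} \<Longrightarrow> e \<in> edge_cut E f U \<longleftrightarrow> (a \<in> U) \<noteq> (b \<in> U)"
  by (auto simp: edge_cut_def)

lemma cut_empty [simp]: "edge_cut E f {} = {}"
  by (auto simp: edge_cut_def)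

lemma empty_in_cuts: "{} \<in> cuts E f"
  by (metis cut_empty cut_in_cuts)

lemma cut_compl: "edge_cut E f (- U) = edge_cut E f U"
  by (auto simp: edge_cut_def)

lemma cut_sym_diff:
  assumes "multigraph E f"
  shows "sym_diff (edge_cut E f U) (edge_cut E f U') = edge_cut E f (sym_diff U U')"
proof (rule set_eqI)
  fix e
  show "e \<in> sym_diff (edge_cut E f U) (edge_cut E f U') \<longleftrightarrow> e \<in> edge_cut E f (sym_diff U U')"
  proof (cases "e \<in> E")
    case True
    then obtain a b where "f e = {a, b}"
      using multigraph_ends[OF assms] by metis
    then show ?thesis
      using True by (simp add: mem_cut_iff) blast
  qed (use cut_subset in fast)
qed

lemma sym_diff_in_cuts:
  "multigraph E f \<Longrightarrow> D \<in> cuts E f \<Longrightarrow> D' \<in> cuts E f \<Longrightarrow> sym_diff D D' \<in> cuts E f"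
  by (force simp: cuts_def cut_sym_diff)

lemma cuts_avoiding:
  assumes "D \<in> cuts E f"
  obtains U where "D = edge_cut E f U" "v \<notin> U"
  using assms cut_compl unfolding cuts_def by (metis ComplD imageE)

lemma cut_star: "multigraph E f \<Longrightarrow> edge_cut E f {v} = {e \<in> E. v \<in> f e}"
proof -
  assume "multigraph E f"
  then have "\<not> f e \<subseteq> {v}" if "e \<in> E" for e
    using multigraph_ends that by (metis insertCI insert_subset singletonD)
  then show ?thesis by (auto simp: edge_cut_def)
qed

lemma cut_Int: "S \<subseteq> E \<Longrightarrow> edge_cut S f U = edge_cut E f U \<inter> S"
  by (auto simp: edge_cut_def)

lemma cuts_restrict: "S \<subseteq> E \<Longrightarrow> cuts S f = (\<lambda>D. D \<inter> S) ` cuts E f"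
  by (auto simp: cuts_def cut_Int image_iff)

section \<open>Separators and 2-separations of the cut space\<close>

definition separator :: "'e set set \<Rightarrow> 'e set \<Rightarrow> bool" where
  "separator W R \<longleftrightarrow> (\<forall>D\<in>W. D \<inter> R \<in> W)"

definition indecomposable :: "'e set set \<Rightarrow> 'e set \<Rightarrow> bool" where
  "indecomposable W E \<longleftrightarrow> (\<forall>R\<subseteq>E. separator W R \<longrightarrow> R = {} \<or> R = E)"

text \<open>\<open>separator\<close> says that the connectivity function of the matroid vanishes at \<open>R\<close>, and
  \<open>two_separator\<close> says that it is at most 1 at \<open>S\<close>: \<open>D \<mapsto> D \<inter> S\<close> has rank at most 1 modulo \<open>W\<close>.\<close>

definition two_separator :: "'e set set \<Rightarrow> 'e set \<Rightarrow> bool" where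
  "two_separator W S \<longleftrightarrow>
     (\<forall>D\<in>W. \<forall>D'\<in>W. D \<inter> S \<in> W \<or> D' \<inter> S \<in> W \<or> sym_diff D D' \<inter> S \<in> W)"

lemma separator_compl:
  assumes "multigraph E f" "R \<subseteq> E" "separator (cuts E f) R"
  shows "separator (cuts E f) (E - R)"
  unfolding separator_def
proof
  fix D assume D: "D \<in> cuts E f"
  then have "sym_diff D (D \<inter> R) \<in> cuts E f"
    using assms by (intro sym_diff_in_cuts) (auto simp: separator_def)
  moreover have "sym_diff D (D \<inter> R) = D \<inter> (E - R)"
    using cuts_subset[OF D] by blast
  ultimately show "D \<inter> (E - R) \<in> cuts E f" by metis
qed

lemma separator_Int: "separator W R \<Longrightarrow> separator W R' \<Longrightarrow> separator W (R \<inter> R')"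
  unfolding separator_def by (metis Int_assoc)

text \<open>Passing to \<open>- U\<close> if necessary, \<open>U\<close> contains neither
  \<open>x\<close> nor \<open>y\<close>. Then edges outside \<open>R\<close> have no end in
  \<open>U \<inter> vset f R\<close>, so this set cuts exactly those edges of \<open>R\<close> that
  \<open>U\<close> cuts.\<close>

lemma cut_Int_two_vertices:
  assumes "R \<subseteq> E" "vset f R \<inter> vset f (E - R) \<subseteq> {x, y}" "x \<in> U \<longleftrightarrow> y \<in> U"
  shows "edge_cut E f U \<inter> R \<in> cuts E f"
proof -
  have *: "edge_cut E f U \<inter> R \<in> cuts E f" if "x \<notin> U" "y \<notin> U" for U
  proof -
    have "edge_cut E f U \<inter> R = edge_cut E f (U \<inter> vset f R)"
    proof (intro set_eqI iffI)
      fix e assume "e \<in> edge_cut E f U \<inter> R"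
      moreover have "f e \<inter> U = f e \<inter> (U \<inter> vset f R)" if "e \<in> R" using that by blast
      ultimately show "e \<in> edge_cut E f (U \<inter> vset f R)"
        unfolding edge_cut_def by blast
    next
      fix e assume e: "e \<in> edge_cut E f (U \<inter> vset f R)"
      then obtain v where "v \<in> f e" "v \<in> U" "v \<in> vset f R" "e \<in> E"
        unfolding edge_cut_def by blast
      moreover have "v \<noteq> x" "v \<noteq> y" using that \<open>v \<in> U\<close> by blast+
      ultimately have "e \<in> R" using assms(2) by blast
      then show "e \<in> edge_cut E f U \<inter> R"
        using e unfolding edge_cut_def by blast
    qed
    then show ?thesis by simp
  qed
  show ?thesis
    using *[of U] *[of "- U"] assms(3) by (auto simp: cut_compl)
qed

lemma separator_one_vertex:
  assumes "R \<subseteq> E" "vset f R \<inter> vset f (E - R) \<subseteq> {q}"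
  shows "separator (cuts E f) R"
  using assms cut_Int_two_vertices[of R E f q q] by (auto simp: separator_def cuts_def)

text \<open>Whether a vertex set separates \<open>x\<close> from \<open>y\<close> is additive over
  GF(2), so one of \<open>U\<close>, \<open>U'\<close> and their symmetric difference does not
  separate them.\<close>

lemma two_separator_two_vertices:
  assumes "multigraph E f" "R \<subseteq> E" "vset f R \<inter> vset f (E - R) \<subseteq> {x, y}"
  shows "two_separator (cuts E f) R"
proof -
  have "edge_cut E f U \<inter> R \<in> cuts E f \<or> edge_cut E f U' \<inter> R \<in> cuts E f \<or>
      sym_diff (edge_cut E f U) (edge_cut E f U') \<inter> R \<in> cuts E f" for U U'
    unfolding cut_sym_diff[OF assms(1)]
    using cut_Int_two_vertices[OF assms(2,3), of U] cut_Int_two_vertices[OF assms(2,3), of U']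
      cut_Int_two_vertices[OF assms(2,3), of "sym_diff U U'"] by blast
  then show ?thesis
    unfolding two_separator_def cuts_def by blast
qed

lemma indecomposable_one_vertex:
  assumes "indecomposable (cuts E f) E" "R \<subseteq> E" "vset f R \<inter> vset f (E - R) \<subseteq> {q}"
  shows "R = {} \<or> R = E"
  using assms separator_one_vertex unfolding indecomposable_def by metis

text \<open>No edge of \<open>B\<close> leaves \<open>Z\<close>, so within \<open>B\<close> the set
  \<open>U \<inter> Z\<close> cuts just the part inside \<open>Z\<close> of what \<open>U\<close>
  cuts. This is how connectivity of the cut space yields connectivity of the graph.\<close>

lemma separator_within:
  assumes "B \<subseteq> E" "separator (cuts E f) B" "edge_cut B f Z = {}"
  shows "separator (cuts E f) {e \<in> B. f e \<subseteq> Z}"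
  unfolding separator_def
proof
  fix D assume "D \<in> cuts E f"
  then obtain U where "D = edge_cut E f U" by (auto simp: cuts_def)
  then have "D \<inter> {e \<in> B. f e \<subseteq> Z} = edge_cut E f (U \<inter> Z) \<inter> B"
    using assms(1,3) unfolding edge_cut_def by blast
  then show "D \<inter> {e \<in> B. f e \<subseteq> Z} \<in> cuts E f"
    using assms(2) by (simp add: separator_def)
qed

section \<open>Blocks as minimal separators\<close>

definition block :: "'e set set \<Rightarrow> 'e set \<Rightarrow> bool" where
  "block W B \<longleftrightarrow> B \<noteq> {} \<and> separator W B \<and> (\<forall>R\<subseteq>B. separator W R \<longrightarrow> R = {} \<or> R = B)"

lemma block_connected:
  assumes "block (cuts E f) B" "B \<subseteq> E" "edge_cut B f Z = {}"
  shows "vset f B \<subseteq> Z \<or> vset f B \<inter> Z = {}"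
proof -
  have "{e \<in> B. f e \<subseteq> Z} = {} \<or> {e \<in> B. f e \<subseteq> Z} = B"
    using assms(1) separator_within[OF assms(2) _ assms(3)] unfolding block_def
    by (metis (no_types, lifting) mem_Collect_eq subsetI)
  then show ?thesis
    using assms(3) unfolding edge_cut_def by blast
qed

lemma indecomposable_block:
  assumes "indecomposable (cuts E f) E" "E \<noteq> {}"
  shows "block (cuts E f) E"
proof -
  have "separator (cuts E f) E"
    using cuts_subset unfolding separator_def by (metis inf.absorb1)
  then show ?thesis
    using assms by (auto simp: indecomposable_def block_def)
qed

lemma indecomposable_connected:
  assumes "indecomposable (cuts E f) E" "edge_cut E f Z = {}"
  shows "vset f E \<subseteq> Z \<or> vset f E \<inter> Z = {}"
  using assms block_connected[OF indecomposable_block] by fastforce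

lemma block_indecomposable:
  assumes "block (cuts E f) B" "B \<subseteq> E"
  shows "indecomposable (cuts B f) B"
  unfolding indecomposable_def
proof (intro allI impI)
  fix R assume R: "R \<subseteq> B" "separator (cuts B f) R"
  have "separator (cuts E f) R"
    unfolding separator_def
  proof
    fix D assume D: "D \<in> cuts E f"
    then have "D \<inter> B \<in> cuts B f"
      using cuts_restrict[OF assms(2), of f] by auto
    then have "D \<inter> B \<inter> R \<in> cuts B f"
      using R by (auto simp: separator_def)
    then obtain D' where "D' \<in> cuts E f" "D \<inter> B \<inter> R = D' \<inter> B"
      using cuts_restrict[OF assms(2), of f] by auto
    moreover have "D \<inter> B \<inter> R = D \<inter> R" using R by blast
    ultimately show "D \<inter> R \<in> cuts E f"
      using assms(1) unfolding block_def separator_def by metis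
  qed
  then show "R = {} \<or> R = B"
    using R assms unfolding block_def by blast
qed

lemma block_subset_or_disjoint:
  assumes "block W B" "separator W R"
  shows "B \<subseteq> R \<or> B \<inter> R = {}"
  using assms separator_Int[of W B R] unfolding block_def by (metis inf_le1 inf.orderI)

text \<open>Descent: a separator that is no block contains a smaller nonempty one, and
  \<open>e\<close> lies in it or in its complement within \<open>R\<close>, which is again a
  separator.\<close>

lemma block_exists:
  assumes "finite R" "separator W R" "e \<in> R" "R \<subseteq> E"
    and compl: "\<And>R. R \<subseteq> E \<Longrightarrow> separator W R \<Longrightarrow> separator W (E - R)"
  shows "\<exists>B. block W B \<and> B \<subseteq> R \<and> e \<in> B"
  using assms(1-4)
proof (induction R rule: finite_psubset_induct)
  case (psubset R)
  show ?case
  proof (cases "block W R")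
    case False
    then obtain R' where R': "R' \<subseteq> R" "separator W R'" "R' \<noteq> {}" "R' \<noteq> R"
      using psubset.prems unfolding block_def by blast
    have sep: "separator W (R \<inter> (E - R'))"
      using psubset.prems R' compl by (intro separator_Int) auto
    show ?thesis
    proof (cases "e \<in> R'")
      case True
      then show ?thesis
        using psubset.IH[of R'] R' psubset.prems by blast
    next
      case False
      then have "e \<in> R \<inter> (E - R')" using psubset.prems by auto
      moreover have "R \<inter> (E - R') \<subset> R" using R' psubset.prems by blast
      ultimately show ?thesis
        using psubset.IH[of "R \<inter> (E - R')"] sep psubset.prems by blast
    qed
  qed (use psubset.prems in blast)
qed

subsection \<open>Edge lengths, reversals and splits\<close>

lemma edge_length_sq_image:
  assumes "card s = 2"
  shows "edge_length_sq p (\<pi> ` s) = edge_length_sq (p \<circ> \<pi>) s"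
  using assms by (auto simp: card_2_iff edge_length_sq_doubleton)

lemma edge_length_sq_cong:
  assumes "card s = 2" "\<And>v. v \<in> s \<Longrightarrow> p v = q v"
  shows "edge_length_sq p s = edge_length_sq q s"
  using assms by (auto simp: card_2_iff edge_length_sq_doubleton)

lemma edge_length_sq_diff:
  assumes "card s = 2"
  shows "edge_length_sq (\<lambda>v. c - p v) s = edge_length_sq p s"
  using assms by (auto simp: card_2_iff edge_length_sq_doubleton norm_minus_commute)

lemma edge_length_sq_plus:
  assumes "card s = 2"
  shows "edge_length_sq (\<lambda>v. p v + c) s = edge_length_sq p s"
  using assms by (auto simp: card_2_iff edge_length_sq_doubleton)

lemma edge_length_sq_eq_0_iff: "edge_length_sq p {a, b} = 0 \<longleftrightarrow> p a = p b"
  by (simp add: edge_length_sq_doubleton)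

section \<open>Edge lengths determine the cuts\<close>

text \<open>One inclusion between two measurement sets whose coordinate axes are the labels in
  \<open>E\<close>. Configurations are total functions, so that no vertex set has to be carried
  along.\<close>

definition lengths_realized ::
  "'d::finite itself \<Rightarrow> 'e set \<Rightarrow> ('e \<Rightarrow> 'v set) \<Rightarrow> ('e \<Rightarrow> 'w set) \<Rightarrow> bool" where
  "lengths_realized _ E f g \<longleftrightarrow>
     (\<forall>p :: 'v \<Rightarrow> real ^ 'd. \<exists>q :: 'w \<Rightarrow> real ^ 'd.
        \<forall>e\<in>E. edge_length_sq q (g e) = edge_length_sq p (f e))"

lemma lengths_realized_trans:
  "lengths_realized d E f g \<Longrightarrow> lengths_realized d E g h \<Longrightarrow> lengths_realized d E f h"
  unfolding lengths_realized_def by metis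

text \<open>A configuration with two positions has nonzero lengths exactly on the cut
  \<open>D\<close>. In a realization by \<open>g\<close>, only edges of nonzero length leave the set
  of vertices at one position, so that set cuts a subset of \<open>D\<close>.\<close>

lemma lengths_realized_subcut:
  fixes d :: "'d::finite itself"
  assumes f: "multigraph E f" and g: "multigraph E g" and r: "lengths_realized d E f g"
    and D: "D \<in> cuts E f" "D \<noteq> {}"
  shows "\<exists>D'\<in>cuts E g. D' \<noteq> {} \<and> D' \<subseteq> D"
proof -
  obtain U where U: "D = edge_cut E f U" using D by (auto simp: cuts_def)
  \<comment> \<open>\<open>1\<close> is the all-ones vector, which differs from \<open>0\<close> in
    every dimension.\<close>
  define p :: "_ \<Rightarrow> real ^ 'd" where "p v = (if v \<in> U then 1 else 0)" for v
  have len: "edge_length_sq p (f e) = 0 \<longleftrightarrow> e \<notin> D" if e: "e \<in> E" for e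
  proof -
    obtain a b where "f e = {a, b}" using multigraph_ends[OF f e] .
    then show ?thesis
      using e by (simp add: edge_length_sq_eq_0_iff U mem_cut_iff p_def)
  qed
  obtain q :: "_ \<Rightarrow> real ^ 'd" where
    q: "\<And>e. e \<in> E \<Longrightarrow> edge_length_sq q (g e) = edge_length_sq p (f e)"
    using r unfolding lengths_realized_def by metis
  obtain e0 where e0: "e0 \<in> D" using D by blast
  then have e0E: "e0 \<in> E" using U by (simp add: edge_cut_def)
  obtain a b where ab: "g e0 = {a, b}" using multigraph_ends[OF g e0E] .
  \<comment> \<open>The vertices at the position of one end of \<open>e0\<close>. As
    \<open>e0\<close> has nonzero length, its other end lies elsewhere, so the cut is
    nonempty.\<close>
  define U' where "U' = {v. q v = q a}"
  have "e0 \<in> edge_cut E g U'"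
    using len[OF e0E] e0 q[OF e0E] 
    by (simp add: mem_cut_iff[where f = g, OF e0E ab] U'_def ab)
      (metis edge_length_sq_eq_0_iff)
  moreover have "edge_cut E g U' \<subseteq> D"
  proof
    fix e assume e: "e \<in> edge_cut E g U'"
    then have eE: "e \<in> E" by (simp add: edge_cut_def)
    obtain a' b' where ab': "g e = {a', b'}" using multigraph_ends[OF g eE] .
    then have "q a' \<noteq> q b'"
      using e by (auto simp: mem_cut_iff[OF eE] U'_def)
    then show "e \<in> D"
      using len[OF eE] q[OF eE] by (simp add: ab') (metis edge_length_sq_eq_0_iff)
  qed
  ultimately show ?thesis by blast
qed

text \<open>A minimal nonempty cut \<open>C\<close> of \<open>f\<close> contains a nonempty cut of
  \<open>g\<close>, which contains one of \<open>f\<close>; by minimality all three agree. Removing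
  such a \<open>C\<close> from \<open>D\<close> leaves a smaller cut of \<open>f\<close>.\<close>

lemma lengths_realized_cuts_subset:
  fixes d :: "'d::finite itself"
  assumes f: "multigraph E f" and g: "multigraph E g"
    and fg: "lengths_realized d E f g" and gf: "lengths_realized d E g f"
  shows "cuts E f \<subseteq> cuts E g"
proof
  fix D assume "D \<in> cuts E f"
  moreover from this have "finite D"
    using cuts_subset multigraph_finite[OF f] finite_subset by metis
  ultimately show "D \<in> cuts E g"
  proof (induction "card D" arbitrary: D rule: less_induct)
    case less
    show ?case
    proof (cases "D = {}")
      case False
      let ?P = "\<lambda>C. C \<in> cuts E f \<and> C \<noteq> {} \<and> C \<subseteq> D"
      define C where "C = arg_min card ?P"
      have C: "?P C" "\<And>C'. ?P C' \<Longrightarrow> card C \<le> card C'"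
        using arg_min_nat_lemma[of ?P D card] less.prems False unfolding C_def by auto
      obtain C' where C': "C' \<in> cuts E g" "C' \<noteq> {}" "C' \<subseteq> C"
        using lengths_realized_subcut[OF f g fg] C by metis
      obtain C'' where C'': "C'' \<in> cuts E f" "C'' \<noteq> {}" "C'' \<subseteq> C'"
        using lengths_realized_subcut[OF g f gf] C' by metis
      have "C'' \<subseteq> C" "finite C" using C' C'' C less.prems finite_subset by blast+
      then have "C'' = C" using C'' C by (metis card_seteq dual_order.trans)
      then have Cg: "C \<in> cuts E g" using C' C'' by (metis subset_antisym)
      have "D - C \<in> cuts E f"
        using sym_diff_in_cuts[OF f less.prems(1), of C] C
        by (metis (no_types, lifting) Diff_eq_empty_iff Un_empty_right)
      moreover have "card (D - C) < card D"
        using C less.prems by (intro psubset_card_mono) blast+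
      ultimately have "D - C \<in> cuts E g"
        using less by blast
      then have "sym_diff (D - C) C \<in> cuts E g"
        using sym_diff_in_cuts[OF g] Cg by metis
      moreover have "sym_diff (D - C) C = D" using C by blast
      ultimately show ?thesis by metis
    qed (simp add: empty_in_cuts)
  qed
qed

lemma lengths_realized_cuts_eq:
  assumes "multigraph E f" "multigraph E g" "lengths_realized d E f g" "lengths_realized d E g f"
  shows "cuts E f = cuts E g"
  using assms by (intro subset_antisym lengths_realized_cuts_subset)

section \<open>Reversals of labelled multigraphs\<close>

definition twist :: "'e set \<Rightarrow> ('e \<Rightarrow> 'v set) \<Rightarrow> ('e \<Rightarrow> 'v set) \<Rightarrow> bool" where
  "twist E f g \<longleftrightarrow>
     (\<exists>S T x y. S \<union> T = E \<and> S \<inter> T = {} \<and> card S \<ge> 2 \<and> card T \<ge> 2 \<and> x \<noteq> y \<and>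
        vset f S \<inter> vset f T = {x, y} \<and>
        (\<forall>e\<in>S. g e = Transposition.transpose x y ` f e) \<and> (\<forall>e\<in>T. g e = f e))"

lemma transpose_image_vset:
  assumes "x \<in> A" "y \<in> A"
  shows "Transposition.transpose x y ` A = A"
  using assms by (simp add: transpose_image_eq)

text \<open>Since \<open>x\<close> and \<open>y\<close> are both vertices of \<open>S\<close>, the
  transposition maps the vertex set of \<open>S\<close> to itself. The common vertices thus stay the
  same, and the same transposition undoes the reversal.\<close>

lemma twist_sym:
  assumes "twist E f g"
  shows "twist E g f"
proof -
  obtain S T x y where *: "S \<union> T = E" "S \<inter> T = {}" "card S \<ge> 2" "card T \<ge> 2" "x \<noteq> y"
    "vset f S \<inter> vset f T = {x, y}"
    "\<And>e. e \<in> S \<Longrightarrow> g e = Transposition.transpose x y ` f e" "\<And>e. e \<in> T \<Longrightarrow> g e = f e"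
    using assms unfolding twist_def by metis
  have "vset g S = Transposition.transpose x y ` vset f S"
    using *(7) by (simp add: image_UN)
  also have "\<dots> = vset f S"
    using *(6) by (intro transpose_image_vset) blast+
  finally have "vset g S \<inter> vset g T = {x, y}"
    using *(6,8) by simp
  moreover have "f e = Transposition.transpose x y ` g e" if "e \<in> S" for e
    using *(7)[OF that] by (simp add: image_image)
  ultimately show ?thesis
    unfolding twist_def using *(1-5,8) by metis
qed

lemma twist_vset:
  assumes "twist E f g"
  shows "vset g E = vset f E"
proof -
  obtain S T x y where *: "S \<union> T = E"
    "vset f S \<inter> vset f T = {x, y}"
    "\<And>e. e \<in> S \<Longrightarrow> g e = Transposition.transpose x y ` f e" "\<And>e. e \<in> T \<Longrightarrow> g e = f e"
    using assms unfolding twist_def by metis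
  have "vset g S = Transposition.transpose x y ` vset f S"
    using *(3) by (simp add: image_UN)
  also have "\<dots> = vset f S"
    using *(2) by (intro transpose_image_vset) blast+
  finally have "vset g S = vset f S" .
  moreover have "vset g T = vset f T" using *(4) by simp
  ultimately show ?thesis
    using *(1) by (metis Union_Un_distrib image_Un)
qed

lemma twist_multigraph:
  assumes "multigraph E f" "twist E f g"
  shows "multigraph E g"
proof -
  have "card (Transposition.transpose x y ` s) = card s" for x y :: 'b and s
    by (intro card_image) (metis inj_on_subset inj_transpose subset_UNIV)
  then show ?thesis
    using assms unfolding multigraph_def twist_def by (metis UnE)
qed

lemma twist_lengths_realized:
  fixes d :: "'d::finite itself"
  assumes f: "multigraph E f" and "twist E f g"
  shows "lengths_realized d E f g"
  unfolding lengths_realized_def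
proof
  fix p :: "_ \<Rightarrow> real ^ 'd"
  obtain S T x y where *: "S \<union> T = E" "x \<noteq> y"
    "vset f S \<inter> vset f T = {x, y}"
    "\<And>e. e \<in> S \<Longrightarrow> g e = Transposition.transpose x y ` f e" "\<And>e. e \<in> T \<Longrightarrow> g e = f e"
    using assms(2) unfolding twist_def by metis
  have card: "card (f e) = 2" if "e \<in> E" for e using f that by (simp add: multigraph_def)
  \<comment> \<open>Reflect the vertices of \<open>S\<close> in the midpoint of \<open>p x\<close> and \<open>p y\<close>.\<close>
  define q where "q v = (if v \<in> vset f S - {x, y} then p x + p y - p v else p v)" for v
  have "edge_length_sq q (g e) = edge_length_sq p (f e)" if e: "e \<in> E" for e
  proof (cases "e \<in> S")
    case True
    have "edge_length_sq q (g e) = edge_length_sq (q \<circ> Transposition.transpose x y) (f e)"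
      using True *(4) card[OF e] by (simp add: edge_length_sq_image)
    also have "\<dots> = edge_length_sq (\<lambda>v. p x + p y - p v) (f e)"
      using True *(2) by (intro edge_length_sq_cong card[OF e])
        (auto simp: q_def Transposition.transpose_def)
    also have "\<dots> = edge_length_sq p (f e)"
      by (rule edge_length_sq_diff[OF card[OF e]])
    finally show ?thesis .
  next
    case False
    then have "e \<in> T" using e *(1) by blast
    moreover have "edge_length_sq q (f e) = edge_length_sq p (f e)"
      using \<open>e \<in> T\<close> *(3) by (intro edge_length_sq_cong card[OF e]) (auto simp: q_def)
    ultimately show ?thesis using *(5) by simp
  qed
  then show "\<exists>q :: _ \<Rightarrow> real ^ 'd. \<forall>e\<in>E. edge_length_sq q (g e) = edge_length_sq p (f e)"
    by (intro exI[of _ q]) simp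
qed

text \<open>Cuts need not be traced through the transposition: lengths are realized in both
  directions, and they determine the cuts. One dimension is enough for this, hence
  \<open>TYPE(1)\<close>. Splits and isomorphisms are treated alike below.\<close>

lemma twist_cuts:
  assumes "multigraph E f" "twist E f g"
  shows "cuts E g = cuts E f"
proof -
  have g: "multigraph E g" by (rule twist_multigraph[OF assms])
  show ?thesis
    using lengths_realized_cuts_eq[OF g assms(1) twist_lengths_realized[OF g twist_sym[OF assms(2)]]
        twist_lengths_realized[OF assms, where d = "TYPE(1)"]] .
qed

section \<open>Splits of labelled multigraphs\<close>

definition vertex_split ::
  "'e set \<Rightarrow> ('e \<Rightarrow> 'v set) \<Rightarrow> 'v \<Rightarrow> 'v \<Rightarrow> 'e set \<Rightarrow> ('e \<Rightarrow> 'v set) \<Rightarrow> bool" where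
  "vertex_split E f x x' R g \<longleftrightarrow>
     R \<subseteq> E \<and> x' \<notin> vset f E \<and> vset f R \<inter> vset f (E - R) \<subseteq> {x} \<and>
     (\<forall>e\<in>R. g e = f e) \<and> (\<forall>e\<in>E - R. g e = (id(x := x')) ` f e)"

lemma vertex_split_multigraph:
  assumes "multigraph E f" "vertex_split E f x x' R g"
  shows "multigraph E g"
proof -
  have "card ((id(x := x')) ` f e) = card (f e)" if "e \<in> E" for e
    using assms that by (intro card_image) (auto simp: vertex_split_def inj_on_def)
  then show ?thesis
    using assms unfolding multigraph_def vertex_split_def by (metis DiffI)
qed

lemma vertex_split_lengths_realized:
  fixes d :: "'d::finite itself"
  assumes f: "multigraph E f" and s: "vertex_split E f x x' R g"
  shows "lengths_realized d E f g" "lengths_realized d E g f"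
proof -
  have card: "card (f e) = 2" if "e \<in> E" for e using f that by (simp add: multigraph_def)
  note s = s[unfolded vertex_split_def]
  have "\<forall>e\<in>E. edge_length_sq (p(x' := p x)) (g e) = edge_length_sq p (f e)" for p :: "_ \<Rightarrow> real ^ 'd"
  proof
    fix e assume e: "e \<in> E"
    show "edge_length_sq (p(x' := p x)) (g e) = edge_length_sq p (f e)"
    proof (cases "e \<in> R")
      case True
      moreover have "edge_length_sq (p(x' := p x)) (f e) = edge_length_sq p (f e)"
        using s e by (intro edge_length_sq_cong card) auto
      ultimately show ?thesis using s by simp
    next
      case False
      have "edge_length_sq (p(x' := p x) \<circ> id(x := x')) (f e) = edge_length_sq p (f e)"
        using s e by (intro edge_length_sq_cong card) auto
      moreover have "g e = (id(x := x')) ` f e" using s e False by blast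
      ultimately show ?thesis
        using edge_length_sq_image[OF card[OF e]] by metis
    qed
  qed
  then show "lengths_realized d E f g" unfolding lengths_realized_def by blast
  \<comment> \<open>To undo the split, the part \<open>E - R\<close> is translated by
    \<open>q x - q x'\<close>, which brings the copy \<open>x'\<close> to the position of
    \<open>x\<close>. Hence \<open>?p\<close> equals \<open>q\<close> at \<open>x\<close>, the only
    vertex that both parts may share.\<close>
  have "\<forall>e\<in>E. edge_length_sq
      (\<lambda>v. if v \<in> vset f (E - R) then q ((id(x := x')) v) + (q x - q x') else q v) (f e) =
      edge_length_sq q (g e)" (is "\<forall>e\<in>E. edge_length_sq ?p _ = _") for q :: "_ \<Rightarrow> real ^ 'd"
  proof
    fix e assume e: "e \<in> E"
    show "edge_length_sq ?p (f e) = edge_length_sq q (g e)"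
    proof (cases "e \<in> R")
      case True
      moreover have "edge_length_sq ?p (f e) = edge_length_sq q (f e)"
      proof (intro edge_length_sq_cong card e)
        fix v assume "v \<in> f e"
        then show "?p v = q v"
          using s True by (cases "v \<in> vset f (E - R)") auto
      qed
      ultimately show ?thesis using s by simp
    next
      case False
      have "edge_length_sq ?p (f e) =
          edge_length_sq (\<lambda>v. (q \<circ> id(x := x')) v + (q x - q x')) (f e)"
        using e False by (intro edge_length_sq_cong card) auto
      also have "\<dots> = edge_length_sq (q \<circ> id(x := x')) (f e)"
        by (rule edge_length_sq_plus[OF card[OF e]])
      also have "\<dots> = edge_length_sq q (g e)"
        using s e False edge_length_sq_image[OF card[OF e], of q "id(x := x')"] by (metis DiffI)
      finally show ?thesis .
    qed
  qed
  then show "lengths_realized d E g f" unfolding lengths_realized_def by blast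
qed

lemma vertex_split_cuts:
  assumes "multigraph E f" "vertex_split E f x x' R g"
  shows "cuts E g = cuts E f"
  using lengths_realized_cuts_eq[OF vertex_split_multigraph[OF assms] assms(1)
      vertex_split_lengths_realized(2,1)[OF assms, where d = "TYPE(1)"]] .

section \<open>Isomorphisms that keep the edge labels\<close>

definition labelled_iso :: "'e set \<Rightarrow> ('e \<Rightarrow> 'v set) \<Rightarrow> ('e \<Rightarrow> 'w set) \<Rightarrow> bool" where
  "labelled_iso E f g \<longleftrightarrow> (\<exists>\<rho>. inj_on \<rho> (vset f E) \<and> (\<forall>e\<in>E. g e = \<rho> ` f e))"

lemma labelled_isoI: "inj_on \<rho> (vset f E) \<Longrightarrow> (\<And>e. e \<in> E \<Longrightarrow> g e = \<rho> ` f e) \<Longrightarrow> labelled_iso E f g"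
  by (auto simp: labelled_iso_def)

lemma labelled_iso_eq: "(\<And>e. e \<in> E \<Longrightarrow> g e = f e) \<Longrightarrow> labelled_iso E f g"
  by (rule labelled_isoI[of id]) auto

lemma labelled_iso_trans:
  assumes "labelled_iso E f g" "labelled_iso E g h"
  shows "labelled_iso E f h"
proof -
  obtain \<rho> \<sigma> where *: "inj_on \<rho> (vset f E)" "\<And>e. e \<in> E \<Longrightarrow> g e = \<rho> ` f e"
    "inj_on \<sigma> (vset g E)" "\<And>e. e \<in> E \<Longrightarrow> h e = \<sigma> ` g e"
    using assms unfolding labelled_iso_def by metis
  have "vset g E = \<rho> ` vset f E" using *(2) by (simp add: image_UN)
  then show ?thesis
    using * by (intro labelled_isoI[of "\<sigma> \<circ> \<rho>"]) (auto simp: comp_inj_on image_comp)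
qed

lemma labelled_iso_sym:
  assumes "labelled_iso E f g"
  shows "labelled_iso E g f"
proof -
  obtain \<rho> where *: "inj_on \<rho> (vset f E)" "\<And>e. e \<in> E \<Longrightarrow> g e = \<rho> ` f e"
    using assms unfolding labelled_iso_def by metis
  have v: "vset g E = \<rho> ` vset f E" using *(2) by (simp add: image_UN)
  show ?thesis
  proof (rule labelled_isoI[of "inv_into (vset f E) \<rho>"])
    show "inj_on (inv_into (vset f E) \<rho>) (vset g E)"
      unfolding v by (rule inj_on_inv_into) simp
    show "f e = inv_into (vset f E) \<rho> ` g e" if "e \<in> E" for e
      using *(2)[OF that] inv_into_image_cancel[OF *(1), of "f e"] that by auto
  qed
qed

lemma labelled_iso_subset: "labelled_iso E f g \<Longrightarrow> S \<subseteq> E \<Longrightarrow> labelled_iso S f g"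
  unfolding labelled_iso_def by (metis (no_types, lifting) Union_mono image_mono inj_on_subset subsetD)

subsection \<open>Multigraphs without 2-separations\<close>

abbreviation star :: "'e set \<Rightarrow> ('e \<Rightarrow> 'v set) \<Rightarrow> 'v \<Rightarrow> 'e set" where
  "star E f v \<equiv> {e \<in> E. v \<in> f e}"

lemma star_in_cuts: "multigraph E f \<Longrightarrow> star E f v \<in> cuts E f"
  by (metis cut_star cut_in_cuts)

text \<open>A bridge \<open>e\<close> would be a separator by itself, since every cut meets
  \<open>{e}\<close> in \<open>{e}\<close> or \<open>{}\<close>, and both are cuts.\<close>

lemma singleton_not_cut:
  assumes "multigraph E f" "indecomposable (cuts E f) E" "card E \<ge> 2" "e \<in> E"
  shows "{e} \<notin> cuts E f"
proof
  assume *: "{e} \<in> cuts E f"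
  have "separator (cuts E f) {e}"
    unfolding separator_def
  proof
    fix D assume "D \<in> cuts E f"
    show "D \<inter> {e} \<in> cuts E f"
      using * empty_in_cuts by (cases "e \<in> D") auto
  qed
  then have "E = {e}" using assms by (auto simp: indecomposable_def)
  then show False using assms(3) by simp
qed

lemma card_star_ge_2:
  assumes f: "multigraph E f" and "indecomposable (cuts E f) E" "card E \<ge> 2" "v \<in> vset f E"
  shows "card (star E f v) \<ge> 2"
proof (rule ccontr)
  assume "\<not> card (star E f v) \<ge> 2"
  moreover have "finite (star E f v)" "star E f v \<noteq> {}"
    using multigraph_finite[OF f] assms(4) by auto
  ultimately have "card (star E f v) = 1"
    by (metis One_nat_def Suc_1 card_0_eq less_2_cases not_le)
  then obtain e where e: "star E f v = {e}" by (auto simp: card_1_singleton_iff)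
  then have "e \<in> E" by blast
  then show False
    using singleton_not_cut[OF assms(1-3)] star_in_cuts[OF f, of v] e by simp
qed

text \<open>Stars are minimal cuts because \<open>v\<close> is no cut vertex: if only edges at
  \<open>v\<close> leave the side \<open>Y\<close> of \<open>D\<close>, then the edges that meet
  \<open>Y\<close> touch all others at \<open>v\<close> only, so they are none or all.\<close>

lemma cut_within_star:
  assumes f: "multigraph E f" and ind: "indecomposable (cuts E f) E"
    and D: "D \<in> cuts E f" "D \<subseteq> star E f v"
  shows "D = {} \<or> D = star E f v"
proof -
  obtain Y where Y: "D = edge_cut E f Y" "v \<notin> Y" using cuts_avoiding[OF D(1)] .
  let ?R = "{e \<in> E. f e \<inter> Y \<noteq> {}}"
  have "vset f ?R \<inter> vset f (E - ?R) \<subseteq> {v}"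
  proof
    fix w assume "w \<in> vset f ?R \<inter> vset f (E - ?R)"
    then obtain e where e: "e \<in> E" "w \<in> f e" "f e \<inter> Y \<noteq> {}" "w \<notin> Y" by blast
    obtain u where u: "f e = {w, u}" using multigraph_ends_at[OF f e(1,2)] .
    have "e \<in> D" using e by (auto simp: Y edge_cut_def)
    then show "w \<in> {v}" using D(2) u e Y by auto
  qed
  then have "?R = {} \<or> ?R = E"
    by (intro indecomposable_one_vertex[OF ind]) blast+
  then show ?thesis
  proof
    assume "?R = {}"
    then have "D = {}" by (auto simp: Y edge_cut_def)
    then show ?thesis ..
  next
    assume R: "?R = E"
    have "star E f v \<subseteq> D"
    proof
      fix e assume e: "e \<in> star E f v"
      then have "f e \<inter> Y \<noteq> {}" using R by blast
      then show "e \<in> D" using e Y by (auto simp: edge_cut_def)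
    qed
    then show ?thesis using D by blast
  qed
qed

text \<open>By \<open>sep\<close>, \<open>S0\<close> is a separator of the graph without
  \<open>v\<close>. If \<open>S0\<close> and the remaining edges of that graph were vertex-disjoint,
  \<open>v\<close> would be a cut vertex. Otherwise a common vertex \<open>c\<close> is a cut vertex
  once \<open>v\<close> is gone, and \<open>{v, c}\<close> gives the 2-separation.\<close>

lemma two_separator_of_star:
  assumes f: "multigraph E f" and ind: "indecomposable (cuts E f) E" and E: "card E \<ge> 2"
    and S0: "S0 \<subseteq> E - star E f v" "S0 \<noteq> {}" and T0: "E - star E f v - S0 \<noteq> {}"
    and sep: "\<And>D. D \<in> cuts E f \<Longrightarrow> \<exists>D'\<in>cuts E f. D' - star E f v = D \<inter> S0"
  shows "\<exists>S\<subseteq>E. card S \<ge> 2 \<and> card (E - S) \<ge> 2 \<and> two_separator (cuts E f) S"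
proof -
  define T0 where "T0 = E - star E f v - S0"
  show ?thesis
  proof (cases "vset f S0 \<inter> vset f T0 = {}")
    case True
    let ?R = "{e \<in> E. f e \<inter> vset f S0 \<noteq> {}}"
    have "vset f ?R \<inter> vset f (E - ?R) \<subseteq> {v}"
    proof
      fix w assume "w \<in> vset f ?R \<inter> vset f (E - ?R)"
      then obtain e where e: "e \<in> E" "w \<in> f e" "f e \<inter> vset f S0 \<noteq> {}" "w \<notin> vset f S0" by blast
      then have "e \<notin> S0" "e \<notin> T0" using True by blast+
      then have "v \<in> f e" using e T0_def by blast
      moreover obtain u where "f e = {w, u}" using multigraph_ends_at[OF f e(1,2)] .
      moreover have "v \<notin> vset f S0" using S0 by blast
      ultimately show "w \<in> {v}" using e by auto
    qed
    then have "?R = {} \<or> ?R = E"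
      by (intro indecomposable_one_vertex[OF ind]) blast+
    moreover have "?R \<noteq> {}"
    proof -
      obtain e where e: "e \<in> S0" using S0 by blast
      then have "e \<in> E" using S0 by blast
      then obtain a b where "f e = {a, b}" using multigraph_ends[OF f] by metis
      then show ?thesis using e \<open>e \<in> E\<close> by auto
    qed
    moreover obtain t where "t \<in> T0" using T0 T0_def by blast
    then have "t \<in> E - ?R" using True T0_def by blast
    ultimately show ?thesis by blast
  next
    case False
    then obtain c s t where c: "s \<in> S0" "t \<in> T0" "c \<in> f s" "c \<in> f t" by blast
    then have st: "s \<in> E" "t \<in> E" "v \<notin> f s" "v \<notin> f t" "t \<notin> S0" using S0 T0_def by auto
    obtain s' where s': "f s = {c, s'}" "c \<noteq> s'" using multigraph_ends_at[OF f st(1) c(3)] .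
    obtain t' where t': "f t = {c, t'}" "c \<noteq> t'" using multigraph_ends_at[OF f st(2) c(4)] .
    \<comment> \<open>Apart from edges at \<open>v\<close>, only edges of \<open>S0\<close> at
      \<open>c\<close> leave the side \<open>Y\<close> of this cut. Deleting \<open>v\<close> and
      \<open>c\<close> therefore leaves no edge between the remaining vertices \<open>A\<close> of
      \<open>Y\<close> and the others, \<open>B\<close>.\<close>
    obtain D where D: "D \<in> cuts E f" "D - star E f v = star E f c \<inter> S0"
      using sep[OF star_in_cuts[OF f]] by blast
    obtain Y where Y: "D = edge_cut E f Y" "v \<notin> Y" using cuts_avoiding[OF D(1)] .
    define A where "A = Y - {c}"
    define B where "B = vset f E - Y - {v, c}"
    have AB: "f e \<inter> B = {}" if e: "e \<in> E" "f e \<inter> A \<noteq> {}" for e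
    proof (rule ccontr)
      assume "f e \<inter> B \<noteq> {}"
      then obtain a b where ab: "a \<in> f e" "a \<in> A" "b \<in> f e" "b \<in> B" using e by blast
      obtain u where "f e = {a, u}" using multigraph_ends_at[OF f e(1) ab(1)] .
      then have fe: "f e = {a, b}" using ab by (auto simp: A_def B_def)
      then have "e \<in> D" using e ab by (auto simp: Y edge_cut_def A_def B_def)
      moreover have "v \<notin> f e" "c \<notin> f e" using fe ab Y by (auto simp: A_def B_def)
      ultimately show False using D(2) by blast
    qed
    \<comment> \<open>\<open>D\<close> contains \<open>s\<close> but not \<open>t\<close>, and both
      edges start at \<open>c\<close>. So \<open>s'\<close> and \<open>t'\<close> lie on different
      sides, and neither \<open>A\<close> nor \<open>B\<close> is empty.\<close>
    have "s \<in> D" using D(2) c(1,3) st by blast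
    then have s'Y: "c \<in> Y \<longleftrightarrow> s' \<notin> Y"
      using s' by (auto simp: Y edge_cut_def)
    have "t \<notin> D" using D(2) st by blast
    then have t'Y: "c \<in> Y \<longleftrightarrow> t' \<in> Y"
      using t' st by (auto simp: Y edge_cut_def)
    have V: "s' \<in> vset f E" "t' \<in> vset f E" "s' \<noteq> v" "t' \<noteq> v" using s' t' st by auto
    have "\<exists>a b. a \<in> A \<and> a \<in> vset f E \<and> b \<in> B \<and> b \<in> vset f E"
    proof (cases "c \<in> Y")
      case True
      then have "t' \<in> A" "s' \<in> B" using s'Y t'Y V s' t' by (auto simp: A_def B_def)
      then show ?thesis using V by blast
    next
      case False
      then have "s' \<in> A" "t' \<in> B" using s'Y t'Y V s' t' by (auto simp: A_def B_def)
      then show ?thesis using V by blast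
    qed
    then obtain a b where ab: "a \<in> A" "a \<in> vset f E" "b \<in> B" "b \<in> vset f E" by blast
    define S where "S = {e \<in> E. f e \<inter> A \<noteq> {}}"
    have "S \<subseteq> E" by (auto simp: S_def)
    moreover have "card S \<ge> 2"
    proof -
      have "star E f a \<subseteq> S" using ab by (auto simp: S_def)
      then have "card (star E f a) \<le> card S"
        using multigraph_finite[OF f] \<open>S \<subseteq> E\<close> by (intro card_mono) (auto intro: finite_subset)
      then show ?thesis using card_star_ge_2[OF f ind E ab(2)] by simp
    qed
    moreover have "card (E - S) \<ge> 2"
    proof -
      have "star E f b \<subseteq> E - S" using ab AB by (auto simp: S_def)
      then have "card (star E f b) \<le> card (E - S)"
        using multigraph_finite[OF f] by (intro card_mono) auto
      then show ?thesis using card_star_ge_2[OF f ind E ab(4)] by simp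
    qed
    moreover have "vset f S \<inter> vset f (E - S) \<subseteq> {v, c}"
    proof
      fix w assume "w \<in> vset f S \<inter> vset f (E - S)"
      then obtain e where e: "e \<in> E" "w \<in> f e" "f e \<inter> A \<noteq> {}" "w \<notin> A" by (auto simp: S_def)
      then have "w \<notin> B" using AB by blast
      then show "w \<in> {v, c}" using e by (auto simp: A_def B_def)
    qed
    then have "two_separator (cuts E f) S"
      by (intro two_separator_two_vertices[OF f \<open>S \<subseteq> E\<close>])
    ultimately show ?thesis by blast
  qed
qed

text \<open>The star is a cut of \<open>h\<close> with some side \<open>X0\<close>. The sets
  \<open>Y \<inter> X0\<close> show that the edges inside \<open>X0\<close> form a separator once
  the star is removed, so without 2-separations all edges off the star lie on one side. The other
  side \<open>X\<close> contains no edge of \<open>h\<close>, so the star of any vertex of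
  \<open>X\<close> is part of the cut, and by \<open>cut_within_star\<close> a nonempty one is all
  of it.\<close>

lemma matching_star:
  assumes f: "multigraph E f" and h: "multigraph E h" and fh: "cuts E f = cuts E h"
    and ind: "indecomposable (cuts E f) E" and E: "card E \<ge> 2"
    and no: "\<not> (\<exists>S\<subseteq>E. card S \<ge> 2 \<and> card (E - S) \<ge> 2 \<and> two_separator (cuts E f) S)"
    and v: "v \<in> vset f E"
  shows "\<exists>x. star E h x = star E f v"
proof -
  obtain X0 where X0: "star E f v = edge_cut E h X0"
    using star_in_cuts[OF f, of v] fh by (auto simp: cuts_def)
  define S0 where "S0 = {e \<in> E. h e \<subseteq> X0}"
  have T0: "E - star E f v - S0 = {e \<in> E. h e \<inter> X0 = {}}" (is "_ = ?T0")
  proof -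
    have "\<not> h e \<subseteq> X0" if "e \<in> E" "h e \<inter> X0 = {}" for e
      using that multigraph_ends[OF h, of e] by (metis disjoint_iff insertI1 subsetD)
    then show ?thesis unfolding X0 S0_def edge_cut_def by blast
  qed
  have S0_star: "S0 \<subseteq> E - star E f v" unfolding X0 S0_def edge_cut_def by blast
  have "\<exists>D'\<in>cuts E f. D' - star E f v = D \<inter> S0" if D: "D \<in> cuts E f" for D
  proof -
    obtain Y where Y: "D = edge_cut E h Y" using D fh by (auto simp: cuts_def)
    have "edge_cut E h (Y \<inter> X0) - star E f v = D \<inter> S0"
      unfolding Y X0 S0_def edge_cut_def by blast
    then show ?thesis using fh by blast
  qed
  then have "S0 = {} \<or> ?T0 = {}"
    using two_separator_of_star[OF f ind E S0_star] no T0 by blast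
  then obtain X where X: "star E f v = edge_cut E h X" "\<And>e. e \<in> E \<Longrightarrow> \<not> h e \<subseteq> X"
  proof
    assume "S0 = {}"
    then show ?thesis using that[of X0] X0 S0_def by blast
  next
    assume "?T0 = {}"
    then have "\<not> h e \<subseteq> - X0" if "e \<in> E" for e using that by blast
    moreover have "star E f v = edge_cut E h (- X0)" using X0 cut_compl by metis
    ultimately show ?thesis using that by blast
  qed
  obtain e where e: "e \<in> star E f v" using v by blast
  then obtain x where x: "x \<in> h e" "x \<in> X" "e \<in> E" unfolding X(1) edge_cut_def by blast
  have "star E h x \<subseteq> star E f v" unfolding X(1) edge_cut_def using x X(2) by blast
  moreover have "star E h x \<in> cuts E f" using star_in_cuts[OF h] fh by metis
  ultimately have "star E h x = {} \<or> star E h x = star E f v"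
    by (intro cut_within_star[OF f ind]) auto
  then show ?thesis using x by blast
qed

text \<open>Here stars do not distinguish vertices, so matching them cannot give an injective map.
  But all edges of \<open>f\<close> are parallel, because the common star touches the rest nowhere.
  Then \<open>{}\<close> and \<open>E\<close> are the only cuts, every nonempty star of
  \<open>h\<close> is \<open>E\<close>, and the edges of \<open>h\<close> are parallel too.\<close>

lemma labelled_iso_dipole:
  assumes f: "multigraph E f" and h: "multigraph E h" and fh: "cuts E f = cuts E h"
    and ind: "indecomposable (cuts E f) E"
    and v: "v \<in> vset f E" "v \<noteq> v'" "star E f v = star E f v'"
  shows "labelled_iso E f h"
proof -
  have fe: "f e = {v, v'}" if e: "e \<in> star E f v" for e
  proof -
    have "e \<in> E" "v \<in> f e" "v' \<in> f e" using e v(3) by blast+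
    moreover obtain u where "f e = {v, u}" using multigraph_ends_at[OF f calculation(1,2)] .
    ultimately show ?thesis using v by auto
  qed
  have "vset f (star E f v) \<subseteq> {v, v'}" using fe by auto
  moreover have "vset f (E - star E f v) \<inter> {v, v'} = {}" using v(3) by blast
  ultimately have "vset f (star E f v) \<inter> vset f (E - star E f v) \<subseteq> {v}" by blast
  then have "star E f v = {} \<or> star E f v = E"
    by (intro indecomposable_one_vertex[OF ind]) blast+
  then have star: "star E f v = E" using v by blast
  have cutsE: "D = {} \<or> D = E" if D: "D \<in> cuts E f" for D
  proof -
    obtain U where "D = edge_cut E f U" using D by (auto simp: cuts_def)
    moreover have "f e = {v, v'}" if "e \<in> E" for e using fe star that by blast
    ultimately show ?thesis
      by (cases "(v \<in> U) = (v' \<in> U)") (auto simp: edge_cut_def)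
  qed
  obtain e0 where e0: "e0 \<in> E" using v by blast
  obtain a b where ab: "h e0 = {a, b}" "a \<noteq> b" using multigraph_ends[OF h e0] .
  have in_all: "x \<in> h e" if "x \<in> h e0" "e \<in> E" for x e
  proof -
    have "star E h x \<in> cuts E f" using star_in_cuts[OF h] fh by metis
    then have "star E h x = E" using cutsE e0 that by blast
    then show ?thesis using that by blast
  qed
  have he: "h e = {a, b}" if e: "e \<in> E" for e
  proof -
    have "a \<in> h e" "b \<in> h e" using in_all[OF _ e] ab by auto
    moreover obtain u where "h e = {a, u}" using multigraph_ends_at[OF h e calculation(1)] .
    ultimately show ?thesis using ab by auto
  qed
  show ?thesis
  proof (rule labelled_isoI[of "\<lambda>u. if u = v then a else b"])
    have "vset f E \<subseteq> {v, v'}" using fe star by blast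
    then show "inj_on (\<lambda>u. if u = v then a else b) (vset f E)"
      using ab by (auto simp: inj_on_def)
    show "h e = (\<lambda>u. if u = v then a else b) ` f e" if "e \<in> E" for e
      using he[OF that] fe[of e] that star v(2) by auto
  qed
qed

text \<open>Vertices correspond when their stars are equal. If stars distinguish the vertices of
  \<open>f\<close>, this map is injective, and comparing cardinalities shows that it sends the ends
  of an edge onto its ends in \<open>h\<close>.\<close>

lemma labelled_iso_if_no_two_separator:
  assumes f: "multigraph E f" and h: "multigraph E h" and fh: "cuts E f = cuts E h"
    and ind: "indecomposable (cuts E f) E" and E: "card E \<ge> 2"
    and no: "\<not> (\<exists>S\<subseteq>E. card S \<ge> 2 \<and> card (E - S) \<ge> 2 \<and> two_separator (cuts E f) S)"
  shows "labelled_iso E f h"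
proof (cases "inj_on (star E f) (vset f E)")
  case False
  then obtain v v' where "v \<in> vset f E" "v \<noteq> v'" "star E f v = star E f v'"
    unfolding inj_on_def by metis
  then show ?thesis by (rule labelled_iso_dipole[OF f h fh ind])
next
  case True
  have "\<forall>v\<in>vset f E. \<exists>x. star E h x = star E f v"
    using matching_star[OF f h fh ind E no] by blast
  then obtain \<rho> where \<rho>: "\<And>v. v \<in> vset f E \<Longrightarrow> star E h (\<rho> v) = star E f v" by metis
  have inj: "inj_on \<rho> (vset f E)"
  proof (rule inj_onI)
    fix v w assume vw: "v \<in> vset f E" "w \<in> vset f E" "\<rho> v = \<rho> w"
    then have "star E f v = star E f w" using \<rho>[of v] \<rho>[of w] by simp
    then show "v = w" using inj_onD[OF True] vw by simp
  qed
  show ?thesis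
  proof (rule labelled_isoI[OF inj])
    fix e assume e: "e \<in> E"
    have "\<rho> ` f e \<subseteq> h e" using \<rho> e by blast
    moreover have "inj_on \<rho> (f e)"
      using inj by (rule inj_on_subset) (use e in blast)
    then have "card (\<rho> ` f e) = 2"
      using f e by (simp add: card_image multigraph_def)
    moreover have "card (h e) = 2" using h e by (simp add: multigraph_def)
    ultimately show "h e = \<rho> ` f e"
      by (metis card.infinite card_subset_eq zero_neq_numeral)
  qed
qed

subsection \<open>Cut pairs of a minimal 2-separation\<close>

text \<open>For a separator \<open>R\<close> of the restriction to \<open>S\<close>, every
  \<open>D \<inter> R\<close> is the trace on \<open>S\<close> of a cut, so \<open>R\<close>
  inherits the rank bound of \<open>S\<close>. Minimality leaves at most one edge for a proper
  \<open>R\<close> and for \<open>S - R\<close>, hence \<open>S = {a, b}\<close>. Both single edges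
  are traces of cuts without being cuts, so the rank bound makes their sum a cut.\<close>

lemma minimal_two_separator:
  assumes f: "multigraph E f" and ind: "indecomposable (cuts E f) E"
    and S: "S \<subseteq> E" "card S \<ge> 2" "card (E - S) \<ge> 2" "two_separator (cuts E f) S"
    and min: "\<And>S'. S' \<subseteq> S \<Longrightarrow> card S' \<ge> 2 \<Longrightarrow> two_separator (cuts E f) S' \<Longrightarrow> S' = S"
  shows "indecomposable (cuts S f) S \<or> (\<exists>a b. a \<noteq> b \<and> S = {a, b} \<and> {a, b} \<in> cuts E f)"
proof (rule disjCI)
  assume no: "\<not> (\<exists>a b. a \<noteq> b \<and> S = {a, b} \<and> {a, b} \<in> cuts E f)"
  let ?W = "cuts E f"
  have finS: "finite S" using S(1) multigraph_finite[OF f] by (rule finite_subset)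
  have cardE: "card E \<ge> 2" using card_mono[OF multigraph_finite[OF f] S(1)] S(2) by simp
  have ex: "\<exists>D'\<in>?W. D \<inter> R = D' \<inter> S" if "R \<subseteq> S" "separator (cuts S f) R" "D \<in> ?W" for R D
  proof -
    have "D \<inter> S \<inter> R \<in> cuts S f"
      using that unfolding separator_def cuts_restrict[OF S(1)] by blast
    moreover have "D \<inter> S \<inter> R = D \<inter> R" using that(1) by blast
    ultimately show ?thesis unfolding cuts_restrict[OF S(1)] by auto
  qed
  have small: "card R \<le> 1" if R: "R \<subseteq> S" "R \<noteq> S" "separator (cuts S f) R" for R
  proof (rule ccontr)
    assume "\<not> card R \<le> 1"
    have "two_separator ?W R"
      unfolding two_separator_def
    proof (intro ballI)
      fix C D assume CD: "C \<in> ?W" "D \<in> ?W"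
      obtain C' where C': "C' \<in> ?W" "C \<inter> R = C' \<inter> S" using ex[OF R(1,3) CD(1)] by metis
      obtain D' where D': "D' \<in> ?W" "D \<inter> R = D' \<inter> S" using ex[OF R(1,3) CD(2)] by metis
      have "sym_diff C D \<inter> R = sym_diff (C \<inter> R) (D \<inter> R)" by blast
      also have "\<dots> = sym_diff C' D' \<inter> S" unfolding C'(2) D'(2) by blast
      finally show "C \<inter> R \<in> ?W \<or> D \<inter> R \<in> ?W \<or> sym_diff C D \<inter> R \<in> ?W"
        using S(4) C' D' unfolding two_separator_def by metis
    qed
    then show False using min[OF R(1)] R(2) \<open>\<not> card R \<le> 1\<close> by simp
  qed
  show "indecomposable (cuts S f) S"
    unfolding indecomposable_def
  proof (intro allI impI, rule ccontr)
    fix R assume R: "R \<subseteq> S" "separator (cuts S f) R" "\<not> (R = {} \<or> R = S)"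
    have sepC: "separator (cuts S f) (S - R)"
      by (rule separator_compl[OF multigraph_subset[OF f S(1)] R(1,2)])
    have "card R \<le> 1" "card (S - R) \<le> 1"
      using small[of R] small[of "S - R"] R sepC by auto
    moreover have "finite R" "finite (S - R)" "R \<noteq> {}" "S - R \<noteq> {}"
      using finS finite_subset[OF R(1)] R by auto
    ultimately have "card R = 1" "card (S - R) = 1"
      by (metis One_nat_def card_0_eq le_Suc_eq le_zero_eq)+
    then obtain a b where ab: "R = {a}" "S - R = {b}" by (auto simp: card_1_singleton_iff)
    then have Sab: "S = {a, b}" "a \<noteq> b" using R by blast+
    have single: "\<exists>D\<in>?W. D \<inter> S = {c} \<and> D \<inter> S \<notin> ?W"
      if c: "c \<in> S" "separator (cuts S f) {c}" for c
    proof -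
      have "c \<in> E" using c S by blast
      then obtain v where v: "v \<in> f c" using multigraph_ends[OF f] by (metis insertI1)
      obtain D where D: "D \<in> ?W" "star E f v \<inter> {c} = D \<inter> S"
        using ex[of "{c}" "star E f v"] c star_in_cuts[OF f] by blast
      moreover have "star E f v \<inter> {c} = {c}" using v \<open>c \<in> E\<close> by blast
      ultimately show ?thesis using singleton_not_cut[OF f ind cardE \<open>c \<in> E\<close>] by auto
    qed
    obtain A where A: "A \<in> ?W" "A \<inter> S = {a}" "A \<inter> S \<notin> ?W"
      using single[of a] R ab by blast
    obtain B where B: "B \<in> ?W" "B \<inter> S = {b}" "B \<inter> S \<notin> ?W"
      using single[of b] sepC Sab unfolding ab by auto
    have "sym_diff A B \<inter> S \<in> ?W"
      using S(4) A B unfolding two_separator_def by metis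
    moreover have "sym_diff A B \<inter> S = sym_diff (A \<inter> S) (B \<inter> S)" by blast
    then have "sym_diff A B \<inter> S = {a, b}" unfolding A(2) B(2) using Sab by auto
    ultimately show False using no Sab by metis
  qed
qed

text \<open>The 2-separation as the vertices of one multigraph show it, whereas
  \<open>two_separator\<close> is the same for all multigraphs with these cuts.\<close>

definition cut_pair :: "'e set \<Rightarrow> ('e \<Rightarrow> 'v set) \<Rightarrow> 'e set \<Rightarrow> 'v set \<Rightarrow> bool" where
  "cut_pair E f S q \<longleftrightarrow> card q = 2 \<and> vset f S \<inter> vset f (E - S) = q"

lemma cut_pair_compl: "S \<subseteq> E \<Longrightarrow> cut_pair E f S q \<Longrightarrow> cut_pair E f (E - S) q"
  by (simp add: cut_pair_def double_diff Int_commute)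

text \<open>Modulo \<open>cuts E f\<close>, the traces on \<open>S\<close> have as rank the number
  of common vertices minus the number of components of \<open>E - S\<close>. Each component contains
  at least two common vertices, or there would be a cut vertex; rank at most 1 thus leaves one
  component with two. The proof avoids counting: a third common vertex gives two stars with
  independent traces.\<close>

lemma cut_pair_if_connected:
  assumes f: "multigraph E f" and ind: "indecomposable (cuts E f) E"
    and S: "S \<subseteq> E" "S \<noteq> {}" "S \<noteq> E" "two_separator (cuts E f) S"
    and indS: "indecomposable (cuts S f) S"
  shows "\<exists>q. cut_pair E f S q"
proof -
  define T where "T = E - S"
  define Q where "Q = vset f S \<inter> vset f T"
  have TE: "T \<subseteq> E" by (auto simp: T_def)
  \<comment> \<open>Lying in the same component of \<open>T\<close>, expressed without paths: a
    vertex set that no edge of \<open>T\<close> crosses and that contains \<open>p\<close> contains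
    \<open>p'\<close>.\<close>
  define conn where "conn p p' \<longleftrightarrow> (\<forall>Z. edge_cut T f Z = {} \<longrightarrow> p \<in> Z \<longrightarrow> p' \<in> Z)" for p p'
  have partner: "\<exists>q'\<in>Q. q' \<noteq> q \<and> conn q q'" if q: "q \<in> Q" for q
  proof (rule ccontr)
    assume no: "\<not> (\<exists>q'\<in>Q. q' \<noteq> q \<and> conn q q')"
    define Z where "Z = {v. conn q v}"
    have Z: "f e \<subseteq> Z" if e: "e \<in> T" "w \<in> f e" "w \<in> Z" for e w
    proof
      fix u assume u: "u \<in> f e"
      show "u \<in> Z"
        unfolding Z_def conn_def mem_Collect_eq
      proof (intro allI impI)
        fix Y assume Y: "edge_cut T f Y = {}" "q \<in> Y"
        then have "w \<in> Y" using e(3) unfolding Z_def conn_def by blast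
        then show "u \<in> Y" using Y(1) e u unfolding edge_cut_def by blast
      qed
    qed
    have qZ: "q \<in> Z" by (simp add: Z_def conn_def)
    \<comment> \<open>The component of \<open>T\<close> at \<open>q\<close>. Without a second common
      vertex it would be attached to the rest at \<open>q\<close> alone.\<close>
    let ?R = "{e \<in> T. f e \<subseteq> Z}"
    have "vset f ?R \<inter> vset f (E - ?R) \<subseteq> {q}"
    proof
      fix w assume "w \<in> vset f ?R \<inter> vset f (E - ?R)"
      then obtain e e' where e: "e \<in> T" "w \<in> f e" "w \<in> Z" "e' \<in> E" "w \<in> f e'" "e' \<notin> ?R" by blast
      then have "e' \<in> S" using Z[of e' w] by (auto simp: T_def)
      then have "w \<in> Q" using e by (auto simp: Q_def)
      then show "w \<in> {q}" using no e(3) by (auto simp: Z_def)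
    qed
    then have "?R = {} \<or> ?R = E"
      using TE by (intro indecomposable_one_vertex[OF ind]) blast+
    moreover obtain t where "t \<in> T" "q \<in> f t" using q by (auto simp: Q_def)
    then have "t \<in> ?R" using Z qZ by blast
    moreover have "?R \<noteq> E" using S(1,2) by (auto simp: T_def)
    ultimately show False by blast
  qed
  \<comment> \<open>If the trace were the cut of some \<open>U'\<close>, no edge of \<open>T\<close>
    would cross \<open>U'\<close>, so \<open>p\<close> and \<open>p'\<close> would be on the same
    side of \<open>U'\<close>. On the connected part \<open>S\<close>, however, \<open>U'\<close>
    agrees with \<open>U\<close> or with its complement, and \<open>U\<close> separates
    them.\<close>
  have separates: "edge_cut E f U \<inter> S \<notin> cuts E f"
    if p: "p \<in> Q" "p' \<in> Q" "conn p p'" "p \<in> U" "p' \<notin> U" for p p' U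
  proof
    assume "edge_cut E f U \<inter> S \<in> cuts E f"
    then obtain U' where U': "edge_cut E f U \<inter> S = edge_cut E f U'" by (auto simp: cuts_def)
    have "edge_cut T f U' = {}"
      using U' unfolding cut_Int[OF TE] by (auto simp: T_def)
    then have U'_conn: "p \<in> U' \<longleftrightarrow> p' \<in> U'"
      using p(3) cut_compl[of T f U'] unfolding conn_def by (metis ComplI ComplD)
    have "edge_cut S f (sym_diff U U') = {}"
    proof -
      have "edge_cut S f U' = edge_cut S f U"
        using U' unfolding cut_Int[OF S(1)] by blast
      then show ?thesis
        using cut_sym_diff[OF multigraph_subset[OF f S(1)], of U U'] by auto
    qed
    then have "vset f S \<subseteq> sym_diff U U' \<or> vset f S \<inter> sym_diff U U' = {}"
      by (rule indecomposable_connected[OF indS])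
    moreover have "p \<in> vset f S" "p' \<in> vset f S" using p by (auto simp: Q_def)
    ultimately show False using U'_conn p(4,5) by blast
  qed
  have "Q \<noteq> {}"
  proof
    assume "Q = {}"
    then have "vset f S \<inter> vset f (E - S) \<subseteq> {undefined}" by (auto simp: Q_def T_def)
    then show False using indecomposable_one_vertex[OF ind S(1)] S by blast
  qed
  then obtain q1 where q1: "q1 \<in> Q" by blast
  then obtain q2 where q2: "q2 \<in> Q" "q2 \<noteq> q1" "conn q1 q2" using partner by blast
  have "Q \<subseteq> {q1, q2}"
  proof (rule ccontr)
    assume "\<not> Q \<subseteq> {q1, q2}"
    then obtain q3 where q3: "q3 \<in> Q" "q3 \<noteq> q1" "q3 \<noteq> q2" by blast
    then obtain q4 where q4: "q4 \<in> Q" "q4 \<noteq> q3" "conn q3 q4" using partner by blast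
    have "edge_cut E f {q1} \<inter> S \<notin> cuts E f"
      by (rule separates[OF q1 q2(1,3)]) (use q2 in auto)
    moreover have "edge_cut E f {q3} \<inter> S \<notin> cuts E f"
      by (rule separates[OF q3(1) q4(1,3)]) (use q4 in auto)
    moreover have "edge_cut E f (sym_diff {q1} {q3}) \<inter> S \<notin> cuts E f"
      by (rule separates[OF q1 q2(1,3)]) (use q2 q3 in auto)
    ultimately show False
      using S(4) cut_sym_diff[OF f, of "{q1}" "{q3}"] cut_in_cuts[of E f]
      unfolding two_separator_def by metis
  qed
  then have "Q = {q1, q2}" using q1 q2 by blast
  then have "cut_pair E f S {q1, q2}" using q2 by (auto simp: cut_pair_def Q_def T_def)
  then show ?thesis ..
qed

text \<open>The common end \<open>z\<close> has degree two: further edges on its side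
  \<open>X\<close> of the cut could be attached only at \<open>z\<close>. So only \<open>u\<close>
  and \<open>w\<close> can meet the other edges, and both do because every star has at least two
  edges.\<close>

lemma cut_pair_series_adjacent:
  assumes f: "multigraph E f" and ind: "indecomposable (cuts E f) E" and E: "card E \<ge> 3"
    and ab: "a \<noteq> b" "{a, b} \<in> cuts E f" and z: "f a = {z, u}" "f b = {z, w}"
  shows "cut_pair E f {a, b} {u, w}"
proof -
  obtain X' where X': "{a, b} = edge_cut E f X'" using ab by (auto simp: cuts_def)
  then obtain X where X: "{a, b} = edge_cut E f X" "z \<in> X"
    using cut_compl[of E f X'] by (metis ComplI)
  have abE: "a \<in> E" "b \<in> E" using X(1) unfolding edge_cut_def by blast+
  have uw: "u \<notin> X" "w \<notin> X"
    using X(2) X(1)[THEN eqset_imp_iff, of a] X(1)[THEN eqset_imp_iff, of b] z abE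
    by (auto simp: edge_cut_def)
  let ?R = "{e \<in> E. f e \<subseteq> X}"
  have "vset f ?R \<inter> vset f (E - ?R) \<subseteq> {z}"
  proof
    fix v assume "v \<in> vset f ?R \<inter> vset f (E - ?R)"
    then obtain e where e: "v \<in> X" "e \<in> E" "v \<in> f e" "\<not> f e \<subseteq> X" by blast
    then have "e \<in> {a, b}" unfolding X(1) edge_cut_def by blast
    then show "v \<in> {z}" using e z uw by auto
  qed
  then have "?R = {} \<or> ?R = E"
    by (intro indecomposable_one_vertex[OF ind]) blast+
  moreover have "a \<notin> ?R" using z uw by auto
  ultimately have R: "?R = {}" using abE by blast
  have star_z: "e \<in> {a, b}" if "e \<in> E" "z \<in> f e" for e
    using that R X(2) unfolding X(1) edge_cut_def by blast
  have sub: "{a, b} \<subseteq> E" using abE by blast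
  have ne: "{a, b} \<noteq> E"
  proof
    assume "{a, b} = E"
    moreover have "card {a, b} \<le> 2" by (simp add: card_insert_if)
    ultimately show False using E by simp
  qed
  have V: "vset f {a, b} \<inter> vset f (E - {a, b}) \<subseteq> {u, w}"
    using z star_z by auto
  have "u \<noteq> w"
  proof
    assume "u = w"
    then have "vset f {a, b} \<inter> vset f (E - {a, b}) \<subseteq> {u}" using V by simp
    then show False using indecomposable_one_vertex[OF ind sub] ne by blast
  qed
  have E2: "card E \<ge> 2" using E by simp
  have deg: "\<exists>e\<in>E - {a, b}. v \<in> f e"
    if v: "c \<in> {a, b}" "v \<in> f c" "d \<in> {a, b}" "v \<notin> f d" for v c d
  proof (rule ccontr)
    assume "\<not> ?thesis"
    then have "star E f v \<subseteq> {c}" using v by auto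
    then have "card (star E f v) \<le> 1" using card_mono[of "{c}" "star E f v"] by simp
    moreover have "v \<in> vset f E" using v abE by blast
    ultimately show False using card_star_ge_2[OF f ind E2] by fastforce
  qed
  have "z \<noteq> u" "z \<noteq> w" using X(2) uw by auto
  then have "\<exists>e\<in>E - {a, b}. u \<in> f e" "\<exists>e\<in>E - {a, b}. w \<in> f e"
    using deg[of a u b] deg[of b w a] z \<open>u \<noteq> w\<close> by auto
  then show ?thesis using V z \<open>u \<noteq> w\<close> by (auto simp: cut_pair_def)
qed

text \<open>If \<open>a\<close> and \<open>b\<close> are disjoint, the multigraph is a ring: the
  part inside \<open>X\<close>, the edge \<open>a\<close>, the part outside \<open>X\<close>, the
  edge \<open>b\<close>. One reversal moves \<open>a\<close> next to \<open>b\<close>.\<close>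

lemma cut_pair_series:
  assumes f: "multigraph E f" and ind: "indecomposable (cuts E f) E" and E: "card E \<ge> 3"
    and ab: "a \<noteq> b" "{a, b} \<in> cuts E f"
  shows "\<exists>f' q. (twist E)\<^sup>*\<^sup>* f f' \<and> cut_pair E f' {a, b} q"
proof -
  obtain X where X: "{a, b} = edge_cut E f X" using ab by (auto simp: cuts_def)
  have abE: "a \<in> E" "b \<in> E" using X unfolding edge_cut_def by blast+
  have ends: "\<exists>x y. f c = {x, y} \<and> x \<in> X \<and> y \<notin> X" if "c \<in> {a, b}" for c
  proof -
    have c: "c \<in> E" "c \<in> edge_cut E f X" using that abE X by auto
    obtain x y where "f c = {x, y}" using multigraph_ends[OF f c(1)] .
    then show ?thesis using c(2) by (cases "x \<in> X") (auto simp: edge_cut_def)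
  qed
  obtain x1 y1 where a: "f a = {x1, y1}" "x1 \<in> X" "y1 \<notin> X" using ends by blast
  obtain x2 y2 where b: "f b = {x2, y2}" "x2 \<in> X" "y2 \<notin> X" using ends by blast
  consider "x1 = x2" | "y1 = y2" | "x1 \<noteq> x2" "y1 \<noteq> y2" by blast
  then show ?thesis
  proof cases
    case 1
    then show ?thesis
      using cut_pair_series_adjacent[OF f ind E ab, of x1 y1 y2] a b by blast
  next
    case 2
    then show ?thesis
      using cut_pair_series_adjacent[OF f ind E ab, of y1 x1 x2] a b
      by (metis insert_commute rtranclp.rtrancl_refl)
  next
    case 3
    \<comment> \<open>With \<open>a\<close> added to the inner part and \<open>b\<close> to the
      outer one, the common vertices are \<open>x2\<close>, the inner end of \<open>b\<close>, and
      \<open>y1\<close>, the outer end of \<open>a\<close>. Exchanging them in \<open>A\<close>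
      moves the end \<open>y1\<close> of \<open>a\<close> to \<open>x2\<close>, where
      \<open>b\<close> ends.\<close>
    define A where "A = insert a {e \<in> E. f e \<subseteq> X}"
    define B where "B = insert b {e \<in> E. f e \<inter> X = {}}"
    have fin: "finite E" by (rule multigraph_finite[OF f])
    have AB: "A \<union> B = E"
      using X abE by (auto simp: A_def B_def edge_cut_def)
    have disj: "A \<inter> B = {}"
    proof -
      have "e \<notin> B" if "e \<in> A" for e
      proof
        assume eB: "e \<in> B"
        have "e \<in> E" using eB AB by blast
        then obtain p q where "f e = {p, q}" using multigraph_ends[OF f] by metis
        then show False using that eB a b ab by (auto simp: A_def B_def)
      qed
      then show ?thesis by blast
    qed
    have E2: "card E \<ge> 2" using E by simp
    have another: "\<exists>e\<in>E. e \<noteq> c \<and> v \<in> f e" if v: "c \<in> E" "v \<in> f c" for v c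
    proof (rule ccontr)
      assume "\<not> ?thesis"
      then have "star E f v \<subseteq> {c}" by auto
      then have "card (star E f v) \<le> 1" using card_mono[of "{c}" "star E f v"] by simp
      moreover have "v \<in> vset f E" using v by blast
      ultimately show False using card_star_ge_2[OF f ind E2] by fastforce
    qed
    obtain e2 where e2: "e2 \<in> E" "e2 \<noteq> b" "x2 \<in> f e2" using another[OF abE(2), of x2] b by blast
    then have "e2 \<noteq> a" using a b 3 by auto
    then have e2A: "e2 \<in> A" using X e2 b by (auto simp: A_def edge_cut_def)
    obtain e1 where e1: "e1 \<in> E" "e1 \<noteq> a" "y1 \<in> f e1" using another[OF abE(1), of y1] a by blast
    then have "e1 \<noteq> b" using a b 3 by auto
    then have e1B: "e1 \<in> B" using X e1 a by (auto simp: B_def edge_cut_def)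
    have cards: "card A \<ge> 2" "card B \<ge> 2"
    proof -
      have finAB: "finite A" "finite B" using fin by (auto simp: A_def B_def)
      have "card {a, e2} \<le> card A" "card {b, e1} \<le> card B"
        using finAB e2A e1B by (intro card_mono; simp add: A_def B_def)+
      then show "card A \<ge> 2" "card B \<ge> 2" using \<open>e2 \<noteq> a\<close> \<open>e1 \<noteq> b\<close> by auto
    qed
    have "vset f A \<subseteq> insert y1 X" using a by (auto simp: A_def)
    moreover have "vset f B \<subseteq> insert x2 (- X)" using b by (auto simp: B_def)
    moreover have "{x2, y1} \<subseteq> vset f A"
      using e2A e2 a by (auto simp: A_def)
    moreover have "{x2, y1} \<subseteq> vset f B"
      using e1B e1 b by (auto simp: B_def)
    ultimately have V: "vset f A \<inter> vset f B = {x2, y1}" using a b by blast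
    define f' where "f' e = (if e \<in> A then Transposition.transpose x2 y1 ` f e else f e)" for e
    have ne: "x2 \<noteq> y1" using a b by blast
    have tw: "twist E f f'"
      unfolding twist_def
      by (rule exI[of _ A], rule exI[of _ B], rule exI[of _ x2], rule exI[of _ y1])
        (use AB disj cards ne V in \<open>auto simp: f'_def\<close>)
    have "a \<in> A" "b \<notin> A" using disj by (auto simp: A_def B_def)
    moreover have "Transposition.transpose x2 y1 ` {x1, y1} = {x1, x2}"
      using a 3 by (auto simp: Transposition.transpose_def)
    ultimately have "f' a = {x2, x1}" "f' b = {x2, y2}"
      using a(1) b(1) by (simp_all add: f'_def insert_commute)
    moreover have "cuts E f' = cuts E f" by (rule twist_cuts[OF f tw])
    ultimately have "cut_pair E f' {a, b} {x1, y2}"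
      using cut_pair_series_adjacent[OF twist_multigraph[OF f tw] _ E ab(1), of x2 x1 y2] ind ab(2)
      by simp
    then show ?thesis using tw by blast
  qed
qed

subsection \<open>Whitney's theorem for 2-connected multigraphs\<close>

text \<open>Suppose that some \<open>U\<close> separates the pair and its trace on \<open>S\<close>
  is a cut. Adding this trace to that of any other separating set shows that the latter is a cut as
  well, so \<open>S\<close> would be a separator.\<close>

lemma cut_pair_cut_Int_iff:
  assumes f: "multigraph E f" and ind: "indecomposable (cuts E f) E"
    and S: "S \<subseteq> E" "S \<noteq> {}" "S \<noteq> E" and q: "cut_pair E f S q"
  shows "edge_cut E f U \<inter> S \<in> cuts E f \<longleftrightarrow> q \<inter> U = {} \<or> q \<subseteq> U"
proof -
  obtain x y where xy: "q = {x, y}" "x \<noteq> y" using q by (auto simp: cut_pair_def card_2_iff)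
  have V: "vset f S \<inter> vset f (E - S) \<subseteq> {x, y}" using q xy by (simp add: cut_pair_def)
  have *: "edge_cut E f U \<inter> S \<in> cuts E f" if "x \<in> U \<longleftrightarrow> y \<in> U" for U
    by (rule cut_Int_two_vertices[OF S(1) V that])
  have "x \<in> U \<longleftrightarrow> y \<in> U" if U: "edge_cut E f U \<inter> S \<in> cuts E f"
  proof (rule ccontr)
    assume sep: "\<not> (x \<in> U \<longleftrightarrow> y \<in> U)"
    have "separator (cuts E f) S"
      unfolding separator_def
    proof
      fix D assume "D \<in> cuts E f"
      then obtain U' where U': "D = edge_cut E f U'" by (auto simp: cuts_def)
      show "D \<inter> S \<in> cuts E f"
      proof (cases "x \<in> U' \<longleftrightarrow> y \<in> U'")
        case False
        then have "x \<in> sym_diff U U' \<longleftrightarrow> y \<in> sym_diff U U'" using sep by blast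
        then have "edge_cut E f (sym_diff U U') \<inter> S \<in> cuts E f" by (rule *)
        then have "sym_diff (edge_cut E f (sym_diff U U') \<inter> S) (edge_cut E f U \<inter> S) \<in> cuts E f"
          using U by (intro sym_diff_in_cuts[OF f])
        moreover have "sym_diff (edge_cut E f (sym_diff U U') \<inter> S) (edge_cut E f U \<inter> S) =
            edge_cut E f U' \<inter> S"
          unfolding cut_sym_diff[OF f, symmetric] by blast
        ultimately show ?thesis using U' by simp
      qed (simp add: U' *)
    qed
    then show False using ind S by (auto simp: indecomposable_def)
  qed
  then show ?thesis using *[of U] xy by blast
qed

text \<open>The right-hand side depends on \<open>f\<close> only through \<open>cuts E f\<close>,
  and not on \<open>q\<close>. Two multigraphs with equal cuts therefore have equal cuts on the part
  with its virtual edge, even if their cut pairs are unrelated. This is what the induction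
  hypothesis needs.\<close>

lemma virtual_cuts:
  assumes f: "multigraph E f" and ind: "indecomposable (cuts E f) E"
    and S: "S \<subseteq> E" "S \<noteq> {}" and q: "cut_pair E f S q" and e: "e \<in> E - S"
  shows "cuts (insert e S) (f(e := q)) =
    (\<lambda>D. if D \<inter> S \<in> cuts E f then D \<inter> S else insert e (D \<inter> S)) ` cuts E f"
proof -
  have "S \<noteq> E" using e by blast
  define F where "F D = (if D \<inter> S \<in> cuts E f then D \<inter> S else insert e (D \<inter> S))" for D
  have "edge_cut (insert e S) (f(e := q)) U = F (edge_cut E f U)" for U
  proof -
    have "edge_cut (insert e S) (f(e := q)) U = edge_cut S f U \<union> (if q \<inter> U = {} \<or> q \<subseteq> U then {} else {e})"
      using e by (auto simp: edge_cut_def)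
    then show ?thesis
      using cut_pair_cut_Int_iff[OF f ind S \<open>S \<noteq> E\<close> q, of U] by (simp add: F_def cut_Int[OF S(1)])
  qed
  then have "cuts (insert e S) (f(e := q)) = F ` cuts E f"
    unfolding cuts_def by (simp add: image_image)
  then show ?thesis unfolding F_def .
qed

lemma virtual_multigraph:
  assumes "multigraph E f" "S \<subseteq> E" "cut_pair E f S q"
  shows "multigraph (insert e S) (f(e := q))"
  using multigraph_subset[OF assms(1,2)] assms(3) by (auto simp: multigraph_def cut_pair_def)

text \<open>A separator that avoids the virtual edge is already a separator of \<open>E\<close>,
  hence empty. One that contains it is handled by its complement.\<close>

lemma virtual_indecomposable:
  assumes f: "multigraph E f" and ind: "indecomposable (cuts E f) E"
    and S: "S \<subseteq> E" "S \<noteq> {}" and q: "cut_pair E f S q" and e: "e \<in> E - S"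
  shows "indecomposable (cuts (insert e S) (f(e := q))) (insert e S)"
proof -
  let ?W = "cuts (insert e S) (f(e := q))"
  note W = virtual_cuts[OF f ind S q e]
  have *: "R = {}" if R: "R \<subseteq> S" "separator ?W R" for R
  proof -
    have "separator (cuts E f) R"
      unfolding separator_def
    proof
      fix D assume D: "D \<in> cuts E f"
      let ?D = "if D \<inter> S \<in> cuts E f then D \<inter> S else insert e (D \<inter> S)"
      have "?D \<in> ?W" using D W by blast
      then have "?D \<inter> R \<in> ?W" using R(2) by (simp add: separator_def)
      moreover have "?D \<inter> R = D \<inter> R" using R(1) e by auto
      ultimately have "D \<inter> R \<in> ?W" by simp
      then obtain C where "D \<inter> R = (if C \<inter> S \<in> cuts E f then C \<inter> S else insert e (C \<inter> S))"
        unfolding W by blast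
      moreover have "e \<notin> D \<inter> R" using R(1) e by blast
      ultimately show "D \<inter> R \<in> cuts E f" by (auto split: if_splits)
    qed
    then have "R = {} \<or> R = E" using ind R S by (auto simp: indecomposable_def)
    then show ?thesis using R e by blast
  qed
  show ?thesis
    unfolding indecomposable_def
  proof (intro allI impI)
    fix R assume R: "R \<subseteq> insert e S" "separator ?W R"
    show "R = {} \<or> R = insert e S"
    proof (cases "e \<in> R")
      case True
      have "separator ?W (insert e S - R)"
        by (rule separator_compl[OF virtual_multigraph[OF f S(1) q] R])
      then have "insert e S - R = {}" using True by (intro *) auto
      then show ?thesis using R by blast
    next
      case False
      then show ?thesis using * R by blast
    qed
  qed
qed

section \<open>Lifting reversals of a part to the whole multigraph\<close>

lemma twist_cong:
  assumes "twist E f g" "\<And>e. e \<in> E \<Longrightarrow> f' e = f e"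
  shows "twist E f' g"
proof -
  obtain S T x y where *: "S \<union> T = E" "S \<inter> T = {}" "card S \<ge> 2" "card T \<ge> 2" "x \<noteq> y"
    "vset f S \<inter> vset f T = {x, y}"
    "\<forall>e\<in>S. g e = Transposition.transpose x y ` f e" "\<forall>e\<in>T. g e = f e"
    using assms(1) unfolding twist_def by metis
  have "f' e = f e" if "e \<in> S \<or> e \<in> T" for e using assms(2) *(1) that by blast
  then have "vset f' S = vset f S" "vset f' T = vset f T"
    "\<forall>e\<in>S. g e = Transposition.transpose x y ` f' e" "\<forall>e\<in>T. g e = f' e"
    using * by auto
  then show ?thesis unfolding twist_def using *(1-6) by metis
qed

lemma twist_preserves:
  assumes "(twist E)\<^sup>*\<^sup>* f g" "multigraph E f"
  shows "multigraph E g" "cuts E g = cuts E f"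
  using assms by (induction rule: rtranclp_induct) (auto simp: twist_multigraph twist_cuts)

text \<open>The other part of the 2-separation moves along with its virtual edge.\<close>

lemma twist_lift_virtual_step:
  assumes f: "multigraph E f" and S: "S \<subseteq> E" and T: "card (E - S) \<ge> 2"
    and q: "cut_pair E f S q" and e: "e \<in> E - S"
    and tw: "twist (insert e S) (f(e := q)) g"
  shows "\<exists>f'. twist E f f' \<and> cut_pair E f' S (g e) \<and> (\<forall>s\<in>S. f' s = g s) \<and>
    (\<forall>s\<in>S. labelled_iso (insert s (E - S)) (f(s := q)) (f'(s := g e)))"
proof -
  define T' where "T' = E - S"
  have finE: "finite E" by (rule multigraph_finite[OF f])
  obtain A B x y where AB: "A \<union> B = insert e S" "A \<inter> B = {}" "card A \<ge> 2" "card B \<ge> 2" "x \<noteq> y"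
    and V: "vset (f(e := q)) A \<inter> vset (f(e := q)) B = {x, y}"
    and gA: "\<And>s. s \<in> A \<Longrightarrow> g s = Transposition.transpose x y ` (f(e := q)) s"
    and gB: "\<And>s. s \<in> B \<Longrightarrow> g s = (f(e := q)) s"
    using tw unfolding twist_def by metis
  let ?\<tau> = "Transposition.transpose x y"
  have inj\<tau>: "inj ?\<tau>" by (rule inj_transpose)
  have q': "card q = 2" "vset f S \<inter> vset f T' = q" using q by (auto simp: cut_pair_def T'_def)
  have eT: "e \<in> T'" "e \<notin> S" using e by (auto simp: T'_def)
  have fin: "finite T'" "finite A" "finite B"
    using finE S AB(1) by (auto simp: T'_def intro: finite_subset[of _ "insert e S"] finite_subset[of S E])
  show ?thesis
  proof (cases "e \<in> A")
    case True
    define P where "P = A - {e}"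
    have B: "e \<notin> B" "B \<subseteq> S" "P \<subseteq> S" "P \<union> B = S" "P \<inter> B = {}"
      using True AB eT by (auto simp: P_def)
    have "f(e := q) ` A = insert q (f ` P)" using True by (auto simp: P_def)
    then have VA: "vset (f(e := q)) A = q \<union> vset f P" by simp
    have VB: "vset (f(e := q)) B = vset f B" using B(1) by auto
    have VS: "vset f S = vset f P \<union> vset f B" using B(4) by blast
    define f' where "f' s = (if s \<in> P \<union> T' then ?\<tau> ` f s else f s)" for s
    have f'B: "f' s = f s" if "s \<in> B" for s
      using that B by (auto simp: f'_def T'_def)
    have "twist E f f'"
      unfolding twist_def
    proof (rule exI[of _ "P \<union> T'"], rule exI[of _ B], rule exI[of _ x], rule exI[of _ y], intro conjI)
      show "P \<union> T' \<union> B = E" "(P \<union> T') \<inter> B = {}" using B S by (auto simp: T'_def)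
      show "2 \<le> card (P \<union> T')" using T card_mono[of "P \<union> T'" T'] fin by (auto simp: P_def T'_def)
      show "2 \<le> card B" "x \<noteq> y" by fact+
      have "vset f T' \<inter> vset f B \<subseteq> q" using q' VS by blast
      moreover have "q \<subseteq> vset f T'" using q' by blast
      ultimately have "(q \<union> vset f P) \<inter> vset f B = (vset f P \<union> vset f T') \<inter> vset f B"
        by blast
      then show "vset f (P \<union> T') \<inter> vset f B = {x, y}"
        using V unfolding VA VB by (simp add: image_Un)
      show "\<forall>s\<in>P \<union> T'. f' s = ?\<tau> ` f s" by (simp add: f'_def)
      show "\<forall>s\<in>B. f' s = f s" using f'B by blast
    qed
    moreover have ge: "g e = ?\<tau> ` q" using gA[OF True] by simp
    moreover have "cut_pair E f' S (?\<tau> ` q)"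
    proof -
      have "{x, y} \<subseteq> vset f B" using V VB by blast
      then have "vset f B = ?\<tau> ` vset f B" by (simp add: transpose_image_vset)
      moreover have "vset f' P = ?\<tau> ` vset f P" by (simp add: f'_def image_UN)
      moreover have "vset f' B = vset f B" using f'B by simp
      moreover have "vset f' S = vset f' P \<union> vset f' B" using B(4) by blast
      ultimately have "vset f' S = ?\<tau> ` vset f S" unfolding VS image_Un by metis
      moreover have "vset f' T' = ?\<tau> ` vset f T'" by (simp add: f'_def image_UN)
      ultimately have "vset f' S \<inter> vset f' T' = ?\<tau> ` q"
        using q'(2) image_Int[OF inj\<tau>] by metis
      moreover have "card (?\<tau> ` q) = 2"
        using q'(1) by (simp add: card_image inj_on_subset[OF inj\<tau>])
      ultimately show ?thesis by (simp add: cut_pair_def T'_def)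
    qed
    moreover have "f' s = g s" if "s \<in> S" for s
    proof (cases "s \<in> P")
      case True
      then show ?thesis using gA[of s] eT that by (auto simp: f'_def P_def)
    next
      case False
      then have "s \<in> B" "s \<noteq> e" using B(4) that eT by blast+
      then show ?thesis using gB[of s] f'B[of s] by simp
    qed
    \<comment> \<open>The other part is moved as a whole, together with the pair \<open>q\<close>,
      so there the reversal is only a renaming of vertices.\<close>
    moreover have "labelled_iso (insert s (E - S)) (f(s := q)) (f'(s := ?\<tau> ` q))" for s
      by (rule labelled_isoI[of ?\<tau>]) (auto simp: f'_def T'_def intro: inj_on_subset[OF inj\<tau>])
    ultimately show ?thesis by (intro exI[of _ f']) simp
  next
    case False
    define P where "P = B - {e}"
    have eB: "e \<in> B" using False AB by blast
    have A: "A \<subseteq> S" "P \<subseteq> S" "P \<union> A = S" "P \<inter> A = {}"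
      using False AB eT by (auto simp: P_def)
    have "f(e := q) ` B = insert q (f ` P)" using eB by (auto simp: P_def)
    then have VB: "vset (f(e := q)) B = q \<union> vset f P" by simp
    have VA: "vset (f(e := q)) A = vset f A" using False by auto
    have VS: "vset f S = vset f P \<union> vset f A" using A(3) by blast
    define f' where "f' s = (if s \<in> A then ?\<tau> ` f s else f s)" for s
    have f'T: "f' s = f s" if "s \<in> T'" for s
      using that A by (auto simp: f'_def T'_def)
    have f'P: "f' s = f s" if "s \<in> P" for s
      using that A by (auto simp: f'_def)
    have "twist E f f'"
      unfolding twist_def
    proof (rule exI[of _ A], rule exI[of _ "P \<union> T'"], rule exI[of _ x], rule exI[of _ y], intro conjI)
      show "A \<union> (P \<union> T') = E" "A \<inter> (P \<union> T') = {}" using A S by (auto simp: T'_def)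
      show "2 \<le> card (P \<union> T')" using T card_mono[of "P \<union> T'" T'] fin by (auto simp: P_def T'_def)
      show "2 \<le> card A" "x \<noteq> y" by fact+
      have "vset f T' \<inter> vset f A \<subseteq> q" using q' VS by blast
      moreover have "q \<subseteq> vset f T'" using q' by blast
      ultimately have "vset f A \<inter> (q \<union> vset f P) = vset f A \<inter> (vset f P \<union> vset f T')"
        by blast
      then show "vset f A \<inter> vset f (P \<union> T') = {x, y}"
        using V unfolding VA VB by (simp add: image_Un)
      show "\<forall>s\<in>A. f' s = ?\<tau> ` f s" by (simp add: f'_def)
      show "\<forall>s\<in>P \<union> T'. f' s = f s" using f'T f'P by blast
    qed
    moreover have ge: "g e = q" using gB[OF eB] by simp
    moreover have "cut_pair E f' S q"
    proof -
      have "{x, y} \<subseteq> vset f A" using V VA by blast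
      then have "vset f A = ?\<tau> ` vset f A" by (simp add: transpose_image_vset)
      moreover have "vset f' A = ?\<tau> ` vset f A" by (simp add: f'_def image_UN)
      moreover have "vset f' P = vset f P" using f'P by simp
      moreover have "vset f' S = vset f' P \<union> vset f' A" using A(3) by blast
      ultimately have "vset f' S = vset f S" unfolding VS by metis
      moreover have "vset f' T' = vset f T'" using f'T by simp
      ultimately show ?thesis
        using q' by (simp add: cut_pair_def T'_def)
    qed
    moreover have "f' s = g s" if "s \<in> S" for s
    proof (cases "s \<in> P")
      case True
      then show ?thesis using gB[of s] f'P[of s] eT that by (auto simp: P_def)
    next
      case False
      then have "s \<in> A" "s \<noteq> e" using A(3) that eT by blast+
      then show ?thesis using gA[of s] by (simp add: f'_def)
    qed
    moreover have "labelled_iso (insert s (E - S)) (f(s := q)) (f'(s := q))" for s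
      by (rule labelled_iso_eq) (use f'T in \<open>auto simp: T'_def\<close>)
    ultimately show ?thesis by (intro exI[of _ f']) simp
  qed
qed

text \<open>The last clause protects the other part, which has its own virtual edge labelled
  \<open>s\<close>: reversals made for \<open>S\<close> change it only up to isomorphism, so the two
  parts can be treated one after the other.\<close>

lemma twist_lift_virtual:
  assumes f: "multigraph E f" and S: "S \<subseteq> E" and T: "card (E - S) \<ge> 2"
    and q: "cut_pair E f S q" and e: "e \<in> E - S"
    and tw: "(twist (insert e S))\<^sup>*\<^sup>* (f(e := q)) g"
  shows "\<exists>f'. (twist E)\<^sup>*\<^sup>* f f' \<and> cut_pair E f' S (g e) \<and> (\<forall>s\<in>S. f' s = g s) \<and>
    (\<forall>s\<in>S. labelled_iso (insert s (E - S)) (f(s := q)) (f'(s := g e)))"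
  using tw
proof (induction rule: rtranclp_induct)
  case base
  show ?case
    using q e by (intro exI[of _ f]) (auto intro: labelled_iso_eq)
next
  case (step g k)
  then obtain f1 where f1: "(twist E)\<^sup>*\<^sup>* f f1" "cut_pair E f1 S (g e)" "\<And>s. s \<in> S \<Longrightarrow> f1 s = g s"
    "\<And>s. s \<in> S \<Longrightarrow> labelled_iso (insert s (E - S)) (f(s := q)) (f1(s := g e))"
    by blast
  have "twist (insert e S) (f1(e := g e)) k"
    using step.hyps(2) by (rule twist_cong) (auto simp: f1(3))
  then obtain f2 where f2: "twist E f1 f2" "cut_pair E f2 S (k e)" "\<And>s. s \<in> S \<Longrightarrow> f2 s = k s"
    "\<And>s. s \<in> S \<Longrightarrow> labelled_iso (insert s (E - S)) (f1(s := g e)) (f2(s := k e))"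
    using twist_lift_virtual_step[OF twist_preserves(1)[OF f1(1) f] S T f1(2) e] by blast
  show ?case
    using f1 f2 labelled_iso_trans by (intro exI[of _ f2]) (blast intro: rtranclp.rtrancl_into_rtrancl)
qed

section \<open>Gluing the two parts of a 2-separation\<close>

lemma inj_on_if_mem:
  assumes "inj_on \<rho> A" "inj_on \<sigma> B" "\<And>v w. v \<in> A \<Longrightarrow> w \<in> B \<Longrightarrow> w \<notin> A \<Longrightarrow> \<rho> v \<noteq> \<sigma> w"
  shows "inj_on (\<lambda>v. if v \<in> A then \<rho> v else \<sigma> v) (A \<union> B)"
  using assms unfolding inj_on_def by (metis UnE)

text \<open>Agreement on common vertices makes the union a map; \<open>meet\<close> makes it
  injective, as images of the two parts might otherwise touch at further vertices.\<close>

lemma labelled_iso_glue: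
  assumes \<rho>: "inj_on \<rho> (vset f S)" "\<And>e. e \<in> S \<Longrightarrow> h e = \<rho> ` f e"
    and \<sigma>: "inj_on \<sigma> (vset f T)" "\<And>e. e \<in> T \<Longrightarrow> h e = \<sigma> ` f e"
    and agree: "\<And>v. v \<in> vset f S \<Longrightarrow> v \<in> vset f T \<Longrightarrow> \<rho> v = \<sigma> v"
    and meet: "vset h S \<inter> vset h T \<subseteq> \<sigma> ` (vset f S \<inter> vset f T)"
  shows "labelled_iso (S \<union> T) f h"
proof (rule labelled_isoI[of "\<lambda>v. if v \<in> vset f S then \<rho> v else \<sigma> v"])
  have *: "\<rho> v \<noteq> \<sigma> w" if vw: "v \<in> vset f S" "w \<in> vset f T" "w \<notin> vset f S" for v w
  proof
    assume eq: "\<rho> v = \<sigma> w"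
    have "\<rho> v \<in> vset h S" using vw(1) \<rho>(2) by blast
    moreover have "\<sigma> w \<in> vset h T" using vw(2) \<sigma>(2) by blast
    ultimately have "\<sigma> w \<in> \<sigma> ` (vset f S \<inter> vset f T)"
      unfolding eq using meet by (metis IntI subsetD)
    then obtain u where u0: "\<sigma> w = \<sigma> u" "u \<in> vset f S \<inter> vset f T" by (rule imageE)
    note u = u0(1) IntD1[OF u0(2)] IntD2[OF u0(2)]
    have "w = u" using inj_onD[OF \<sigma>(1) u(1) vw(2) u(3)] .
    then show False using u vw by blast
  qed
  have "vset f (S \<union> T) = vset f S \<union> vset f T" by (simp add: image_Un)
  then show "inj_on (\<lambda>v. if v \<in> vset f S then \<rho> v else \<sigma> v) (vset f (S \<union> T))"
    using inj_on_if_mem[OF \<rho>(1) \<sigma>(1)] * by metis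
  fix e assume e: "e \<in> S \<union> T"
  show "h e = (\<lambda>v. if v \<in> vset f S then \<rho> v else \<sigma> v) ` f e"
  proof (cases "e \<in> S")
    case True
    then have "v \<in> vset f S" if "v \<in> f e" for v using that by blast
    then have "(\<lambda>v. if v \<in> vset f S then \<rho> v else \<sigma> v) ` f e = \<rho> ` f e"
      by (intro image_cong) simp_all
    then show ?thesis using \<rho>(2)[OF True] by simp
  next
    case False
    then have eT: "e \<in> T" using e by blast
    then have "v \<in> vset f T" if "v \<in> f e" for v using that by blast
    then have "(\<lambda>v. if v \<in> vset f S then \<rho> v else \<sigma> v) ` f e = \<sigma> ` f e"
      by (intro image_cong) (simp_all add: agree del: UN_iff)
    then show ?thesis using \<sigma>(2)[OF eT] by simp
  qed
qed

text \<open>The virtual edges force both isomorphisms to send \<open>q\<close> onto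
  \<open>r\<close>. On \<open>q\<close> they agree or differ by an exchange, and in the latter case
  a reversal of \<open>S\<close> at \<open>q\<close> makes them agree.\<close>

lemma virtual_glue:
  assumes f: "multigraph E f" and S: "S \<subseteq> E" "card S \<ge> 2" "card (E - S) \<ge> 2"
    and q: "cut_pair E f S q" and r: "cut_pair E h S r"
    and e: "e \<in> E - S" and s: "s \<in> S"
    and isoS: "labelled_iso (insert e S) (f(e := q)) (h(e := r))"
    and isoT: "labelled_iso (insert s (E - S)) (f(s := q)) (h(s := r))"
  shows "\<exists>f'. (twist E)\<^sup>*\<^sup>* f f' \<and> labelled_iso E f' h"
proof -
  let ?T = "E - S"
  have V: "card q = 2" "vset f S \<inter> vset f ?T = q" "card r = 2" "vset h S \<inter> vset h ?T = r"
    using q r by (auto simp: cut_pair_def)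
  obtain \<rho> where \<rho>0: "inj_on \<rho> (vset (f(e := q)) (insert e S))"
    "\<And>u. u \<in> insert e S \<Longrightarrow> (h(e := r)) u = \<rho> ` (f(e := q)) u"
    using isoS unfolding labelled_iso_def by metis
  have "vset f S \<subseteq> vset (f(e := q)) (insert e S)" using e by auto
  with \<rho>0(1) have \<rho>1: "inj_on \<rho> (vset f S)" by (rule inj_on_subset)
  have \<rho>2: "h u = \<rho> ` f u" if "u \<in> S" for u
  proof -
    have "u \<noteq> e" using e that by blast
    then show ?thesis using \<rho>0(2)[of u] that by simp
  qed
  have \<rho>q: "r = \<rho> ` q" using \<rho>0(2)[of e] by simp
  obtain \<sigma> where \<sigma>0: "inj_on \<sigma> (vset (f(s := q)) (insert s ?T))"
    "\<And>u. u \<in> insert s ?T \<Longrightarrow> (h(s := r)) u = \<sigma> ` (f(s := q)) u"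
    using isoT unfolding labelled_iso_def by metis
  have "vset f ?T \<subseteq> vset (f(s := q)) (insert s ?T)" using s by auto
  with \<sigma>0(1) have \<sigma>1: "inj_on \<sigma> (vset f ?T)" by (rule inj_on_subset)
  have \<sigma>2: "h u = \<sigma> ` f u" if "u \<in> ?T" for u
  proof -
    have "u \<noteq> s" using s that by blast
    then show ?thesis using \<sigma>0(2)[of u] that by simp
  qed
  have \<sigma>q: "r = \<sigma> ` q" using \<sigma>0(2)[of s] by simp
  obtain x y where xy: "q = {x, y}" "x \<noteq> y" using V(1) by (auto simp: card_2_iff)
  have ET: "S \<union> ?T = E" using S(1) by blast
  show ?thesis
  proof (cases "\<rho> x = \<sigma> x")
    case True
    have "{\<rho> x, \<rho> y} = {\<sigma> x, \<sigma> y}" using \<rho>q \<sigma>q xy by simp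
    then have "\<rho> y = \<sigma> y" using True V(3) \<rho>q xy by (auto simp: doubleton_eq_iff)
    then have "labelled_iso (S \<union> ?T) f h"
      using True V \<sigma>q xy by (intro labelled_iso_glue[OF \<rho>1 \<rho>2 \<sigma>1 \<sigma>2]) auto
    then show ?thesis using ET by auto
  next
    case False
    have "{\<rho> x, \<rho> y} = {\<sigma> x, \<sigma> y}" using \<rho>q \<sigma>q xy by simp
    then have swap: "\<rho> x = \<sigma> y" "\<rho> y = \<sigma> x" using False by (auto simp: doubleton_eq_iff)
    let ?\<tau> = "Transposition.transpose x y"
    define f' where "f' u = (if u \<in> S then ?\<tau> ` f u else f u)" for u
    have f'T: "f' u = f u" if "u \<in> ?T" for u using that by (simp add: f'_def)
    have "twist E f f'"
      unfolding twist_def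
      by (rule exI[of _ S], rule exI[of _ ?T], rule exI[of _ x], rule exI[of _ y])
        (use S V xy in \<open>auto simp: f'_def\<close>)
    moreover have "labelled_iso (S \<union> ?T) f' h"
    proof (rule labelled_iso_glue)
      have "{x, y} \<subseteq> vset f S" using V xy by blast
      then have \<tau>VS: "?\<tau> ` vset f S = vset f S" by (simp add: transpose_image_vset)
      have "vset f' S = ?\<tau> ` vset f S" by (simp add: f'_def image_UN)
      then have VS: "vset f' S = vset f S" using \<tau>VS by simp
      have VT: "vset f' ?T = vset f ?T" using f'T by simp
      show "inj_on (\<rho> \<circ> ?\<tau>) (vset f' S)"
        unfolding VS using \<rho>1 \<tau>VS by (intro comp_inj_on) (auto intro: inj_on_subset[OF inj_transpose])
      show "h u = (\<rho> \<circ> ?\<tau>) ` f' u" if "u \<in> S" for u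
        using \<rho>2[OF that] that by (simp add: f'_def image_image)
      show "inj_on \<sigma> (vset f' ?T)" unfolding VT by (rule \<sigma>1)
      show "h u = \<sigma> ` f' u" if "u \<in> ?T" for u using \<sigma>2[OF that] f'T[OF that] by simp
      show "(\<rho> \<circ> ?\<tau>) v = \<sigma> v" if "v \<in> vset f' S" "v \<in> vset f' ?T" for v
      proof -
        have "v \<in> {x, y}" using that V(2) unfolding VS VT xy by blast
        then show ?thesis using swap by auto
      qed
      show "vset h S \<inter> vset h ?T \<subseteq> \<sigma> ` (vset f' S \<inter> vset f' ?T)"
        unfolding VS VT V(2,4) using \<sigma>q by simp
    qed
    ultimately show ?thesis using ET by auto
  qed
qed

lemma labelled_iso_card_le_1:
  assumes f: "multigraph E f" and h: "multigraph E h" and E: "card E \<le> 1"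
  shows "labelled_iso E f h"
proof (cases "E = {}")
  case True
  then show ?thesis by (simp add: labelled_iso_def)
next
  case False
  then have "card E = 1" using E multigraph_finite[OF f] by (simp add: Suc_leI card_gt_0_iff le_antisym)
  then obtain e where e: "E = {e}" by (auto simp: card_1_singleton_iff)
  obtain a b where ab: "f e = {a, b}" "a \<noteq> b" using multigraph_ends[OF f] e by blast
  obtain c d where cd: "h e = {c, d}" "c \<noteq> d" using multigraph_ends[OF h] e by blast
  show ?thesis
    by (rule labelled_isoI[of "\<lambda>v. if v = a then c else d"])
      (use ab cd e in \<open>auto simp: inj_on_def\<close>)
qed

theorem whitney_indecomposable:
  assumes "multigraph E f" "multigraph E h" "cuts E f = cuts E h" "indecomposable (cuts E f) E"
  shows "\<exists>f' h'. (twist E)\<^sup>*\<^sup>* f f' \<and> (twist E)\<^sup>*\<^sup>* h h' \<and> labelled_iso E f' h'"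
  using assms
proof (induction "card E" arbitrary: E f h rule: less_induct)
  case less
  note f = less.prems(1) and h = less.prems(2) and fh = less.prems(3) and ind = less.prems(4)
  let ?P = "\<lambda>S. S \<subseteq> E \<and> card S \<ge> 2 \<and> card (E - S) \<ge> 2 \<and> two_separator (cuts E f) S"
  have finE: "finite E" by (rule multigraph_finite[OF f])
  consider "card E \<le> 1" | "card E \<ge> 2" "\<nexists>S. ?P S" | "\<exists>S. ?P S"
  proof -
    have "card E \<le> 1 \<or> card E \<ge> 2" by linarith
    then show ?thesis using that by blast
  qed
  then show ?case
  proof cases
    case 1
    then show ?thesis using labelled_iso_card_le_1[OF f h] by blast
  next
    case 2
    then show ?thesis using labelled_iso_if_no_two_separator[OF f h fh ind] by blast
  next
    case 3
    \<comment> \<open>Least cardinality gives minimality under inclusion: a subset of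
      \<open>S\<close> has a larger complement, so the bound on the complement carries over.\<close>
    define S where "S = arg_min card ?P"
    have "?P S" "\<And>S'. ?P S' \<Longrightarrow> card S \<le> card S'"
      using 3 arg_min_nat_lemma[of ?P _ card] unfolding S_def by auto
    then have S: "S \<subseteq> E" "card S \<ge> 2" "card (E - S) \<ge> 2" "two_separator (cuts E f) S"
      and least: "\<And>S'. ?P S' \<Longrightarrow> card S \<le> card S'" by auto
    have finS: "finite S" using S(1) finE by (rule finite_subset)
    have min: "S' = S" if S': "S' \<subseteq> S" "card S' \<ge> 2" "two_separator (cuts E f) S'" for S'
    proof -
      have "card (E - S) \<le> card (E - S')" using finE S'(1) by (intro card_mono) auto
      then have "card S \<le> card S'" using least[of S'] S' S by auto
      then show ?thesis using card_seteq[OF finS S'(1)] by simp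
    qed
    have cardE: "card E = card S + card (E - S)"
      using card_Diff_subset[OF finS S(1)] card_mono[OF finE S(1)] by simp
    have ne: "S \<noteq> {}" "S \<noteq> E" using S(2,3) by auto
    \<comment> \<open>The alternative from \<open>minimal_two_separator\<close> concerns cuts only
      and so holds for \<open>h\<close> too. Each multigraph then gets its cut pair by reversals of
      its own.\<close>
    have fh_ex: "\<exists>f' q. (twist E)\<^sup>*\<^sup>* f f' \<and> cut_pair E f' S q"
      "\<exists>h' q. (twist E)\<^sup>*\<^sup>* h h' \<and> cut_pair E h' S q"
    proof -
      have *: "indecomposable (cuts S f) S \<or> (\<exists>a b. a \<noteq> b \<and> S = {a, b} \<and> {a, b} \<in> cuts E f)"
        using minimal_two_separator[OF f ind S min] by blast
      have "cuts S h = cuts S f" using fh by (simp add: cuts_restrict[OF S(1)])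
      with * fh have **: "indecomposable (cuts S h) S \<or> (\<exists>a b. a \<noteq> b \<and> S = {a, b} \<and> {a, b} \<in> cuts E h)"
        by simp
      have E3: "card E \<ge> 3" using cardE S by simp
      show "\<exists>f' q. (twist E)\<^sup>*\<^sup>* f f' \<and> cut_pair E f' S q"
        using * cut_pair_if_connected[OF f ind S(1) ne S(4)] cut_pair_series[OF f ind E3] by blast
      show "\<exists>h' q. (twist E)\<^sup>*\<^sup>* h h' \<and> cut_pair E h' S q"
        using ** cut_pair_if_connected[OF h _ S(1) ne] cut_pair_series[OF h _ E3] ind S(4)
        unfolding fh by blast
    qed
    obtain f1 q1 where f1: "(twist E)\<^sup>*\<^sup>* f f1" "cut_pair E f1 S q1" using fh_ex by blast
    obtain h1 r1 where h1: "(twist E)\<^sup>*\<^sup>* h h1" "cut_pair E h1 S r1" using fh_ex by blast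
    obtain s e where se: "s \<in> S" "e \<in> E - S" using ne S(1) by blast
    note mf1 = twist_preserves[OF f1(1) f] and mh1 = twist_preserves[OF h1(1) h]
    \<comment> \<open>Each part lacks at least two edges of \<open>E\<close> and gains one, so the
      induction needs both bounds in the definition of a 2-separation.\<close>
    have cards: "card (insert e S) < card E" "card (insert s (E - S)) < card E"
      using cardE S finS finE by (auto simp: card_insert_if)
    have T: "E - S \<subseteq> E" "E - S \<noteq> {}" "E - (E - S) = S" using se S by auto
    have "\<exists>g k. (twist (insert e S))\<^sup>*\<^sup>* (f1(e := q1)) g \<and> (twist (insert e S))\<^sup>*\<^sup>* (h1(e := r1)) k \<and>
        labelled_iso (insert e S) g k"
    proof (rule less.hyps[OF cards(1)])
      show "multigraph (insert e S) (f1(e := q1))" by (rule virtual_multigraph[OF mf1(1) S(1) f1(2)])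
      show "multigraph (insert e S) (h1(e := r1))" by (rule virtual_multigraph[OF mh1(1) S(1) h1(2)])
      show "cuts (insert e S) (f1(e := q1)) = cuts (insert e S) (h1(e := r1))"
        using virtual_cuts[OF mf1(1) _ S(1) ne(1) f1(2) se(2)]
          virtual_cuts[OF mh1(1) _ S(1) ne(1) h1(2) se(2)] mf1(2) mh1(2) ind fh by simp
      show "indecomposable (cuts (insert e S) (f1(e := q1))) (insert e S)"
        using virtual_indecomposable[OF mf1(1) _ S(1) ne(1) f1(2) se(2)] mf1(2) ind by simp
    qed
    then obtain g k where gk: "(twist (insert e S))\<^sup>*\<^sup>* (f1(e := q1)) g"
      "(twist (insert e S))\<^sup>*\<^sup>* (h1(e := r1)) k" "labelled_iso (insert e S) g k" by blast
    obtain f2 where f2: "(twist E)\<^sup>*\<^sup>* f1 f2" "cut_pair E f2 S (g e)" "\<And>s. s \<in> S \<Longrightarrow> f2 s = g s"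
      using twist_lift_virtual[OF mf1(1) S(1,3) f1(2) se(2) gk(1)] by blast
    obtain h2 where h2: "(twist E)\<^sup>*\<^sup>* h1 h2" "cut_pair E h2 S (k e)" "\<And>s. s \<in> S \<Longrightarrow> h2 s = k s"
      using twist_lift_virtual[OF mh1(1) S(1,3) h1(2) se(2) gk(2)] by blast
    have iso2: "labelled_iso (insert e S) (f2(e := g e)) (h2(e := k e))"
    proof -
      have "labelled_iso (insert e S) (f2(e := g e)) g" using f2(3) by (intro labelled_iso_eq) auto
      moreover have "labelled_iso (insert e S) k (h2(e := k e))" using h2(3) by (intro labelled_iso_eq) auto
      ultimately show ?thesis using gk(3) labelled_iso_trans by metis
    qed
    note mf2 = twist_preserves[OF f2(1) mf1(1)] and mh2 = twist_preserves[OF h2(1) mh1(1)]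
    have cp: "cut_pair E f2 (E - S) (g e)" "cut_pair E h2 (E - S) (k e)"
      using cut_pair_compl[OF S(1)] f2(2) h2(2) by auto
    have sT: "s \<in> E - (E - S)" "card (E - (E - S)) \<ge> 2" using se S T by auto
    \<comment> \<open>The second part is taken from the multigraphs already reversed for the first
      one.\<close>
    have "\<exists>g' k'. (twist (insert s (E - S)))\<^sup>*\<^sup>* (f2(s := g e)) g' \<and>
        (twist (insert s (E - S)))\<^sup>*\<^sup>* (h2(s := k e)) k' \<and> labelled_iso (insert s (E - S)) g' k'"
    proof (rule less.hyps[OF cards(2)])
      show "multigraph (insert s (E - S)) (f2(s := g e))"
        by (rule virtual_multigraph[OF mf2(1) T(1) cp(1)])
      show "multigraph (insert s (E - S)) (h2(s := k e))"
        by (rule virtual_multigraph[OF mh2(1) T(1) cp(2)])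
      show "cuts (insert s (E - S)) (f2(s := g e)) = cuts (insert s (E - S)) (h2(s := k e))"
        using virtual_cuts[OF mf2(1) _ T(1,2) cp(1) sT(1)]
          virtual_cuts[OF mh2(1) _ T(1,2) cp(2) sT(1)] mf2(2) mf1(2) mh2(2) mh1(2) ind fh by simp
      show "indecomposable (cuts (insert s (E - S)) (f2(s := g e))) (insert s (E - S))"
        using virtual_indecomposable[OF mf2(1) _ T(1,2) cp(1) sT(1)] mf2(2) mf1(2) ind by simp
    qed
    then obtain g' k' where gk': "(twist (insert s (E - S)))\<^sup>*\<^sup>* (f2(s := g e)) g'"
      "(twist (insert s (E - S)))\<^sup>*\<^sup>* (h2(s := k e)) k'" "labelled_iso (insert s (E - S)) g' k'" by blast
    \<comment> \<open>The lift is used with \<open>S\<close> and \<open>E - S\<close> exchanged. Its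
      last clause, taken at \<open>e\<close>, preserves the first part with its virtual edge up to
      isomorphism, so \<open>iso2\<close> survives.\<close>
    obtain f3 where f3: "(twist E)\<^sup>*\<^sup>* f2 f3" "cut_pair E f3 (E - S) (g' s)"
      "\<And>t. t \<in> E - S \<Longrightarrow> f3 t = g' t"
      "labelled_iso (insert e S) (f2(e := g e)) (f3(e := g' s))"
      using twist_lift_virtual[OF mf2(1) T(1) sT(2) cp(1) sT(1) gk'(1)] se(2) unfolding T(3) by blast
    obtain h3 where h3: "(twist E)\<^sup>*\<^sup>* h2 h3" "cut_pair E h3 (E - S) (k' s)"
      "\<And>t. t \<in> E - S \<Longrightarrow> h3 t = k' t"
      "labelled_iso (insert e S) (h2(e := k e)) (h3(e := k' s))"
      using twist_lift_virtual[OF mh2(1) T(1) sT(2) cp(2) sT(1) gk'(2)] se(2) unfolding T(3) by blast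
    have isoS: "labelled_iso (insert e S) (f3(e := g' s)) (h3(e := k' s))"
      using labelled_iso_trans[OF labelled_iso_sym[OF f3(4)] labelled_iso_trans[OF iso2 h3(4)]] .
    have isoT: "labelled_iso (insert s (E - S)) (f3(s := g' s)) (h3(s := k' s))"
    proof -
      have "labelled_iso (insert s (E - S)) (f3(s := g' s)) g'" using f3(3) by (intro labelled_iso_eq) auto
      moreover have "labelled_iso (insert s (E - S)) k' (h3(s := k' s))"
        using h3(3) by (intro labelled_iso_eq) auto
      ultimately show ?thesis using gk'(3) labelled_iso_trans by metis
    qed
    have "cut_pair E f3 S (g' s)" "cut_pair E h3 S (k' s)"
      using cut_pair_compl[OF T(1)] f3(2) h3(2) unfolding T(3) by auto
    then obtain f4 where f4: "(twist E)\<^sup>*\<^sup>* f3 f4" "labelled_iso E f4 h3"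
      using virtual_glue[OF twist_preserves(1)[OF f3(1) mf2(1)] S(1-3) _ _ se(2,1) isoS isoT] by blast
    have "(twist E)\<^sup>*\<^sup>* f f4" using f1(1) f2(1) f3(1) f4(1) by (meson rtranclp_trans)
    moreover have "(twist E)\<^sup>*\<^sup>* h h3" using h1(1) h2(1) h3(1) by (meson rtranclp_trans)
    ultimately show ?thesis using f4(2) by blast
  qed
qed

subsection \<open>Blocks\<close>

text \<open>Two vertices of a block are never joined by edges outside it. As \<open>B\<close> is a
  separator, the star of \<open>v\<close> within \<open>B\<close> is a cut of \<open>E\<close>; no
  edge outside \<open>B\<close> crosses its side, and since \<open>B\<close> is connected, this side
  or its complement meets \<open>B\<close> in \<open>v\<close> alone.\<close>

lemma block_vertex_isolating:
  assumes f: "multigraph E f" and B: "block (cuts E f) B" "B \<subseteq> E" and v: "v \<in> vset f B"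
  shows "\<exists>U. edge_cut (E - B) f U = {} \<and> vset f B \<inter> U = {v}"
proof -
  have "edge_cut E f {v} \<inter> B \<in> cuts E f"
    using B(1) by (auto simp: block_def separator_def)
  then obtain U where U: "edge_cut E f {v} \<inter> B = edge_cut E f U" by (auto simp: cuts_def)
  have out: "edge_cut (E - B) f U = {}"
    using U cut_Int[of "E - B" E f U] by auto
  have "edge_cut B f U = edge_cut B f {v}"
    using U unfolding cut_Int[OF B(2)] by blast
  then have "edge_cut B f (sym_diff U {v}) = {}"
    using cut_sym_diff[OF multigraph_subset[OF f B(2)], of U "{v}"] by auto
  then have "vset f B \<subseteq> sym_diff U {v} \<or> vset f B \<inter> sym_diff U {v} = {}"
    by (rule block_connected[OF B])
  then show ?thesis
  proof
    assume "vset f B \<subseteq> sym_diff U {v}"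
    then have "vset f B \<inter> - U = {v}" using v by blast
    then show ?thesis using out cut_compl by metis
  next
    assume "vset f B \<inter> sym_diff U {v} = {}"
    then have "vset f B \<inter> U = {v}" using v by blast
    then show ?thesis using out by blast
  qed
qed

text \<open>Everything that hangs off the reversed side of the block is reversed as well.\<close>

lemma twist_lift_block_step:
  assumes f: "multigraph E f" and B: "block (cuts E f) B" "B \<subseteq> E" and tw: "twist B f g"
  shows "\<exists>f'. twist E f f' \<and> (\<forall>e\<in>B. f' e = g e) \<and>
    (\<forall>B'. block (cuts E f) B' \<longrightarrow> B' \<subseteq> E \<longrightarrow> B' \<noteq> B \<longrightarrow> labelled_iso B' f f')"
proof -
  obtain S T x y where ST: "S \<union> T = B" "S \<inter> T = {}" "card S \<ge> 2" "card T \<ge> 2" "x \<noteq> y"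
    and V: "vset f S \<inter> vset f T = {x, y}"
    and gS: "\<And>s. s \<in> S \<Longrightarrow> g s = Transposition.transpose x y ` f s"
    and gT: "\<And>s. s \<in> T \<Longrightarrow> g s = f s"
    using tw unfolding twist_def by metis
  let ?\<tau> = "Transposition.transpose x y"
  have finE: "finite E" by (rule multigraph_finite[OF f])
  \<comment> \<open>\<open>Z\<close> is what edges outside \<open>B\<close> reach from the vertices
    of \<open>S\<close> other than \<open>x\<close> and \<open>y\<close>. What hangs off
    \<open>x\<close> or \<open>y\<close> stays in place.\<close>
  define C where "C = vset f S - {x, y}"
  define Z where "Z = \<Inter> {Y. C \<subseteq> Y \<and> edge_cut (E - B) f Y = {}}"
  have CZ: "C \<subseteq> Z" by (auto simp: Z_def)
  have VB: "vset f B = vset f S \<union> vset f T" using ST(1) by blast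
  \<comment> \<open>Another vertex of \<open>B\<close> in \<open>Z\<close> would be joined to
    \<open>C\<close> outside \<open>B\<close>, which the set \<open>U\<close> around it
    excludes.\<close>
  have ZB: "v \<in> C" if v: "v \<in> Z" "v \<in> vset f B" for v
  proof (rule ccontr)
    assume "v \<notin> C"
    obtain U where U: "edge_cut (E - B) f U = {}" "vset f B \<inter> U = {v}"
      using block_vertex_isolating[OF f B v(2)] by blast
    have "C \<subseteq> vset f B - {v}" using \<open>v \<notin> C\<close> VB by (auto simp: C_def)
    then have "C \<subseteq> - U" using U(2) by blast
    then have "v \<in> - U" using v(1) U(1) by (auto simp: Z_def cut_compl)
    then show False using U(2) by blast
  qed
  have Zcut: "f e \<subseteq> Z" if e: "e \<in> E - B" "w \<in> f e" "w \<in> Z" for e w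
  proof
    fix u assume u: "u \<in> f e"
    show "u \<in> Z"
      unfolding Z_def
    proof (rule InterI, clarify)
      fix Y assume Y: "C \<subseteq> Y" "edge_cut (E - B) f Y = {}"
      then have "w \<in> Y" using e(3) by (auto simp: Z_def)
      then show "u \<in> Y" using Y(2) e(1,2) u unfolding edge_cut_def by blast
    qed
  qed
  define S' where "S' = S \<union> {e \<in> E - B. f e \<subseteq> Z}"
  have SE: "S \<subseteq> E" "T \<subseteq> E" using ST B by blast+
  have S'E: "S' \<subseteq> E" using SE by (auto simp: S'_def)
  have TS': "T \<subseteq> E - S'" using ST SE by (auto simp: S'_def)
  have VS': "v \<in> vset f S \<or> v \<in> Z" if "v \<in> vset f S'" for v
    using that by (auto simp: S'_def)
  have VT': "v \<in> vset f T \<or> v \<notin> Z" if v: "v \<in> vset f (E - S')" for v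
  proof -
    obtain e where e: "e \<in> E" "e \<notin> S'" "v \<in> f e" using v by blast
    show ?thesis
    proof (cases "e \<in> B")
      case True
      then show ?thesis using e ST by (auto simp: S'_def)
    next
      case False
      then show ?thesis using e Zcut[of e v] by (auto simp: S'_def)
    qed
  qed
  have V': "vset f S' \<inter> vset f (E - S') = {x, y}"
  proof (rule subset_antisym)
    show "vset f S' \<inter> vset f (E - S') \<subseteq> {x, y}"
    proof
      fix v assume "v \<in> vset f S' \<inter> vset f (E - S')"
      then have "v \<in> vset f S \<or> v \<in> Z" "v \<in> vset f T \<or> v \<notin> Z" using VS' VT' by blast+
      moreover have "v \<in> C" if "v \<in> Z" "v \<in> vset f T" using ZB that VB by blast
      moreover have "v \<in> Z" if "v \<in> vset f S" "v \<notin> {x, y}"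
        using CZ that unfolding C_def by (meson DiffI subsetD)
      moreover have "v \<in> vset f S" "v \<notin> {x, y}" if "v \<in> C"
        using that unfolding C_def by (meson DiffE)+
      moreover have "v \<in> {x, y}" if "v \<in> vset f S" "v \<in> vset f T"
        using V that by (metis IntI)
      ultimately show "v \<in> {x, y}" by argo
    qed
    have "vset f S \<subseteq> vset f S'" by (auto simp: S'_def)
    moreover have "vset f T \<subseteq> vset f (E - S')" using TS' by blast
    ultimately show "{x, y} \<subseteq> vset f S' \<inter> vset f (E - S')"
      unfolding V[symmetric] by (rule Int_mono)
  qed
  define f' where "f' e = (if e \<in> S' then ?\<tau> ` f e else f e)" for e
  have "twist E f f'"
    unfolding twist_def
  proof (rule exI[of _ S'], rule exI[of _ "E - S'"], rule exI[of _ x], rule exI[of _ y], intro conjI)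
    show "S' \<union> (E - S') = E" "S' \<inter> (E - S') = {}" using S'E by blast+
    show "2 \<le> card S'"
      using ST(3) card_mono[of S' S] finite_subset[OF S'E finE] by (auto simp: S'_def)
    show "2 \<le> card (E - S')" using ST(4) card_mono[OF _ TS'] finE by auto
    show "x \<noteq> y" "vset f S' \<inter> vset f (E - S') = {x, y}" by fact+
  qed (auto simp: f'_def)
  moreover have "f' e = g e" if "e \<in> B" for e
  proof (cases "e \<in> S")
    case True
    then show ?thesis using gS by (simp add: f'_def S'_def)
  next
    case False
    then have "e \<in> T" "e \<notin> S'" using that ST by (auto simp: S'_def)
    then show ?thesis using gT by (simp add: f'_def)
  qed
  \<comment> \<open>Any other block is connected by edges outside \<open>B\<close>, so it lies
    inside \<open>Z\<close> or is disjoint from it, and the reversal renames all of its vertices or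
    moves none.\<close>
  moreover have "labelled_iso B' f f'" if B': "block (cuts E f) B'" "B' \<subseteq> E" "B' \<noteq> B" for B'
  proof -
    have "B' \<inter> B = {}"
      using block_subset_or_disjoint[OF B'(1), of B] B(1) B' unfolding block_def by blast
    then have sub: "B' \<subseteq> E - B" using B' by blast
    then have "edge_cut B' f Z = {}" using Zcut unfolding edge_cut_def by blast
    then have "vset f B' \<subseteq> Z \<or> vset f B' \<inter> Z = {}" by (rule block_connected[OF B'(1,2)])
    then show ?thesis
    proof
      assume "vset f B' \<subseteq> Z"
      then have "B' \<subseteq> S'" using sub by (auto simp: S'_def)
      then show ?thesis
        by (intro labelled_isoI[of ?\<tau>]) (auto simp: f'_def intro: inj_on_subset[OF inj_transpose])
    next
      assume disj: "vset f B' \<inter> Z = {}"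
      have "e \<notin> S'" if e: "e \<in> B'" for e
      proof
        assume "e \<in> S'"
        then have "f e \<subseteq> Z" using sub ST e by (auto simp: S'_def)
        moreover have "e \<in> E" using e B' by blast
        then obtain a b where "f e = {a, b}" using multigraph_ends[OF f] by metis
        ultimately show False using disj e by auto
      qed
      then show ?thesis by (intro labelled_iso_eq) (simp add: f'_def)
    qed
  qed
  ultimately show ?thesis by (intro exI[of _ f']) simp
qed

lemma twist_lift_block:
  assumes f: "multigraph E f" and B: "block (cuts E f) B" "B \<subseteq> E" and tw: "(twist B)\<^sup>*\<^sup>* f g"
  shows "\<exists>f'. (twist E)\<^sup>*\<^sup>* f f' \<and> (\<forall>e\<in>B. f' e = g e) \<and>
    (\<forall>B'. block (cuts E f) B' \<longrightarrow> B' \<subseteq> E \<longrightarrow> B' \<noteq> B \<longrightarrow> labelled_iso B' f f')"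
  using tw
proof (induction rule: rtranclp_induct)
  case base
  show ?case by (intro exI[of _ f]) (auto intro: labelled_iso_eq)
next
  case (step g k)
  then obtain f1 where f1: "(twist E)\<^sup>*\<^sup>* f f1" "\<And>e. e \<in> B \<Longrightarrow> f1 e = g e"
    "\<And>B'. block (cuts E f) B' \<Longrightarrow> B' \<subseteq> E \<Longrightarrow> B' \<noteq> B \<Longrightarrow> labelled_iso B' f f1" by blast
  note m = twist_preserves[OF f1(1) f]
  have "twist B f1 k" by (rule twist_cong[OF step.hyps(2) f1(2)])
  then obtain f2 where f2: "twist E f1 f2" "\<And>e. e \<in> B \<Longrightarrow> f2 e = k e"
    "\<And>B'. block (cuts E f) B' \<Longrightarrow> B' \<subseteq> E \<Longrightarrow> B' \<noteq> B \<Longrightarrow> labelled_iso B' f1 f2"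
    using twist_lift_block_step[OF m(1) _ B(2), of k] B(1) m(2) by metis
  show ?case
    using f1 f2 labelled_iso_trans
    by (intro exI[of _ f2]) (blast intro: rtranclp.rtrancl_into_rtrancl)
qed

text \<open>Blocks are treated one at a time: reversals lifted from one block change the others only
  up to isomorphism, so earlier matches persist. The resulting isomorphisms need not agree at shared
  vertices, which is why splits are still required.\<close>

theorem whitney_blocks:
  assumes f: "multigraph E f" and h: "multigraph E h" and fh: "cuts E f = cuts E h"
  shows "\<exists>f' h'. (twist E)\<^sup>*\<^sup>* f f' \<and> (twist E)\<^sup>*\<^sup>* h h' \<and>
    (\<forall>B. block (cuts E f) B \<longrightarrow> B \<subseteq> E \<longrightarrow> labelled_iso B f' h')"
proof -
  let ?BB = "{B. block (cuts E f) B \<and> B \<subseteq> E}"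
  have "\<exists>f' h'. (twist E)\<^sup>*\<^sup>* f f' \<and> (twist E)\<^sup>*\<^sup>* h h' \<and> (\<forall>B\<in>A. labelled_iso B f' h')"
    if "finite A" "A \<subseteq> ?BB" for A
    using that
  proof (induction A)
    case empty
    then show ?case by blast
  next
    case (insert B A)
    then obtain f1 h1 where 1: "(twist E)\<^sup>*\<^sup>* f f1" "(twist E)\<^sup>*\<^sup>* h h1"
      "\<And>B'. B' \<in> A \<Longrightarrow> labelled_iso B' f1 h1" by blast
    have B: "block (cuts E f) B" "B \<subseteq> E" using insert.prems by auto
    note mf = twist_preserves[OF 1(1) f] and mh = twist_preserves[OF 1(2) h]
    have bf: "block (cuts E f1) B" "block (cuts E h1) B" using B fh mf(2) mh(2) by auto
    obtain g k where gk: "(twist B)\<^sup>*\<^sup>* f1 g" "(twist B)\<^sup>*\<^sup>* h1 k" "labelled_iso B g k"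
      using whitney_indecomposable[OF multigraph_subset[OF mf(1) B(2)] multigraph_subset[OF mh(1) B(2)]]
        block_indecomposable[OF bf(1) B(2)] cuts_restrict[OF B(2)] mf(2) mh(2) fh by metis
    obtain f2 where f2: "(twist E)\<^sup>*\<^sup>* f1 f2" "\<And>e. e \<in> B \<Longrightarrow> f2 e = g e"
      "\<And>B'. block (cuts E f1) B' \<Longrightarrow> B' \<subseteq> E \<Longrightarrow> B' \<noteq> B \<Longrightarrow> labelled_iso B' f1 f2"
      using twist_lift_block[OF mf(1) bf(1) B(2) gk(1)] by blast
    obtain h2 where h2: "(twist E)\<^sup>*\<^sup>* h1 h2" "\<And>e. e \<in> B \<Longrightarrow> h2 e = k e"
      "\<And>B'. block (cuts E h1) B' \<Longrightarrow> B' \<subseteq> E \<Longrightarrow> B' \<noteq> B \<Longrightarrow> labelled_iso B' h1 h2"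
      using twist_lift_block[OF mh(1) bf(2) B(2) gk(2)] by blast
    have "labelled_iso B' f2 h2" if B': "B' \<in> insert B A" for B'
    proof (cases "B' = B")
      case True
      have "labelled_iso B f2 g" "labelled_iso B k h2"
        using f2(2) h2(2) by (auto intro: labelled_iso_eq)
      then show ?thesis using True gk(3) labelled_iso_trans by metis
    next
      case False
      then have *: "B' \<in> A" "block (cuts E f) B'" "B' \<subseteq> E" using B' insert.prems by auto
      have "labelled_iso B' f1 f2" using f2(3)[of B'] * False mf(2) by simp
      moreover have "labelled_iso B' h1 h2" using h2(3)[of B'] * False mh(2) fh by simp
      ultimately show ?thesis using 1(3)[OF *(1)] labelled_iso_trans labelled_iso_sym by metis
    qed
    then show ?case using 1(1,2) f2(1) h2(1) by (meson rtranclp_trans)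
  qed
  moreover have "finite ?BB" by (rule finite_subset[of _ "Pow E"]) (auto simp: multigraph_finite[OF f])
  ultimately have "\<exists>f' h'. (twist E)\<^sup>*\<^sup>* f f' \<and> (twist E)\<^sup>*\<^sup>* h h' \<and> (\<forall>B\<in>?BB. labelled_iso B f' h')"
    by blast
  then show ?thesis by (simp add: imp_conjL)
qed

subsection \<open>Splitting into blocks\<close>

lemma vertex_splitD:
  assumes "vertex_split E f x x' R g"
  shows "R \<subseteq> E" "x' \<notin> vset f E" "vset f R \<inter> vset f (E - R) \<subseteq> {x}"
    "e \<in> R \<Longrightarrow> g e = f e" "e \<in> E - R \<Longrightarrow> g e = (id(x := x')) ` f e"
proof -
  note * = assms[unfolded vertex_split_def]
  show "R \<subseteq> E" using * by (elim conjE)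
  show "x' \<notin> vset f E" using * by (elim conjE)
  show "vset f R \<inter> vset f (E - R) \<subseteq> {x}" using * by (elim conjE)
  have "\<forall>e\<in>R. g e = f e" using * by (elim conjE)
  then show "e \<in> R \<Longrightarrow> g e = f e" by (rule bspec)
  have "\<forall>e\<in>E - R. g e = (id(x := x')) ` f e" using * by (elim conjE)
  then show "e \<in> E - R \<Longrightarrow> g e = (id(x := x')) ` f e" by (rule bspec)
qed

lemma vertex_split_vset:
  assumes s: "vertex_split E f x x' R g" and x: "x \<in> vset f R" "x \<in> vset f (E - R)"
  shows "vset g E = insert x' (vset f E)"
proof -
  have R: "R \<union> (E - R) = E" using vertex_splitD(1)[OF s] by blast
  have "vset g R = vset f R" using vertex_splitD(4)[OF s] by simp
  moreover have "vset g (E - R) = (\<Union>e\<in>E - R. (id(x := x')) ` f e)"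
    by (intro SUP_cong refl vertex_splitD(5)[OF s])
  then have "vset g (E - R) = (id(x := x')) ` vset f (E - R)"
    by (simp only: image_UN)
  moreover have "(id(x := x')) ` vset f (E - R) = insert x' (vset f (E - R) - {x})"
    using x(2) by (simp only: fun_upd_image if_True image_id id_apply)
  moreover have "vset g E = vset g R \<union> vset g (E - R)" "vset f E = vset f R \<union> vset f (E - R)"
    using R by blast+
  ultimately show ?thesis using x(1) by auto
qed

lemma inj_on_fun_upd_fresh: "x' \<notin> A \<Longrightarrow> inj_on (id(x := x')) A"
  by (auto simp: inj_on_def)

lemma vertex_split_block:
  assumes s: "vertex_split E f x x' R g" and B: "block (cuts E f) B" "B \<subseteq> E"
  shows "labelled_iso B f g"
proof -
  have "separator (cuts E f) R"
    by (rule separator_one_vertex[OF vertex_splitD(1,3)[OF s]])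
  then consider "B \<subseteq> R" | "B \<inter> R = {}" using block_subset_or_disjoint[OF B(1)] by blast
  then show ?thesis
  proof cases
    case 1
    then show ?thesis using vertex_splitD(4)[OF s] by (intro labelled_iso_eq) auto
  next
    case 2
    show ?thesis
    proof (rule labelled_isoI[of "id(x := x')"])
      show "inj_on (id(x := x')) (vset f B)"
        using vertex_splitD(2)[OF s] B by (intro inj_on_fun_upd_fresh) blast
      show "g e = (id(x := x')) ` f e" if "e \<in> B" for e
        by (rule vertex_splitD(5)[OF s]) (use that 2 B in blast)
    qed
  qed
qed

text \<open>Needed because a graph has a set of edges: two labels with the same ends would merge. If
  a moved edge coincides with a kept one, its image avoids \<open>x'\<close>, so the edge avoided
  \<open>x\<close> and was not changed.\<close>

lemma vertex_split_inj_on: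
  assumes s: "vertex_split E f x x' R g" and inj: "inj_on f E"
  shows "inj_on g E"
proof (rule inj_onI)
  fix e e' assume e: "e \<in> E" "e' \<in> E" "g e = g e'"
  have *: "f e = f e'" if e: "e \<in> R" "e' \<in> E - R" "g e = g e'" for e e'
  proof -
    have "f e = (id(x := x')) ` f e'"
      using vertex_splitD(4)[OF s e(1)] vertex_splitD(5)[OF s e(2)] e(3) by metis
    moreover have "x' \<notin> f e" using vertex_splitD(1,2)[OF s] e by blast
    ultimately have "x \<notin> f e'" by (metis fun_upd_same imageI)
    then have "(id(x := x')) ` f e' = f e'" by (simp only: fun_upd_image if_False image_id id_apply)
    then show ?thesis using \<open>f e = _\<close> by simp
  qed
  have **: "f e = f e'" if "e \<in> E - R" "e' \<in> E - R" "g e = g e'" for e e'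
  proof -
    have "inj_on (id(x := x')) (vset f E)" by (rule inj_on_fun_upd_fresh[OF vertex_splitD(2)[OF s]])
    moreover have "(id(x := x')) ` f e = (id(x := x')) ` f e'"
      using vertex_splitD(5)[OF s that(1)] vertex_splitD(5)[OF s that(2)] that(3) by metis
    moreover have "f e \<subseteq> vset f E" "f e' \<subseteq> vset f E" using that by blast+
    ultimately show ?thesis using inj_on_image_eq_iff by metis
  qed
  have "f e = f e'"
  proof (cases "e \<in> R"; cases "e' \<in> R")
    assume "e \<in> R" "e' \<in> R"
    then show ?thesis using vertex_splitD(4)[OF s] e(3) by metis
  next
    assume "e \<in> R" "e' \<notin> R"
    then show ?thesis using *[of e e'] e by blast
  next
    assume "e \<notin> R" "e' \<in> R"
    then show ?thesis using *[of e' e] e by force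
  next
    assume "e \<notin> R" "e' \<notin> R"
    then show ?thesis using **[of e e'] e by blast
  qed
  then show "e = e'" using inj e by (metis inj_onD)
qed

text \<open>A separator may share several vertices with its complement, while a split handles one.
  The edges of \<open>R\<close> at \<open>x\<close> form a cut with a side \<open>Y\<close> avoiding
  \<open>x\<close>; only edges at \<open>x\<close> leave \<open>Y\<close>, so the edges that meet
  \<open>Y\<close> touch the others at \<open>x\<close> alone.\<close>

lemma separator_split_vertex:
  assumes f: "multigraph E f" and R: "separator (cuts E f) R" "R \<subseteq> E"
    and x: "x \<in> vset f R" "x \<in> vset f (E - R)"
  shows "\<exists>R'\<subseteq>E. vset f R' \<inter> vset f (E - R') \<subseteq> {x} \<and> x \<in> vset f R' \<and> x \<in> vset f (E - R')"
proof -
  have "star E f x \<inter> R \<in> cuts E f" using star_in_cuts[OF f] R by (auto simp: separator_def)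
  then obtain Y where Y: "star E f x \<inter> R = edge_cut E f Y" "x \<notin> Y" by (rule cuts_avoiding)
  let ?R = "{e \<in> E. f e \<inter> Y \<noteq> {}}"
  have "vset f ?R \<inter> vset f (E - ?R) \<subseteq> {x}"
  proof
    fix w assume "w \<in> vset f ?R \<inter> vset f (E - ?R)"
    then obtain e where e: "e \<in> E" "w \<in> f e" "f e \<inter> Y \<noteq> {}" "w \<notin> Y" by blast
    obtain u where u: "f e = {w, u}" using multigraph_ends_at[OF f e(1,2)] .
    have "e \<in> edge_cut E f Y" using e by (auto simp: edge_cut_def)
    then have "x \<in> f e" using Y(1) by blast
    then show "w \<in> {x}" using u e Y by auto
  qed
  moreover have "x \<in> vset f ?R"
  proof -
    obtain e where e: "e \<in> R" "x \<in> f e" using x by blast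
    then have "e \<in> edge_cut E f Y" using Y(1) R by blast
    then show ?thesis using e by (auto simp: edge_cut_def)
  qed
  moreover have "x \<in> vset f (E - ?R)"
  proof -
    obtain e where e: "e \<in> E - R" "x \<in> f e" using x by blast
    then have "e \<notin> edge_cut E f Y" using Y(1) by blast
    then have "e \<notin> ?R" using e Y(2) by (auto simp: edge_cut_def)
    then show ?thesis using e by blast
  qed
  ultimately show ?thesis by (intro exI[of _ ?R]) blast
qed

lemma split_op_vertex_split:
  assumes f: "multigraph E f" and V: "vset f E \<subseteq> V" "x' \<notin> V"
    and s: "vertex_split E f x x' R g" and x: "x \<in> vset f R" "x \<in> vset f (E - R)"
  shows "split_op (Graph V (f ` E)) (Graph (insert x' V) (g ` E))"
proof -
  let ?G = "Graph V (f ` E)"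
  note R = vertex_splitD(1,3,4,5)[OF s]
  define A where "A = vset f R - {x}"
  \<comment> \<open>The isolated vertices in \<open>V\<close> go to this side.\<close>
  define B where "B = V - {x} - A"
  have xV: "x \<in> V" using x R(1) V by blast
  have AV: "A \<subseteq> V" using R(1) V by (auto simp: A_def)
  have adj: "adj ?G u w \<longleftrightarrow> (\<exists>e\<in>E. f e = {u, w})" for u w
    by (auto simp: adj_def)
  have RA: "f e \<subseteq> insert x A" if "e \<in> R" for e using that by (auto simp: A_def)
  have RB: "f e \<subseteq> insert x B" if "e \<in> E - R" for e
  proof
    fix v assume v: "v \<in> f e"
    then have "v \<in> V" "v \<notin> A" using V(1) that R(2) by (auto simp: A_def)
    then show "v \<in> insert x B" by (simp add: B_def)
  qed
  have noadj: "\<not> adj ?G a b" if ab: "a \<in> A" "b \<in> B" for a b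
  proof
    assume "adj ?G a b"
    then obtain e where e: "e \<in> E" "f e = {a, b}" using adj by blast
    have "a \<noteq> x" "b \<noteq> x" "a \<notin> B" "b \<notin> A" using ab by (auto simp: A_def B_def)
    then show False using RA[of e] RB[of e] e by auto
  qed
  obtain ea where ea: "ea \<in> R" "x \<in> f ea" using x by blast
  obtain a where a: "f ea = {x, a}" "x \<noteq> a" using multigraph_ends_at[OF f] ea R(1) by (metis subsetD)
  obtain eb where eb: "eb \<in> E - R" "x \<in> f eb" using x by blast
  obtain b where b: "f eb = {x, b}" "x \<noteq> b" using multigraph_ends_at[OF f] eb by (metis DiffD1)
  have ab: "a \<in> A" "b \<in> B" "adj ?G x a" "adj ?G x b"
    using RA[OF ea(1)] RB[OF eb(1)] a b ea(1) eb(1) R(1) by (auto simp: adj)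
  have cv: "cut_vertex ?G x"
  proof -
    have "x \<in> verts ?G" using xV by simp
    moreover have "a \<in> verts ?G - {x}" "b \<in> verts ?G - {x}"
      using ab AV by (auto simp: A_def B_def)
    moreover have "adj ?G a x" using ab(3) by (simp add: adj_def insert_commute)
    then have "(adj ?G)\<^sup>*\<^sup>* a b" using ab(4) by (meson r_into_rtranclp rtranclp.rtrancl_into_rtrancl)
    moreover have "\<not> (adj (delete_vertex ?G x))\<^sup>*\<^sup>* a b"
    proof
      assume "(adj (delete_vertex ?G x))\<^sup>*\<^sup>* a b"
      then have "b \<in> A"
      proof (induction rule: rtranclp_induct)
        case base
        show ?case by (rule ab(1))
      next
        case (step u w)
        have *: "{u, w} \<in> f ` E" "x \<notin> {u, w}"
          using step.hyps(2) by (auto simp: adj_def delete_vertex_def)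
        then have "w \<in> V" using V(1) by blast
        then have "w \<in> A \<or> w \<in> B" using * by (auto simp: B_def)
        moreover have "adj ?G u w" using * by (simp add: adj_def)
        ultimately show ?case using noadj step.IH by blast
      qed
      then show False using ab(2) by (simp add: B_def)
    qed
    ultimately show ?thesis unfolding cut_vertex_def by blast
  qed
  have A_edges: "{s \<in> f ` E. s \<subseteq> insert x A} = f ` R"
  proof -
    have "e \<in> R" if e: "e \<in> E" "f e \<subseteq> insert x A" for e
    proof (rule ccontr)
      assume "e \<notin> R"
      then have "f e \<subseteq> insert x B" using RB e by blast
      then have "f e \<subseteq> {x}" using e(2) by (auto simp: B_def)
      moreover obtain u w where "f e = {u, w}" "u \<noteq> w" using multigraph_ends[OF f e(1)] .
      ultimately show False by auto
    qed
    then show ?thesis using RA R(1) by auto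
  qed
  have B_edges: "{s \<in> f ` E. s \<subseteq> insert x B} = f ` (E - R)"
  proof -
    have "e \<notin> R" if e: "e \<in> E" "f e \<subseteq> insert x B" for e
    proof
      assume "e \<in> R"
      then have "f e \<subseteq> insert x A" using RA by blast
      then have "f e \<subseteq> {x}" using e(2) by (auto simp: B_def)
      moreover obtain u w where "f e = {u, w}" "u \<noteq> w" using multigraph_ends[OF f e(1)] .
      ultimately show False by auto
    qed
    then show ?thesis using RB by auto
  qed
  have g_edges: "g ` E = f ` R \<union> (\<lambda>s. (id(x := x')) ` s) ` f ` (E - R)"
  proof -
    have "g ` R = f ` R" using R(3) by (intro image_cong) auto
    moreover have "g ` (E - R) = (\<lambda>s. (id(x := x')) ` s) ` f ` (E - R)"
      unfolding image_image using R(4) by (intro image_cong) auto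
    moreover have "g ` E = g ` R \<union> g ` (E - R)" using R(1) by blast
    ultimately show ?thesis by simp
  qed
  have AB: "A \<union> B = V - {x}" "A \<inter> B = {}" using AV by (auto simp: A_def B_def)
  show ?thesis
    unfolding split_op_def graph.sel
  proof (rule exI[of _ x], rule exI[of _ x'], rule exI[of _ A], rule exI[of _ B], intro conjI)
    show "\<forall>a\<in>A. \<forall>b\<in>B. \<not> adj ?G a b" using noadj by blast
    show "\<exists>a\<in>A. adj ?G x a" "\<exists>b\<in>B. adj ?G x b" using ab by blast+
    show "Graph (insert x' V) (g ` E) = Graph (insert x' V)
        ({s \<in> f ` E. s \<subseteq> insert x A} \<union>
         (\<lambda>s. (id(x := x')) ` s) ` {s \<in> f ` E. s \<subseteq> insert x B})"
      by (simp only: A_edges B_edges g_edges)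
  qed (fact cv AB V(2))+
qed

lemma card_vset_le: "multigraph E f \<Longrightarrow> card (vset f E) \<le> 2 * card E"
  using card_UN_le[of E f] by (simp add: multigraph_def mult.commute)

text \<open>Termination: each split adds one vertex incident with an edge, and \<open>card E\<close>
  edges have at most \<open>2 * card E\<close> ends. The clause on \<open>V' - vset g E\<close>
  keeps the isolated vertices, and the one on blocks carries over the matches that reversals have
  produced.\<close>

lemma split_into_blocks:
  fixes f :: "'e \<Rightarrow> 'v set"
  assumes "infinite (UNIV :: 'v set)"
    and "multigraph E f" "inj_on f E" "finite V" "vset f E \<subseteq> V"
  shows "\<exists>g V'. split_op\<^sup>*\<^sup>* (Graph V (f ` E)) (Graph V' (g ` E)) \<and> multigraph E g \<and> inj_on g E \<and>
    finite V' \<and> vset g E \<subseteq> V' \<and> V' - vset g E = V - vset f E \<and> cuts E g = cuts E f \<and>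
    (\<forall>B. block (cuts E f) B \<longrightarrow> B \<subseteq> E \<longrightarrow> labelled_iso B f g) \<and>
    (\<forall>R\<subseteq>E. separator (cuts E f) R \<longrightarrow> vset g R \<inter> vset g (E - R) = {})"
  using assms(2-)
proof (induction "2 * card E - card (vset f E)" arbitrary: f V rule: less_induct)
  case less
  note f = less.prems(1) and inj = less.prems(2) and V = less.prems(3,4)
  show ?case
  proof (cases "\<forall>R\<subseteq>E. separator (cuts E f) R \<longrightarrow> vset f R \<inter> vset f (E - R) = {}")
    case True
    then show ?thesis
      using less.prems by (intro exI[of _ f] exI[of _ V]) (auto intro: labelled_iso_eq)
  next
    case False
    then obtain R0 x where R0: "R0 \<subseteq> E" "separator (cuts E f) R0" "x \<in> vset f R0" "x \<in> vset f (E - R0)"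
      by blast
    obtain R where R: "R \<subseteq> E" "vset f R \<inter> vset f (E - R) \<subseteq> {x}" "x \<in> vset f R" "x \<in> vset f (E - R)"
      using separator_split_vertex[OF f R0(2,1,3,4)] by blast
    obtain x' where x': "x' \<notin> V" using ex_new_if_finite[OF assms(1) V(1)] by blast
    define g where "g e = (if e \<in> R then f e else (id(x := x')) ` f e)" for e
    have s: "vertex_split E f x x' R g"
      unfolding vertex_split_def
    proof (intro conjI ballI)
      show "x' \<notin> vset f E" using x' V(2) by blast
    qed (use R in \<open>simp_all add: g_def\<close>)
    have vg: "vset g E = insert x' (vset f E)" by (rule vertex_split_vset[OF s R(3,4)])
    have mg: "multigraph E g" by (rule vertex_split_multigraph[OF f s])
    have cg: "cuts E g = cuts E f" by (rule vertex_split_cuts[OF f s])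
    have x'f: "x' \<notin> vset f E" using x' V(2) by blast
    have "card (vset g E) = Suc (card (vset f E))"
      unfolding vg using x'f finite_vset[OF f order_refl] by simp
    then have less_card: "2 * card E - card (vset g E) < 2 * card E - card (vset f E)"
      using card_vset_le[OF mg] by simp
    have V': "finite (insert x' V)" "vset g E \<subseteq> insert x' V" unfolding vg using V by auto
    obtain h V' where h: "split_op\<^sup>*\<^sup>* (Graph (insert x' V) (g ` E)) (Graph V' (h ` E))"
      "multigraph E h" "inj_on h E" "finite V'" "vset h E \<subseteq> V'"
      "V' - vset h E = insert x' V - vset g E" "cuts E h = cuts E g"
      "\<forall>B. block (cuts E g) B \<longrightarrow> B \<subseteq> E \<longrightarrow> labelled_iso B g h"
      "\<forall>R\<subseteq>E. separator (cuts E g) R \<longrightarrow> vset h R \<inter> vset h (E - R) = {}"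
      using less.hyps[OF less_card mg vertex_split_inj_on[OF s inj] V'] by (elim exE conjE) (rule that)
    have "split_op (Graph V (f ` E)) (Graph (insert x' V) (g ` E))"
      by (rule split_op_vertex_split[OF f V(2) x' s R(3,4)])
    then have "split_op\<^sup>*\<^sup>* (Graph V (f ` E)) (Graph V' (h ` E))"
      using h(1) by (rule converse_rtranclp_into_rtranclp)
    moreover have "V' - vset h E = V - vset f E"
      unfolding h(6) vg using x' by blast
    moreover have "labelled_iso B f h" if "block (cuts E f) B" "B \<subseteq> E" for B
      using labelled_iso_trans[OF vertex_split_block[OF s that]] h(8) that cg by metis
    ultimately show ?thesis
      using h(2-5,7,9) cg by (intro exI[of _ h] exI[of _ V']) simp
  qed
qed

text \<open>Once the blocks are vertex-disjoint in both multigraphs, their isomorphisms cannot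
  conflict and are glued one block after another.\<close>

lemma labelled_iso_disjoint_blocks:
  assumes f: "multigraph E f" and h: "multigraph E h" and fh: "cuts E f = cuts E h"
    and iso: "\<And>B. block (cuts E f) B \<Longrightarrow> B \<subseteq> E \<Longrightarrow> labelled_iso B f h"
    and df: "\<And>R. R \<subseteq> E \<Longrightarrow> separator (cuts E f) R \<Longrightarrow> vset f R \<inter> vset f (E - R) = {}"
    and dh: "\<And>R. R \<subseteq> E \<Longrightarrow> separator (cuts E f) R \<Longrightarrow> vset h R \<inter> vset h (E - R) = {}"
  shows "labelled_iso E f h"
proof -
  let ?BB = "{B. block (cuts E f) B \<and> B \<subseteq> E}"
  have "labelled_iso (\<Union>A) f h" if "finite A" "A \<subseteq> ?BB" for A
    using that
  proof (induction A)
    case empty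
    then show ?case by (simp add: labelled_iso_def)
  next
    case (insert B A)
    have B: "block (cuts E f) B" "B \<subseteq> E" "separator (cuts E f) B"
      using insert.prems by (auto simp: block_def)
    have "C \<inter> B = {}" if C: "C \<in> A" for C
    proof -
      have C': "block (cuts E f) C" "C \<noteq> B" using insert C by blast+
      then show ?thesis
        using block_subset_or_disjoint[OF C'(1) B(3)] B(1) unfolding block_def by metis
    qed
    then have sub: "\<Union>A \<subseteq> E - B" using insert.prems by blast
    obtain \<rho> where \<rho>: "inj_on \<rho> (vset f B)" "\<And>e. e \<in> B \<Longrightarrow> h e = \<rho> ` f e"
      using iso[OF B(1,2)] unfolding labelled_iso_def by metis
    have "labelled_iso (\<Union>A) f h" using insert.IH insert.prems by simp
    then obtain \<sigma> where \<sigma>: "inj_on \<sigma> (vset f (\<Union>A))" "\<And>e. e \<in> \<Union>A \<Longrightarrow> h e = \<sigma> ` f e"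
      unfolding labelled_iso_def by metis
    have disj: "vset f B \<inter> vset f (\<Union>A) = {}" "vset h B \<inter> vset h (\<Union>A) = {}"
      using df[OF B(2,3)] dh[OF B(2,3)] sub by blast+
    have "labelled_iso (B \<union> \<Union>A) f h"
    proof (rule labelled_iso_glue[OF \<rho> \<sigma>])
      show "\<rho> v = \<sigma> v" if "v \<in> vset f B" "v \<in> vset f (\<Union>A)" for v
        using disj(1) that by (metis IntI empty_iff)
    qed (simp_all only: disj empty_subsetI)
    then show ?case by simp
  qed
  moreover have "finite ?BB" by (rule finite_subset[of _ "Pow E"]) (auto simp: multigraph_finite[OF f])
  ultimately have "labelled_iso (\<Union>?BB) f h" by blast
  moreover have "\<Union>?BB = E"
  proof -
    have "separator (cuts E f) E"
      using cuts_subset unfolding separator_def by (metis inf.absorb1)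
    then have "\<exists>B. block (cuts E f) B \<and> B \<subseteq> E \<and> e \<in> B" if "e \<in> E" for e
      using block_exists[OF multigraph_finite[OF f] _ that order_refl] separator_compl[OF f] by blast
    then show ?thesis by blast
  qed
  ultimately show ?thesis by simp
qed

subsection \<open>Measurement sets and 2-isomorphism\<close>

lemma labelled_iso_lengths_realized:
  fixes d :: "'d::finite itself"
  assumes "multigraph E f" "labelled_iso E f g"
  shows "lengths_realized d E g f"
proof -
  obtain \<rho> where \<rho>: "\<And>e. e \<in> E \<Longrightarrow> g e = \<rho> ` f e"
    using assms(2) unfolding labelled_iso_def by metis
  have "edge_length_sq (q \<circ> \<rho>) (f e) = edge_length_sq q (g e)" if "e \<in> E" for q :: "_ \<Rightarrow> real ^ 'd" and e
    using \<rho>[OF that] assms(1) that by (simp add: edge_length_sq_image multigraph_def)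
  then show ?thesis unfolding lengths_realized_def by metis
qed

lemma labelled_iso_multigraph:
  assumes "multigraph E f" "labelled_iso E f g"
  shows "multigraph E g"
proof -
  obtain \<rho> where \<rho>: "inj_on \<rho> (vset f E)" "\<And>e. e \<in> E \<Longrightarrow> g e = \<rho> ` f e"
    using assms(2) unfolding labelled_iso_def by metis
  have "card (g e) = card (f e)" if "e \<in> E" for e
  proof -
    have "inj_on \<rho> (f e)" using \<rho>(1) by (rule inj_on_subset) (use that in blast)
    then show ?thesis using \<rho>(2)[OF that] by (simp add: card_image)
  qed
  then show ?thesis using assms(1) by (simp add: multigraph_def)
qed

lemma labelled_iso_cuts:
  assumes "multigraph E f" "labelled_iso E f g"
  shows "cuts E g = cuts E f"
  using lengths_realized_cuts_eq[OF labelled_iso_multigraph[OF assms] assms(1)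
      labelled_iso_lengths_realized[OF assms, where d = "TYPE(1)"]
      labelled_iso_lengths_realized[OF labelled_iso_multigraph[OF assms] labelled_iso_sym[OF assms(2)]]] .

text \<open>Measurement isomorphism with both labellings merged into one bijection of the edges. In
  this form it is an equivalence that can be followed through single reversals and splits.\<close>

definition same_lengths :: "'d::finite itself \<Rightarrow> 'a graph \<Rightarrow> 'b graph \<Rightarrow> bool" where
  "same_lengths d \<Gamma> \<Delta> \<longleftrightarrow> (\<exists>\<phi>. bij_betw \<phi> (edges \<Gamma>) (edges \<Delta>) \<and>
     lengths_realized d (edges \<Gamma>) id \<phi> \<and> lengths_realized d (edges \<Gamma>) \<phi> id)"

lemma graph_finite_edges: "graph \<Gamma> \<Longrightarrow> finite (edges \<Gamma>)"
  unfolding graph_def by (rule finite_subset[of _ "Pow (verts \<Gamma>)"]) auto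

lemma graph_multigraph: "graph \<Gamma> \<Longrightarrow> multigraph (edges \<Gamma>) id"
  by (auto simp: multigraph_def graph_finite_edges graph_def)

lemma same_lengths_labelled:
  assumes inj: "inj_on f E" "inj_on g E"
    and fg: "lengths_realized d E f g" and gf: "lengths_realized d E g f"
  shows "same_lengths d (Graph V (f ` E)) (Graph V' (g ` E))"
proof -
  define \<phi> where "\<phi> = g \<circ> inv_into E f"
  have \<phi>: "\<phi> (f e) = g e" if "e \<in> E" for e
    using that inj(1) by (simp add: \<phi>_def inv_into_f_f)
  have "bij_betw \<phi> (f ` E) (g ` E)"
    unfolding \<phi>_def using inj by (intro bij_betw_trans[of _ _ E] bij_betw_inv_into) (auto simp: bij_betw_def)
  moreover have "lengths_realized d (f ` E) id \<phi>" "lengths_realized d (f ` E) \<phi> id"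
    using fg gf by (simp_all add: lengths_realized_def \<phi>)
  ultimately show ?thesis unfolding same_lengths_def by auto
qed

lemma same_lengths_refl: "same_lengths d \<Gamma> \<Gamma>"
  unfolding same_lengths_def lengths_realized_def by (intro exI[of _ id]) auto

lemma same_lengths_sym:
  assumes "same_lengths d \<Gamma> \<Delta>"
  shows "same_lengths d \<Delta> \<Gamma>"
proof -
  obtain \<phi> where \<phi>: "bij_betw \<phi> (edges \<Gamma>) (edges \<Delta>)" "lengths_realized d (edges \<Gamma>) id \<phi>"
    "lengths_realized d (edges \<Gamma>) \<phi> id"
    using assms unfolding same_lengths_def by blast
  have *: "edges \<Delta> = \<phi> ` edges \<Gamma>" "inj_on \<phi> (edges \<Gamma>)" using \<phi>(1) by (auto simp: bij_betw_def)
  show ?thesis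
    using same_lengths_labelled[OF *(2) _ \<phi>(3,2)] *(1) by (simp add: same_lengths_def)
qed

lemma same_lengths_trans:
  assumes "same_lengths d \<Gamma> \<Delta>" "same_lengths d \<Delta> \<Theta>"
  shows "same_lengths d \<Gamma> \<Theta>"
proof -
  obtain \<phi> where \<phi>: "bij_betw \<phi> (edges \<Gamma>) (edges \<Delta>)" "lengths_realized d (edges \<Gamma>) id \<phi>"
    "lengths_realized d (edges \<Gamma>) \<phi> id"
    using assms(1) unfolding same_lengths_def by blast
  obtain \<psi> where \<psi>: "bij_betw \<psi> (edges \<Delta>) (edges \<Theta>)" "lengths_realized d (edges \<Delta>) id \<psi>"
    "lengths_realized d (edges \<Delta>) \<psi> id"
    using assms(2) unfolding same_lengths_def by blast
  have \<Delta>: "edges \<Delta> = \<phi> ` edges \<Gamma>" using \<phi>(1) by (simp add: bij_betw_def)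
  have "lengths_realized d (edges \<Gamma>) \<phi> (\<psi> \<circ> \<phi>)" "lengths_realized d (edges \<Gamma>) (\<psi> \<circ> \<phi>) \<phi>"
    using \<psi>(2,3) unfolding \<Delta> lengths_realized_def by simp_all
  then have "lengths_realized d (edges \<Gamma>) id (\<psi> \<circ> \<phi>)" "lengths_realized d (edges \<Gamma>) (\<psi> \<circ> \<phi>) id"
    using \<phi>(2,3) lengths_realized_trans by metis+
  then show ?thesis
    unfolding same_lengths_def using bij_betw_trans[OF \<phi>(1) \<psi>(1)] by blast
qed

lemma measurement_set_restrict:
  fixes \<Gamma> :: "'a graph" and d :: "'d::finite itself"
  assumes "graph \<Gamma>" "edge_labelling \<Gamma> \<phi>"
  shows "measurement_set d \<Gamma> \<phi> = range (length_sq_map \<Gamma> \<phi> :: ('a \<Rightarrow> real ^ 'd) \<Rightarrow> _)"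
proof -
  have "length_sq_map \<Gamma> \<phi> (restrict p (verts \<Gamma>)) = length_sq_map \<Gamma> \<phi> p" for p :: "'a \<Rightarrow> real ^ 'd"
    unfolding length_sq_map_def
  proof (rule restrict_ext)
    fix i assume "i \<in> {..<card (edges \<Gamma>)}"
    then have "\<phi> i \<in> edges \<Gamma>" using assms(2) by (auto simp: edge_labelling_def bij_betw_def)
    then show "edge_length_sq (restrict p (verts \<Gamma>)) (\<phi> i) = edge_length_sq p (\<phi> i)"
      using assms(1) by (intro edge_length_sq_cong) (auto simp: graph_def)
  qed
  then have "range (length_sq_map \<Gamma> \<phi> :: ('a \<Rightarrow> real ^ 'd) \<Rightarrow> _) \<subseteq> measurement_set d \<Gamma> \<phi>"
    unfolding measurement_set_def by (metis image_subset_iff image_eqI restrict_PiE_iff UNIV_I)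
  then show ?thesis unfolding measurement_set_def by blast
qed

lemma length_sq_map_eq_iff:
  assumes "card (edges \<Gamma>) = card (edges \<Delta>)"
  shows "length_sq_map \<Gamma> \<phi> p = length_sq_map \<Delta> \<psi> q \<longleftrightarrow>
    (\<forall>i<card (edges \<Gamma>). edge_length_sq p (\<phi> i) = edge_length_sq q (\<psi> i))"
  unfolding length_sq_map_def assms by (auto simp: fun_eq_iff restrict_def)

lemma measurement_isomorphic_iff_same_lengths:
  fixes \<Gamma> :: "'a graph" and \<Delta> :: "'b graph" and d :: "'d::finite itself"
  assumes \<Gamma>: "graph \<Gamma>" and \<Delta>: "graph \<Delta>"
  shows "measurement_isomorphic d \<Gamma> \<Delta> \<longleftrightarrow> same_lengths d \<Gamma> \<Delta>"
proof
  assume "measurement_isomorphic d \<Gamma> \<Delta>"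
  then obtain \<phi> \<psi> where card: "card (edges \<Gamma>) = card (edges \<Delta>)"
    and lab: "edge_labelling \<Gamma> \<phi>" "edge_labelling \<Delta> \<psi>"
    and eq: "measurement_set d \<Gamma> \<phi> = measurement_set d \<Delta> \<psi>"
    unfolding measurement_isomorphic_def by blast
  let ?I = "{..<card (edges \<Gamma>)}"
  have *: "edges \<Gamma> = \<phi> ` ?I" "inj_on \<phi> ?I" "edges \<Delta> = \<psi> ` ?I" "inj_on \<psi> ?I"
    using lab card by (auto simp: edge_labelling_def bij_betw_def)
  have r: "range (length_sq_map \<Gamma> \<phi> :: ('a \<Rightarrow> real ^ 'd) \<Rightarrow> _) = range (length_sq_map \<Delta> \<psi> :: ('b \<Rightarrow> real ^ 'd) \<Rightarrow> _)"
    using eq measurement_set_restrict[OF \<Gamma> lab(1), of d] measurement_set_restrict[OF \<Delta> lab(2), of d]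
    by simp
  have "\<exists>q :: 'b \<Rightarrow> real ^ 'd. \<forall>i\<in>?I. edge_length_sq q (\<psi> i) = edge_length_sq p (\<phi> i)" for p :: "'a \<Rightarrow> real ^ 'd"
  proof -
    obtain q :: "'b \<Rightarrow> real ^ 'd" where "length_sq_map \<Gamma> \<phi> p = length_sq_map \<Delta> \<psi> q"
      using r by (metis rangeE rangeI)
    then show ?thesis unfolding length_sq_map_eq_iff[OF card] by (metis lessThan_iff)
  qed
  then have 1: "lengths_realized d ?I \<phi> \<psi>" unfolding lengths_realized_def by blast
  have "\<exists>p :: 'a \<Rightarrow> real ^ 'd. \<forall>i\<in>?I. edge_length_sq p (\<phi> i) = edge_length_sq q (\<psi> i)" for q :: "'b \<Rightarrow> real ^ 'd"
  proof -
    obtain p :: "'a \<Rightarrow> real ^ 'd" where "length_sq_map \<Gamma> \<phi> p = length_sq_map \<Delta> \<psi> q"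
      using r by (metis rangeE rangeI)
    then show ?thesis unfolding length_sq_map_eq_iff[OF card] by (metis lessThan_iff)
  qed
  then have 2: "lengths_realized d ?I \<psi> \<phi>" unfolding lengths_realized_def by blast
  show "same_lengths d \<Gamma> \<Delta>"
    using same_lengths_labelled[OF *(2,4) 1 2] *(1,3) by (simp add: same_lengths_def)
next
  assume "same_lengths d \<Gamma> \<Delta>"
  then obtain \<theta> where \<theta>: "bij_betw \<theta> (edges \<Gamma>) (edges \<Delta>)" "lengths_realized d (edges \<Gamma>) id \<theta>"
    "lengths_realized d (edges \<Gamma>) \<theta> id"
    unfolding same_lengths_def by blast
  have card: "card (edges \<Gamma>) = card (edges \<Delta>)" using bij_betw_same_card[OF \<theta>(1)] .
  obtain \<phi> where \<phi>: "edge_labelling \<Gamma> \<phi>"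
    using ex_bij_betw_nat_finite[OF graph_finite_edges[OF \<Gamma>]]
    by (auto simp: edge_labelling_def atLeast0LessThan)
  have \<psi>: "edge_labelling \<Delta> (\<theta> \<circ> \<phi>)"
    using bij_betw_trans[OF _ \<theta>(1)] \<phi> card by (metis edge_labelling_def)
  have \<phi>E: "\<phi> i \<in> edges \<Gamma>" if "i < card (edges \<Gamma>)" for i
    using \<phi> that by (auto simp: edge_labelling_def bij_betw_def)
  have "range (length_sq_map \<Gamma> \<phi> :: ('a \<Rightarrow> real ^ 'd) \<Rightarrow> _) = range (length_sq_map \<Delta> (\<theta> \<circ> \<phi>) :: ('b \<Rightarrow> real ^ 'd) \<Rightarrow> _)"
  proof (intro subset_antisym image_subsetI)
    fix p :: "'a \<Rightarrow> real ^ 'd"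
    obtain q :: "'b \<Rightarrow> real ^ 'd" where q: "\<forall>s\<in>edges \<Gamma>. edge_length_sq q (\<theta> s) = edge_length_sq p s"
      using \<theta>(2) unfolding lengths_realized_def id_def by blast
    have "length_sq_map \<Gamma> \<phi> p = length_sq_map \<Delta> (\<theta> \<circ> \<phi>) q"
      unfolding length_sq_map_eq_iff[OF card] using q \<phi>E by simp
    then show "length_sq_map \<Gamma> \<phi> p \<in> range (length_sq_map \<Delta> (\<theta> \<circ> \<phi>) :: ('b \<Rightarrow> real ^ 'd) \<Rightarrow> _)"
      by (metis rangeI)
  next
    fix q :: "'b \<Rightarrow> real ^ 'd"
    obtain p :: "'a \<Rightarrow> real ^ 'd" where p: "\<forall>s\<in>edges \<Gamma>. edge_length_sq p s = edge_length_sq q (\<theta> s)"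
      using \<theta>(3) unfolding lengths_realized_def id_def by blast
    have "length_sq_map \<Gamma> \<phi> p = length_sq_map \<Delta> (\<theta> \<circ> \<phi>) q"
      unfolding length_sq_map_eq_iff[OF card] using p \<phi>E by simp
    then show "length_sq_map \<Delta> (\<theta> \<circ> \<phi>) q \<in> range (length_sq_map \<Gamma> \<phi> :: ('a \<Rightarrow> real ^ 'd) \<Rightarrow> _)"
      by (metis rangeI)
  qed
  then have "measurement_set d \<Gamma> \<phi> = measurement_set d \<Delta> (\<theta> \<circ> \<phi>)"
    using measurement_set_restrict[OF \<Gamma> \<phi>, of d] measurement_set_restrict[OF \<Delta> \<psi>, of d] by simp
  then show "measurement_isomorphic d \<Gamma> \<Delta>"
    unfolding measurement_isomorphic_def using card \<phi> \<psi> by blast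
qed

text \<open>A reversal keeps simple graphs simple. If a moved edge \<open>s\<close> coincided with a
  fixed edge \<open>t\<close>, the ends of \<open>t\<close> would lie on both sides, so they would
  be \<open>x\<close> and \<open>y\<close>; the transposition fixes this pair, so \<open>s\<close>
  and \<open>t\<close> had equal ends before.\<close>

lemma twist_inj_on:
  assumes "twist E f g" "inj_on f E" "multigraph E f"
  shows "inj_on g E"
proof -
  obtain S T x y where ST: "S \<union> T = E" "S \<inter> T = {}" "x \<noteq> y"
    and V: "vset f S \<inter> vset f T = {x, y}"
    and gS: "\<And>s. s \<in> S \<Longrightarrow> g s = Transposition.transpose x y ` f s"
    and gT: "\<And>s. s \<in> T \<Longrightarrow> g s = f s"
    using assms(1) unfolding twist_def by metis
  let ?\<tau> = "Transposition.transpose x y"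
  have \<tau>2: "?\<tau> ` ?\<tau> ` s = s" for s by (simp add: image_image)
  have mixed: "s = t" if st: "s \<in> S" "t \<in> T" "g s = g t" for s t
  proof -
    have eq: "f t = ?\<tau> ` f s" using st gS gT by simp
    have "?\<tau> ` vset f S = vset f S" using V by (intro transpose_image_vset) blast+
    moreover have "?\<tau> ` f s \<subseteq> ?\<tau> ` vset f S" using st(1) by blast
    ultimately have "f t \<subseteq> vset f S" using eq by simp
    moreover have "f t \<subseteq> vset f T" using st(2) by blast
    ultimately have "f t \<subseteq> {x, y}" using V by (metis Int_greatest)
    moreover have "t \<in> E" "s \<in> E" using st ST(1) by blast+
    then have "card (f t) = 2" using assms(3) by (simp add: multigraph_def)
    ultimately have "f t = {x, y}" using ST(3) by (intro card_subset_eq) auto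
    then have "?\<tau> ` f t = f t" by (simp add: insert_commute)
    moreover have "f s = ?\<tau> ` f t" using eq \<tau>2 by metis
    ultimately show ?thesis
      using inj_onD[OF assms(2), of s t] \<open>t \<in> E\<close> \<open>s \<in> E\<close> by simp
  qed
  show ?thesis
  proof (rule inj_onI)
    fix s t assume st: "s \<in> E" "t \<in> E" "g s = g t"
    have "f s = f t" if "s \<in> S" "t \<in> S"
      using st(3) gS that \<tau>2 by metis
    moreover have "f s = f t" if "s \<in> T" "t \<in> T"
      using st(3) gT that by metis
    ultimately show "s = t"
      using mixed[of s t] mixed[of t s] st ST(1) inj_onD[OF assms(2)] by (metis UnE)
  qed
qed

lemma graph_labelled:
  "multigraph E f \<Longrightarrow> finite V \<Longrightarrow> vset f E \<subseteq> V \<Longrightarrow> graph (Graph V (f ` E))"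
  by (auto simp: graph_def multigraph_def)

lemma reversal_same_lengths:
  assumes \<Gamma>: "graph \<Gamma>" and r: "reversal \<Gamma> \<Gamma>'"
  shows "graph \<Gamma>'" "same_lengths d \<Gamma> \<Gamma>'"
proof -
  obtain S T x y where ST: "two_separation \<Gamma> S T" "\<Union> S \<inter> \<Union> T = {x, y}"
    and \<Gamma>': "\<Gamma>' = Graph (verts \<Gamma>) ((\<lambda>s. Transposition.transpose x y ` s) ` S \<union> T)"
    using r unfolding reversal_def by metis
  define g where "g s = (if s \<in> S then Transposition.transpose x y ` s else s)" for s
  let ?E = "edges \<Gamma>"
  have E: "S \<union> T = ?E" "S \<inter> T = {}" "card S \<ge> 2" "card T \<ge> 2"
    using ST(1) by (auto simp: two_separation_def)
  have "x \<noteq> y" using ST by (auto simp: two_separation_def)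
  have gT: "g s = s" if "s \<in> T" for s using that E(2) by (auto simp: g_def)
  have m: "multigraph ?E id" by (rule graph_multigraph[OF \<Gamma>])
  have tw: "twist ?E id g"
    unfolding twist_def
    by (rule exI[of _ S], rule exI[of _ T], rule exI[of _ x], rule exI[of _ y])
      (use E ST(2) \<open>x \<noteq> y\<close> gT in \<open>auto simp: g_def\<close>)
  have "g ` S = (\<lambda>s. Transposition.transpose x y ` s) ` S" by (auto simp: g_def)
  moreover have "g ` T = T" using gT by simp
  ultimately have gE: "g ` ?E = (\<lambda>s. Transposition.transpose x y ` s) ` S \<union> T"
    using E(1) by (metis image_Un)
  have "vset g ?E \<subseteq> verts \<Gamma>"
    using twist_vset[OF tw] \<Gamma> by (auto simp: graph_def)
  then show "graph \<Gamma>'"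
    unfolding \<Gamma>' gE[symmetric] using twist_multigraph[OF m tw] \<Gamma>
    by (intro graph_labelled) (auto simp: graph_def)
  have "same_lengths d (Graph (verts \<Gamma>) (id ` ?E)) (Graph (verts \<Gamma>) (g ` ?E))"
    by (intro same_lengths_labelled twist_inj_on[OF tw] twist_lengths_realized[OF m tw]
        twist_lengths_realized[OF twist_multigraph[OF m tw] twist_sym[OF tw]] m) auto
  then show "same_lengths d \<Gamma> \<Gamma>'"
    unfolding \<Gamma>' gE[symmetric] by simp
qed

lemma split_op_same_lengths:
  assumes \<Gamma>: "graph \<Gamma>" and s: "split_op \<Gamma> \<Gamma>'"
  shows "graph \<Gamma>'" "same_lengths d \<Gamma> \<Gamma>'"
proof -
  obtain x x' A B where x: "cut_vertex \<Gamma> x" "x' \<notin> verts \<Gamma>"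
    and AB: "A \<union> B = verts \<Gamma> - {x}" "A \<inter> B = {}"
    and noadj: "\<And>a b. a \<in> A \<Longrightarrow> b \<in> B \<Longrightarrow> \<not> adj \<Gamma> a b"
    and \<Gamma>': "\<Gamma>' = Graph (insert x' (verts \<Gamma>))
      ({s \<in> edges \<Gamma>. s \<subseteq> insert x A} \<union> (\<lambda>s. (id(x := x')) ` s) ` {s \<in> edges \<Gamma>. s \<subseteq> insert x B})"
    using s unfolding split_op_def by blast
  let ?E = "edges \<Gamma>"
  define R where "R = {s \<in> ?E. s \<subseteq> insert x A}"
  define g where "g s = (if s \<in> R then s else (id(x := x')) ` s)" for s
  have m: "multigraph ?E id" by (rule graph_multigraph[OF \<Gamma>])
  have RE: "R \<subseteq> ?E" by (auto simp: R_def)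
  have sV: "s \<subseteq> verts \<Gamma>" if "s \<in> ?E" for s using \<Gamma> that by (simp add: graph_def)
  have xV: "x \<in> verts \<Gamma>" using x(1) by (simp add: cut_vertex_def)
  have side: "s \<subseteq> insert x A \<or> s \<subseteq> insert x B" if s: "s \<in> ?E" for s
  proof -
    obtain u w where uw: "s = {u, w}" using multigraph_ends[OF m s] by (metis id_apply)
    then have "u \<in> insert x (A \<union> B)" "w \<in> insert x (A \<union> B)" using sV[OF s] AB(1) by auto
    moreover have "\<not> adj \<Gamma> u w \<Longrightarrow> False" "\<not> adj \<Gamma> w u \<Longrightarrow> False"
      using s uw by (auto simp: adj_def insert_commute)
    ultimately show ?thesis using noadj[of u w] noadj[of w u] uw by auto
  qed
  have not_both: "s \<notin> R" if s: "s \<in> ?E" "s \<subseteq> insert x B" for s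
  proof
    assume "s \<in> R"
    then have "s \<subseteq> {x}" using s AB(2) by (auto simp: R_def)
    moreover obtain u w where "s = {u, w}" "u \<noteq> w"
      using multigraph_ends[OF m s(1)] by (metis id_apply)
    ultimately show False by auto
  qed
  have ER: "?E - R = {s \<in> ?E. s \<subseteq> insert x B}" using side not_both by (auto simp: R_def)
  have vs: "vertex_split ?E id x x' R g"
    unfolding vertex_split_def
  proof (intro conjI ballI)
    show "R \<subseteq> ?E" by (rule RE)
    show "x' \<notin> vset id ?E" using x(2) sV by auto
    have "vset id R \<subseteq> insert x A" by (auto simp: R_def)
    moreover have "vset id (?E - R) \<subseteq> insert x B" unfolding ER by auto
    ultimately show "vset id R \<inter> vset id (?E - R) \<subseteq> {x}" using AB(2) by blast
  qed (simp_all add: g_def)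
  have "g ` R = R" by (simp add: g_def)
  moreover have "g ` (?E - R) = (\<lambda>s. (id(x := x')) ` s) ` (?E - R)"
    by (intro image_cong refl) (simp add: g_def)
  moreover have "g ` ?E = g ` R \<union> g ` (?E - R)" using RE by blast
  ultimately have gE: "g ` ?E = R \<union> (\<lambda>s. (id(x := x')) ` s) ` {s \<in> ?E. s \<subseteq> insert x B}"
    unfolding ER by simp
  have \<Gamma>'g: "\<Gamma>' = Graph (insert x' (verts \<Gamma>)) (g ` ?E)" unfolding \<Gamma>' gE R_def ..
  have "v \<in> insert x' (verts \<Gamma>)" if v: "v \<in> g s" "s \<in> ?E" for v s
    using v sV[OF v(2)] by (auto simp: g_def split: if_splits)
  then have "vset g ?E \<subseteq> insert x' (verts \<Gamma>)" by blast
  then show "graph \<Gamma>'"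
    unfolding \<Gamma>'g using vertex_split_multigraph[OF m vs] \<Gamma>
    by (intro graph_labelled) (auto simp: graph_def)
  have "same_lengths d (Graph (verts \<Gamma>) (id ` ?E)) (Graph (insert x' (verts \<Gamma>)) (g ` ?E))"
    by (intro same_lengths_labelled vertex_split_inj_on[OF vs]
        vertex_split_lengths_realized[OF m vs]) auto
  then show "same_lengths d \<Gamma> \<Gamma>'" unfolding \<Gamma>'g by simp
qed

lemma reversals_same_lengths:
  assumes "reversal\<^sup>*\<^sup>* \<Gamma> \<Gamma>'" "graph \<Gamma>"
  shows "graph \<Gamma>' \<and> same_lengths d \<Gamma> \<Gamma>'"
  using assms
proof (induction rule: rtranclp_induct)
  case (step \<Delta> \<Theta>)
  then show ?case
    using reversal_same_lengths(1)[OF _ step.hyps(2)] reversal_same_lengths(2)[OF _ step.hyps(2), of d]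
      same_lengths_trans[of d \<Gamma> \<Delta> \<Theta>] by blast
qed (simp add: same_lengths_refl)

lemma splits_same_lengths:
  assumes "split_op\<^sup>*\<^sup>* \<Gamma> \<Gamma>'" "graph \<Gamma>"
  shows "graph \<Gamma>' \<and> same_lengths d \<Gamma> \<Gamma>'"
  using assms
proof (induction rule: rtranclp_induct)
  case (step \<Delta> \<Theta>)
  then show ?case
    using split_op_same_lengths(1)[OF _ step.hyps(2)] split_op_same_lengths(2)[OF _ step.hyps(2), of d]
      same_lengths_trans[of d \<Gamma> \<Delta> \<Theta>] by blast
qed (simp add: same_lengths_refl)

lemma same_lengths_labelled_iso:
  assumes f: "multigraph E f" and inj: "inj_on f E" and iso: "labelled_iso E f g"
  shows "same_lengths d (Graph V (f ` E)) (Graph V' (g ` E))"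
proof (rule same_lengths_labelled[OF inj])
  obtain \<rho> where \<rho>: "inj_on \<rho> (vset f E)" "\<And>e. e \<in> E \<Longrightarrow> g e = \<rho> ` f e"
    using iso unfolding labelled_iso_def by metis
  show "inj_on g E"
  proof (rule inj_onI)
    fix s t assume st: "s \<in> E" "t \<in> E" "g s = g t"
    then have "\<rho> ` f s = \<rho> ` f t" using \<rho>(2) by metis
    moreover have "f s \<subseteq> vset f E" "f t \<subseteq> vset f E" using st by blast+
    ultimately have "f s = f t" using inj_on_image_eq_iff[OF \<rho>(1)] by metis
    then show "s = t" using inj_onD[OF inj] st by blast
  qed
  show "lengths_realized d E g f" by (rule labelled_iso_lengths_realized[OF f iso])
  show "lengths_realized d E f g"
    by (rule labelled_iso_lengths_realized[OF labelled_iso_multigraph[OF f iso] labelled_iso_sym[OF iso]])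
qed

lemma copy_graph_same_lengths:
  assumes \<Gamma>: "graph \<Gamma>"
  shows "graph (copy_graph \<Gamma>)" "same_lengths d \<Gamma> (copy_graph \<Gamma>)"
proof -
  let ?c = "\<lambda>s. (\<lambda>v. (v, 0::nat)) ` s"
  have m: "multigraph (edges \<Gamma>) id" by (rule graph_multigraph[OF \<Gamma>])
  have iso: "labelled_iso (edges \<Gamma>) id ?c"
    by (rule labelled_isoI[of "\<lambda>v. (v, 0)"]) (auto simp: inj_on_def)
  have "vset ?c (edges \<Gamma>) \<subseteq> (\<lambda>v. (v, 0)) ` verts \<Gamma>" using \<Gamma> by (auto simp: graph_def)
  then show "graph (copy_graph \<Gamma>)"
    unfolding copy_graph_def using labelled_iso_multigraph[OF m iso] \<Gamma>
    by (intro graph_labelled) (auto simp: graph_def)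
  show "same_lengths d \<Gamma> (copy_graph \<Gamma>)"
    using same_lengths_labelled_iso[OF m _ iso, of d] unfolding copy_graph_def
    by (simp add: same_lengths_def)
qed

lemma isomorphic_same_lengths:
  assumes \<Gamma>: "graph \<Gamma>" and \<Delta>: "graph \<Delta>" and "isomorphic \<Gamma> \<Delta>"
  shows "same_lengths d \<Gamma> \<Delta>"
proof -
  obtain \<rho> where bij: "bij_betw \<rho> (verts \<Gamma>) (verts \<Delta>)"
    and adj: "\<And>x y. x \<in> verts \<Gamma> \<Longrightarrow> y \<in> verts \<Gamma> \<Longrightarrow> {x, y} \<in> edges \<Gamma> \<longleftrightarrow> {\<rho> x, \<rho> y} \<in> edges \<Delta>"
    using assms(3) unfolding isomorphic_def by blast
  have m: "multigraph (edges \<Gamma>) id" "multigraph (edges \<Delta>) id"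
    by (rule graph_multigraph[OF \<Gamma>], rule graph_multigraph[OF \<Delta>])
  have V: "\<And>s. s \<in> edges \<Gamma> \<Longrightarrow> s \<subseteq> verts \<Gamma>" "\<And>s. s \<in> edges \<Delta> \<Longrightarrow> s \<subseteq> verts \<Delta>"
    using \<Gamma> \<Delta> by (auto simp: graph_def)
  have edges: "edges \<Delta> = (`) \<rho> ` edges \<Gamma>"
  proof (intro subset_antisym subsetI)
    fix s assume s: "s \<in> edges \<Delta>"
    then obtain u w where uw: "s = {u, w}" using multigraph_ends[OF m(2)] by (metis id_apply)
    then have "u \<in> \<rho> ` verts \<Gamma>" "w \<in> \<rho> ` verts \<Gamma>"
      using V(2)[OF s] bij by (auto simp: bij_betw_def)
    then obtain x y where xy: "x \<in> verts \<Gamma>" "y \<in> verts \<Gamma>" "u = \<rho> x" "w = \<rho> y" by blast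
    then have "{x, y} \<in> edges \<Gamma>" using adj s uw by blast
    then show "s \<in> (`) \<rho> ` edges \<Gamma>" using xy uw by (intro image_eqI[of _ _ "{x, y}"]) auto
  next
    fix s assume "s \<in> (`) \<rho> ` edges \<Gamma>"
    then obtain t where t: "t \<in> edges \<Gamma>" "s = \<rho> ` t" by blast
    obtain u w where "t = {u, w}" using multigraph_ends[OF m(1) t(1)] by (metis id_apply)
    then show "s \<in> edges \<Delta>" using adj[of u w] V(1)[OF t(1)] t by auto
  qed
  have "inj_on \<rho> (vset id (edges \<Gamma>))"
    using bij by (rule inj_on_subset[OF bij_betw_imp_inj_on]) (use V(1) in auto)
  then have "labelled_iso (edges \<Gamma>) id ((`) \<rho>)" by (rule labelled_isoI) simp
  then show ?thesis
    using same_lengths_labelled_iso[OF m(1), of "(`) \<rho>" d] edges by (simp add: same_lengths_def)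
qed

lemma two_isomorphic_same_lengths:
  assumes \<Gamma>: "graph \<Gamma>" and \<Delta>: "graph \<Delta>" and "two_isomorphic \<Gamma> \<Delta>"
  shows "same_lengths d \<Gamma> \<Delta>"
proof -
  obtain \<Gamma>1 \<Delta>1 \<Gamma>2 \<Delta>2 where *: "reversal\<^sup>*\<^sup>* \<Gamma> \<Gamma>1" "reversal\<^sup>*\<^sup>* \<Delta> \<Delta>1"
    "split_op\<^sup>*\<^sup>* (copy_graph \<Gamma>1) \<Gamma>2" "split_op\<^sup>*\<^sup>* (copy_graph \<Delta>1) \<Delta>2" "isomorphic \<Gamma>2 \<Delta>2"
    using assms(3) unfolding two_isomorphic_def one_isomorphic_def by blast
  have \<Gamma>1: "graph \<Gamma>1" "same_lengths d \<Gamma> \<Gamma>1" using reversals_same_lengths[OF *(1) \<Gamma>] by auto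
  have \<Delta>1: "graph \<Delta>1" "same_lengths d \<Delta> \<Delta>1" using reversals_same_lengths[OF *(2) \<Delta>] by auto
  note c\<Gamma> = copy_graph_same_lengths[OF \<Gamma>1(1)] and c\<Delta> = copy_graph_same_lengths[OF \<Delta>1(1)]
  have \<Gamma>2: "graph \<Gamma>2" "same_lengths d (copy_graph \<Gamma>1) \<Gamma>2"
    using splits_same_lengths[OF *(3) c\<Gamma>(1)] by auto
  have \<Delta>2: "graph \<Delta>2" "same_lengths d (copy_graph \<Delta>1) \<Delta>2"
    using splits_same_lengths[OF *(4) c\<Delta>(1)] by auto
  have "same_lengths d \<Gamma> \<Gamma>2"
    by (rule same_lengths_trans[OF \<Gamma>1(2) same_lengths_trans[OF c\<Gamma>(2) \<Gamma>2(2)]])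
  moreover have "same_lengths d \<Gamma>2 \<Delta>2"
    by (rule isomorphic_same_lengths[OF \<Gamma>2(1) \<Delta>2(1) *(5)])
  moreover have "same_lengths d \<Delta>2 \<Delta>"
    by (rule same_lengths_sym[OF same_lengths_trans[OF \<Delta>1(2) same_lengths_trans[OF c\<Delta>(2) \<Delta>2(2)]]])
  ultimately show ?thesis by (meson same_lengths_trans)
qed

section \<open>From labelled multigraphs back to graphs\<close>

lemma twists_reversals:
  assumes "(twist E)\<^sup>*\<^sup>* f g" "multigraph E f" "inj_on f E"
  shows "reversal\<^sup>*\<^sup>* (Graph V (f ` E)) (Graph V (g ` E)) \<and> multigraph E g \<and> inj_on g E \<and>
    vset g E = vset f E"
  using assms
proof (induction rule: rtranclp_induct)
  case (step g h)
  then have g: "reversal\<^sup>*\<^sup>* (Graph V (f ` E)) (Graph V (g ` E))" "multigraph E g" "inj_on g E"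
    "vset g E = vset f E" by blast+
  obtain S T x y where ST: "S \<union> T = E" "S \<inter> T = {}" "card S \<ge> 2" "card T \<ge> 2" "x \<noteq> y"
    and V: "vset g S \<inter> vset g T = {x, y}"
    and hS: "\<And>s. s \<in> S \<Longrightarrow> h s = Transposition.transpose x y ` g s"
    and hT: "\<And>s. s \<in> T \<Longrightarrow> h s = g s"
    using step.hyps(2) unfolding twist_def by metis
  have sub: "S \<subseteq> E" "T \<subseteq> E" using ST(1) by auto
  have "reversal (Graph V (g ` E)) (Graph V (h ` E))"
    unfolding reversal_def
  proof (rule exI[of _ "g ` S"], rule exI[of _ "g ` T"], rule exI[of _ x], rule exI[of _ y],
      intro conjI)
    show "vset g S \<inter> vset g T = {x, y}" by (rule V)
    have "card (g ` S) = card S" "card (g ` T) = card T"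
      using inj_on_subset[OF g(3)] sub by (auto intro: card_image)
    moreover have "g ` S \<inter> g ` T = {}"
      using inj_on_image_Int[OF g(3) sub] ST(2) by simp
    moreover have "g ` S \<union> g ` T = g ` E" using ST(1) by blast
    ultimately show "two_separation (Graph V (g ` E)) (g ` S) (g ` T)"
      using ST(3-5) V by (simp add: two_separation_def)
    have "h ` S = (\<lambda>s. Transposition.transpose x y ` s) ` g ` S"
      unfolding image_image using hS by (intro image_cong) auto
    moreover have "h ` T = g ` T" using hT by (intro image_cong) auto
    ultimately have "h ` E = (\<lambda>s. Transposition.transpose x y ` s) ` g ` S \<union> g ` T"
      using ST(1) by (metis image_Un)
    then show "Graph V (h ` E) = Graph (verts (Graph V (g ` E)))
        ((\<lambda>s. Transposition.transpose x y ` s) ` g ` S \<union> g ` T)" by simp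
  qed
  moreover have "vset h E = vset f E" using twist_vset[OF step.hyps(2)] g(4) by simp
  ultimately show ?case
    using g twist_multigraph[OF g(2) step.hyps(2)] twist_inj_on[OF step.hyps(2) g(3,2)]
    by (meson rtranclp.rtrancl_into_rtrancl)
qed simp

text \<open>\<open>labelled_iso\<close> knows only vertices on edges; the isolated ones are equally
  many and are matched by an arbitrary bijection.\<close>

lemma isomorphic_labelled_iso:
  assumes f: "multigraph E f" and iso: "labelled_iso E f h"
    and V: "finite V" "vset f E \<subseteq> V" and V': "finite V'" "vset h E \<subseteq> V'"
    and card: "card (V - vset f E) = card (V' - vset h E)"
  shows "isomorphic (Graph V (f ` E)) (Graph V' (h ` E))"
proof -
  obtain \<rho> where \<rho>: "inj_on \<rho> (vset f E)" "\<And>e. e \<in> E \<Longrightarrow> h e = \<rho> ` f e"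
    using iso unfolding labelled_iso_def by metis
  obtain \<pi> where \<pi>: "bij_betw \<pi> (V - vset f E) (V' - vset h E)"
    using finite_same_card_bij[OF _ _ card] V(1) V'(1) by blast
  define A where "A = vset f E"
  have A: "A \<subseteq> V" "inj_on \<rho> A" "\<And>e. e \<in> E \<Longrightarrow> f e \<subseteq> A" using V(2) \<rho>(1) by (auto simp: A_def)
  have hA: "vset h E = \<rho> ` A" unfolding A_def image_UN using \<rho>(2) by simp
  let ?\<sigma> = "\<lambda>v. if v \<in> A then \<rho> v else \<pi> v"
  have "bij_betw \<pi> (V - A) (V' - \<rho> ` A)" using \<pi> unfolding hA A_def[symmetric] .
  then have "bij_betw ?\<sigma> (A \<union> (V - A)) (\<rho> ` A \<union> (V' - \<rho> ` A))"
    by (intro bij_betw_disjoint_Un) (use A(2) in \<open>auto simp: bij_betw_def\<close>)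
  moreover have "A \<union> (V - A) = V" "\<rho> ` A \<union> (V' - \<rho> ` A) = V'" using A(1) V'(2) hA by auto
  ultimately have bij: "bij_betw ?\<sigma> V V'" by metis
  have he: "h e = ?\<sigma> ` f e" if "e \<in> E" for e
  proof -
    have "?\<sigma> ` f e = \<rho> ` f e" using A(3)[OF that] by (intro image_cong) auto
    then show ?thesis using \<rho>(2)[OF that] by simp
  qed
  have "{x, y} \<in> f ` E \<longleftrightarrow> {?\<sigma> x, ?\<sigma> y} \<in> h ` E" if xy: "x \<in> V" "y \<in> V" for x y
  proof
    assume "{x, y} \<in> f ` E"
    then obtain e where e: "e \<in> E" "f e = {x, y}" by auto
    then have "h e = {?\<sigma> x, ?\<sigma> y}" using he[OF e(1)] by simp
    then show "{?\<sigma> x, ?\<sigma> y} \<in> h ` E" using e(1) by (metis imageI)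
  next
    assume "{?\<sigma> x, ?\<sigma> y} \<in> h ` E"
    then obtain e where e: "e \<in> E" "{?\<sigma> x, ?\<sigma> y} = h e" by (metis imageE)
    then have "?\<sigma> ` {x, y} = ?\<sigma> ` f e" unfolding he[OF e(1)] by (simp only: image_insert image_empty)
    moreover have "f e \<subseteq> V" "{x, y} \<subseteq> V" using A(1,3) e(1) xy by auto
    ultimately have "{x, y} = f e"
      using inj_on_image_eq_iff[OF bij_betw_imp_inj_on[OF bij]] by metis
    then show "{x, y} \<in> f ` E" using e(1) by (metis imageI)
  qed
  then show ?thesis unfolding isomorphic_def graph.sel using bij by (intro exI[of _ ?\<sigma>]) blast
qed

text \<open>On the copies, pairs with a natural number supply the fresh vertices. As the vertex type
  changes, only the number of isolated vertices can be compared.\<close>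

lemma split_copy_into_blocks:
  fixes k :: "'e \<Rightarrow> 'v set"
  assumes k: "multigraph E k" "inj_on k E" "finite V" "vset k E \<subseteq> V"
  shows "\<exists>g V'. split_op\<^sup>*\<^sup>* (copy_graph (Graph V (k ` E))) (Graph V' (g ` E)) \<and> multigraph E g \<and>
      finite V' \<and> vset g E \<subseteq> V' \<and> card (V' - vset g E) = card (V - vset k E) \<and> cuts E g = cuts E k \<and>
      (\<forall>B. block (cuts E k) B \<longrightarrow> B \<subseteq> E \<longrightarrow> labelled_iso B k g) \<and>
      (\<forall>R\<subseteq>E. separator (cuts E k) R \<longrightarrow> vset g R \<inter> vset g (E - R) = {})"
proof -
  let ?c = "\<lambda>v::'v. (v, 0::nat)"
  define k' where "k' e = ?c ` k e" for e
  have inj: "inj ?c" by (simp add: inj_on_def)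
  have iso: "labelled_iso E k k'"
    by (rule labelled_isoI[of ?c]) (auto simp: k'_def intro: inj_on_subset[OF inj])
  have m': "multigraph E k'" by (rule labelled_iso_multigraph[OF k(1) iso])
  have cuts: "cuts E k' = cuts E k" by (rule labelled_iso_cuts[OF k(1) iso])
  have inj': "inj_on k' E"
    using k(2) unfolding k'_def inj_on_def inj_image_eq_iff[OF inj] .
  have vk': "vset k' E = ?c ` vset k E" unfolding k'_def by (simp add: image_UN)
  have V: "finite (?c ` V)" "vset k' E \<subseteq> ?c ` V"
    using k(3,4) unfolding vk' by (simp_all add: image_mono)
  have cg: "copy_graph (Graph V (k ` E)) = Graph (?c ` V) (k' ` E)"
    by (simp add: copy_graph_def k'_def image_image)
  have inf: "infinite (UNIV :: ('v \<times> nat) set)" by (simp add: finite_prod)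
  obtain g V' where g: "split_op\<^sup>*\<^sup>* (Graph (?c ` V) (k' ` E)) (Graph V' (g ` E))"
    "multigraph E g" "inj_on g E" "finite V'" "vset g E \<subseteq> V'"
    "V' - vset g E = ?c ` V - vset k' E" "cuts E g = cuts E k'"
    "\<forall>B. block (cuts E k') B \<longrightarrow> B \<subseteq> E \<longrightarrow> labelled_iso B k' g"
    "\<forall>R\<subseteq>E. separator (cuts E k') R \<longrightarrow> vset g R \<inter> vset g (E - R) = {}"
    using split_into_blocks[OF inf m' inj' V] by (elim exE conjE) (rule that)
  have "?c ` V - vset k' E = ?c ` (V - vset k E)"
    unfolding vk' using inj by (rule image_set_diff[symmetric])
  then have "card (V' - vset g E) = card (V - vset k E)"
    unfolding g(6) using inj by (simp add: card_image inj_on_subset)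
  moreover have "labelled_iso B k g" if "block (cuts E k) B" "B \<subseteq> E" for B
    using labelled_iso_trans[OF labelled_iso_subset[OF iso that(2)]] g(8) that cuts by metis
  ultimately show ?thesis
    unfolding cg using g cuts by (intro exI[of _ g] exI[of _ V']) simp
qed

text \<open>The edges of \<open>\<Gamma>\<close> serve as common labels: the two graphs become
  \<open>id\<close> and the given bijection \<open>\<phi>\<close>, and equal lengths mean equal
  cuts. Reversals then match the blocks, and splits detach them from each other.\<close>

lemma same_lengths_two_isomorphic:
  fixes \<Gamma> :: "'a graph" and \<Delta> :: "'b graph"
  assumes \<Gamma>: "graph \<Gamma>" and \<Delta>: "graph \<Delta>"
    and iso: "card (isolated_verts \<Gamma>) = card (isolated_verts \<Delta>)"
    and "same_lengths d \<Gamma> \<Delta>"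
  shows "two_isomorphic \<Gamma> \<Delta>"
proof -
  obtain \<phi> where \<phi>: "bij_betw \<phi> (edges \<Gamma>) (edges \<Delta>)" "lengths_realized d (edges \<Gamma>) id \<phi>"
    "lengths_realized d (edges \<Gamma>) \<phi> id"
    using assms(4) unfolding same_lengths_def by blast
  define E where "E = edges \<Gamma>"
  have E: "id ` E = edges \<Gamma>" "\<phi> ` E = edges \<Delta>" "inj_on \<phi> E" "inj_on id E"
    using \<phi>(1) by (auto simp: E_def bij_betw_def)
  have m: "multigraph E id" "multigraph E \<phi>"
    using graph_multigraph[OF \<Gamma>] graph_multigraph[OF \<Delta>] E(2)
    by (auto simp: E_def multigraph_def)
  have "cuts E id = cuts E \<phi>"
    using \<phi>(2,3) unfolding E_def[symmetric] by (rule lengths_realized_cuts_eq[OF m])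
  then obtain f h where f: "(twist E)\<^sup>*\<^sup>* id f" and h: "(twist E)\<^sup>*\<^sup>* \<phi> h"
    and blocks: "\<And>B. block (cuts E id) B \<Longrightarrow> B \<subseteq> E \<Longrightarrow> labelled_iso B f h"
    using whitney_blocks[OF m] by blast
  have f1: "reversal\<^sup>*\<^sup>* \<Gamma> (Graph (verts \<Gamma>) (f ` E))" "multigraph E f" "inj_on f E"
    "vset f E = \<Union> (edges \<Gamma>)" "cuts E f = cuts E id"
    using twists_reversals[OF f m(1) E(4), of "verts \<Gamma>"] twist_preserves[OF f m(1)] E(1) by auto
  have h1: "reversal\<^sup>*\<^sup>* \<Delta> (Graph (verts \<Delta>) (h ` E))" "multigraph E h" "inj_on h E"
    "vset h E = \<Union> (edges \<Delta>)" "cuts E h = cuts E id"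
    using twists_reversals[OF h m(2) E(3), of "verts \<Delta>"] twist_preserves[OF h m(2)] E(2)
      \<open>cuts E id = cuts E \<phi>\<close> by auto
  have V: "finite (verts \<Gamma>)" "vset f E \<subseteq> verts \<Gamma>" "finite (verts \<Delta>)" "vset h E \<subseteq> verts \<Delta>"
    using \<Gamma> \<Delta> unfolding f1(4) h1(4) graph_def by auto
  obtain f2 V1 where f2: "split_op\<^sup>*\<^sup>* (copy_graph (Graph (verts \<Gamma>) (f ` E))) (Graph V1 (f2 ` E))"
    "multigraph E f2" "finite V1" "vset f2 E \<subseteq> V1" "card (V1 - vset f2 E) = card (verts \<Gamma> - vset f E)"
    "cuts E f2 = cuts E f" "\<forall>B. block (cuts E f) B \<longrightarrow> B \<subseteq> E \<longrightarrow> labelled_iso B f f2"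
    "\<forall>R\<subseteq>E. separator (cuts E f) R \<longrightarrow> vset f2 R \<inter> vset f2 (E - R) = {}"
    using split_copy_into_blocks[OF f1(2,3) V(1,2)] by (elim exE conjE) (rule that)
  obtain h2 V2 where h2: "split_op\<^sup>*\<^sup>* (copy_graph (Graph (verts \<Delta>) (h ` E))) (Graph V2 (h2 ` E))"
    "multigraph E h2" "finite V2" "vset h2 E \<subseteq> V2" "card (V2 - vset h2 E) = card (verts \<Delta> - vset h E)"
    "cuts E h2 = cuts E h" "\<forall>B. block (cuts E h) B \<longrightarrow> B \<subseteq> E \<longrightarrow> labelled_iso B h h2"
    "\<forall>R\<subseteq>E. separator (cuts E h) R \<longrightarrow> vset h2 R \<inter> vset h2 (E - R) = {}"
    using split_copy_into_blocks[OF h1(2,3) V(3,4)] by (elim exE conjE) (rule that)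
  have "labelled_iso E f2 h2"
  proof (rule labelled_iso_disjoint_blocks[OF f2(2) h2(2)])
    show "cuts E f2 = cuts E h2" using f2(6) h2(6) f1(5) h1(5) by simp
    show "labelled_iso B f2 h2" if B: "block (cuts E f2) B" "B \<subseteq> E" for B
    proof -
      have "labelled_iso B f f2" using f2(6,7) B by simp
      moreover have "labelled_iso B f h" using blocks B f2(6) f1(5) by simp
      moreover have "labelled_iso B h h2" using h2(7) B f2(6) f1(5) h1(5) by simp
      ultimately show ?thesis by (meson labelled_iso_sym labelled_iso_trans)
    qed
    show "vset f2 R \<inter> vset f2 (E - R) = {}" if "R \<subseteq> E" "separator (cuts E f2) R" for R
      using f2(6,8) that by metis
    show "vset h2 R \<inter> vset h2 (E - R) = {}" if "R \<subseteq> E" "separator (cuts E f2) R" for R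
      using h2(8) f2(6) f1(5) h1(5) that by metis
  qed
  moreover have "card (V1 - vset f2 E) = card (V2 - vset h2 E)"
    using iso f2(5) h2(5) unfolding f1(4) h1(4) isolated_verts_def by simp
  ultimately have "isomorphic (Graph V1 (f2 ` E)) (Graph V2 (h2 ` E))"
    using f2 h2 by (intro isomorphic_labelled_iso)
  then show ?thesis
    unfolding two_isomorphic_def one_isomorphic_def
    using f1(1) h1(1) f2(1) h2(1) by blast
qed

theorem theorem1:
  fixes \<Gamma> :: "'a graph" and \<Delta> :: "'b graph"
  assumes "graph \<Gamma>" and "graph \<Delta>"
    and "card (isolated_verts \<Gamma>) = card (isolated_verts \<Delta>)"
  shows "measurement_isomorphic TYPE('d::finite) \<Gamma> \<Delta> \<longleftrightarrow> two_isomorphic \<Gamma> \<Delta>"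
  using measurement_isomorphic_iff_same_lengths[OF assms(1,2)] same_lengths_two_isomorphic[OF assms]
    two_isomorphic_same_lengths[OF assms(1,2)] by blast

end
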